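(* Let $0<b<\infty$, let $q\in L^1(0,b)$ be real-valued, let $h\in\mathbb{R}\cup\{\infty\}$, and let $m$ be the $m$-function of the potential $(q,b,h)$. Then there is a measurable function $A$ on $(0,2b)$, integrable on $(0,a)$ for each $a<2b$, such that for every $0<a<2b$, as $\kappa\to\infty$, $$m(-\kappa^2)=-\kappa-\int_0^aA(\alpha)e^{-2\alpha\kappa}\,d\alpha-A_1\kappa e^{-2\kappa b}-B_1e^{-2\kappa b}+\tilde O(e^{-2a\kappa}),$$ where (a) if $h=\infty$, then $A_1=2$ and $B_1=-2\int_0^bq(y)\,dy$; (b) if $|h|<\infty$, then $A_1=-2$ and $B_1=2\left[2h+\int_0^bq(y)\,dy\right]$.
   Context: For $0<b<\infty$, real-valued $q\in L^1(0,b)$ and $h\in\mathbb{R}\cup\{\infty\}$, consider $-u''+qu=zu$ on $(0,b)$ with the boundary condition $u'(b)+hu(b)=0$ ($h=\infty$ means $u(b)=0$). Let $u(x,z)$ be the (unique up to a constant) nonzero solution satisfying this boundary condition at $b$. The $m$-function is $m(z)=u'(0,z)/u(0,z)$, defined in particular for $z=-\kappa^2$ with $\kappa>0$ sufficiently large. Notation: if $g\to0$ as $x\to x_0$, then $f=\tilde O(g)$ as $x\to x_0$ means $\lim_{x\to x_0}|f(x)|/|g(x)|^{1-\varepsilon}=0$ for every $\varepsilon>0$. *)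

theory Defs
  imports "HOL-Analysis.Analysis"
begin

text \<open>Absolute continuity of a function on a set of reals, tested on finite families \<open>d\<close> of
  non-overlapping compact intervals contained in \<open>S\<close>.\<close>

definition absolutely_continuous_on :: "real set \<Rightarrow> (real \<Rightarrow> 'a::real_normed_vector) \<Rightarrow> bool" where
  "absolutely_continuous_on S f \<longleftrightarrow>
     (\<forall>\<epsilon>>0. \<exists>\<delta>>0. \<forall>d. d division_of \<Union>d \<and> \<Union>d \<subseteq> S \<and> (\<Sum>K\<in>d. Sup K - Inf K) < \<delta> \<longrightarrow>
        (\<Sum>K\<in>d. norm (f (Sup K) - f (Inf K))) < \<epsilon>)"

text \<open>\<open>u\<close> solves \<open>- u'' + q u = z u\<close> on \<open>(0,b)\<close> with derivative \<open>u'\<close>, in the sense appropriate to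
  \<open>q \<in> L\<^sup>1(0,b)\<close>: \<open>u'\<close> is absolutely continuous and the equation holds almost everywhere. As \<open>q\<close> is
  integrable up to both endpoints, \<open>u\<close> and \<open>u'\<close> extend continuously to \<open>[0,b]\<close>; derivatives at the
  endpoints are one-sided.\<close>

definition schroedinger_solution ::
  "(real \<Rightarrow> real) \<Rightarrow> real \<Rightarrow> complex \<Rightarrow> (real \<Rightarrow> complex) \<Rightarrow> (real \<Rightarrow> complex) \<Rightarrow> bool" where
  "schroedinger_solution q b z u u' \<longleftrightarrow>
     (\<forall>x\<in>{0..b}. (u has_vector_derivative u' x) (at x within {0..b})) \<and>
     absolutely_continuous_on {0..b} u' \<and>
     (AE x in lebesgue. x \<in> {0<..<b} \<longrightarrow>
        (\<exists>u''. (u' has_vector_derivative u'') (at x) \<and>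
               - u'' + complex_of_real (q x) * u x = z * u x))"

text \<open>The parameter \<open>h \<in> \<real> \<union> {\<infinity>}\<close> (a single, unsigned infinity).\<close>

datatype bc_param = Finite_h real | Infinite_h

fun boundary_condition ::
  "real \<Rightarrow> bc_param \<Rightarrow> (real \<Rightarrow> complex) \<Rightarrow> (real \<Rightarrow> complex) \<Rightarrow> bool" where
  "boundary_condition b (Finite_h h) u u' \<longleftrightarrow> u' b + complex_of_real h * u b = 0"
| "boundary_condition b Infinite_h u u' \<longleftrightarrow> u b = 0"

text \<open>The nonzero solution satisfying the boundary condition is unique up to a constant factor, which
  cancels in the quotient. Where \<open>u(0,z) = 0\<close> the value is \<open>0\<close>, by the convention for division.\<close>

definition m_function :: "(real \<Rightarrow> real) \<Rightarrow> real \<Rightarrow> bc_param \<Rightarrow> complex \<Rightarrow> complex" where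
  "m_function q b h z =
     (THE w. \<exists>u u'. schroedinger_solution q b z u u' \<and> boundary_condition b h u u' \<and>
        (\<exists>x\<in>{0..b}. u x \<noteq> 0) \<and> w = u' 0 / u 0)"

text \<open>The class of \<open>f\<close> with \<open>f = O~(g)\<close> along the filter \<open>F\<close>; meant for \<open>g\<close> tending to \<open>0\<close>
  along \<open>F\<close>.\<close>

definition tilde_bigo ::
  "'a filter \<Rightarrow> ('a \<Rightarrow> 'c::real_normed_vector) \<Rightarrow> ('a \<Rightarrow> 'b::real_normed_vector) set" where
  "tilde_bigo F g = {f. \<forall>\<epsilon>>0. ((\<lambda>x. norm (f x) / norm (g x) powr (1 - \<epsilon>)) \<longlongrightarrow> 0) F}"

fun coeff_A1 :: "bc_param \<Rightarrow> real" where
  "coeff_A1 Infinite_h = 2"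
| "coeff_A1 (Finite_h h) = -2"

fun coeff_B1 :: "(real \<Rightarrow> real) \<Rightarrow> real \<Rightarrow> bc_param \<Rightarrow> real" where
  "coeff_B1 q b Infinite_h = - 2 * (LINT y:{0<..<b}|lebesgue. q y)"
| "coeff_B1 q b (Finite_h h) = 2 * (2 * h + (LINT y:{0<..<b}|lebesgue. q y))"

end

theory Submission
  imports Defs
begin

text \<open>Write the solutions of \<open>- u'' + q u = - \<kappa>\<^sup>2 u\<close> with Cauchy data \<open>(1, - \<kappa>)\<close> and \<open>(1, \<kappa>)\<close> at
  \<open>b\<close> as \<open>exp (\<kappa> * (b - x))\<close> times the solutions \<open>p\<close> and \<open>s\<close> of a Volterra equation with kernel
  \<open>(1 - exp (- 2 * \<kappa> * (y - x))) / (2 * \<kappa>)\<close>. This kernel is the Laplace transform, in the variable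
  \<open>2 * \<kappa>\<close>, of the indicator of \<open>[0, y - x]\<close>, so the Volterra series converges inside the algebra of Laplace
  transforms of weighted \<open>L\<^sup>1\<close> kernels, which is also closed under \<open>F \<mapsto> 1 / (1 + F) - 1\<close> for small
  \<open>F\<close>. The boundary condition selects the combination \<open>p + \<rho> s\<close>, with \<open>\<rho> = - 1\<close> for \<open>h = \<infinity>\<close> and
  \<open>\<rho> = (\<kappa> - h) / (\<kappa> + h)\<close> otherwise, and constancy of the Wronskian gives, at \<open>x = 0\<close>,
  \<open>m = - \<kappa> - n / p + 2 * \<kappa> * \<rho> * exp (- 2 * \<kappa> * b) / (p * (p + \<rho> * s))\<close>, where \<open>n\<close> is such a Laplace
  transform. Expanding the last term in \<open>1 / \<kappa>\<close> inside the algebra yields \<open>A\<^sub>1\<close>, \<open>B\<^sub>1\<close>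
  and the kernel \<open>A\<close>.\<close>

section \<open>Absolute continuity and the fundamental theorem of calculus\<close>

text \<open>A constant is the transform of a point mass at \<alpha> = 0 and a factor \<kappa> that
  of the derivative of one, so neither lies in the algebra. Every quantity is therefore kept as an
  explicit constant or multiple of \<kappa> plus the transform of an integrable kernel. In the
  reflected term the transforms are merely shifted by \<open>b\<close> and disappear into
  \<open>A\<close>; the singular part at \<alpha> = b cannot, and this is what the coefficients
  \<open>A\<^sub>1\<close> and \<open>B\<^sub>1\<close> record. The next reflection, at \<alpha> =
  2b, is not resolved: it costs \<open>\<kappa> * exp (- 4 * \<kappa> * b)\<close>, which is of
  order \<open>exp (- 2 * a * \<kappa>)\<close> exactly when a < 2b. Since \<open>q\<close> is only
  integrable, solutions satisfy the equation almost everywhere, and constancy of Wronskians rests on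
  the fundamental theorem for absolutely continuous functions. The value of the m-function is well
  defined because a solution with zero Cauchy data vanishes; this is obtained by dividing by the
  solution built from \<open>p\<close>, which is positive for large \<kappa>.\<close>

lemma absolutely_continuous_onD:
  assumes "absolutely_continuous_on S f" "\<epsilon> > 0"
  obtains \<delta> where "\<delta> > 0"
    "\<forall>d. d division_of \<Union>d \<longrightarrow> \<Union>d \<subseteq> S \<longrightarrow> (\<Sum>K\<in>d. Sup K - Inf K) < \<delta> \<longrightarrow>
      (\<Sum>K\<in>d. norm (f (Sup K) - f (Inf K))) < \<epsilon>"
  proof -
  obtain \<delta> where "\<delta> > 0" "\<forall>d. d division_of \<Union>d \<and> \<Union>d \<subseteq> S \<and> (\<Sum>K\<in>d. Sup K - Inf K) < \<delta> \<longrightarrow>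
        (\<Sum>K\<in>d. norm (f (Sup K) - f (Inf K))) < \<epsilon>"
    using assms unfolding absolutely_continuous_on_def by (elim allE[of _ \<epsilon>]) auto
  then show thesis by (intro that[of \<delta>]) auto
qed

lemma division_member_real:
  fixes d :: "real set set"
  assumes "d division_of S" "K \<in> d"
  obtains u v where "K = {u..v}" "u \<le> v" "Inf K = u" "Sup K = v" "u \<in> S" "v \<in> S"
proof -
  obtain u v where K: "K = cbox u v" using assms by blast
  have "K \<noteq> {}" "K \<subseteq> S" using assms by blast+
  then have "u \<le> v" using K by auto
  moreover from this have "u \<in> S" "v \<in> S" using K \<open>K \<subseteq> S\<close> by auto
  ultimately show thesis using that[of u v] K by simp
qed

lemma absolutely_continuous_on_bounded_mult:
  fixes f g :: "real \<Rightarrow> 'a::real_normed_algebra"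
  assumes f: "absolutely_continuous_on S f" and g: "absolutely_continuous_on S g"
    and fB: "\<And>x. x \<in> S \<Longrightarrow> norm (f x) \<le> B" and gB: "\<And>x. x \<in> S \<Longrightarrow> norm (g x) \<le> B"
  shows "absolutely_continuous_on S (\<lambda>x. f x * g x)"
  unfolding absolutely_continuous_on_def
proof (intro allI impI)
  fix \<epsilon> :: real assume "\<epsilon> > 0"
  \<comment> \<open>The summand 1 keeps \<open>C\<close> positive, so that the tolerance
    \<open>\<epsilon> / (2 * C)\<close> makes sense whatever the value of \<open>B\<close>.\<close>
  define C where "C = \<bar>B\<bar> + 1"
  have C: "C > 0" "\<And>x. x \<in> S \<Longrightarrow> norm (f x) \<le> C" "\<And>x. x \<in> S \<Longrightarrow> norm (g x) \<le> C"
    using fB gB unfolding C_def by force+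
  have e: "\<epsilon> / (2 * C) > 0" using \<open>\<epsilon> > 0\<close> C by simp
  obtain \<delta>1 where 1: "\<delta>1 > 0"
    "\<forall>d. d division_of \<Union>d \<longrightarrow> \<Union>d \<subseteq> S \<longrightarrow> (\<Sum>K\<in>d. Sup K - Inf K) < \<delta>1 \<longrightarrow>
      (\<Sum>K\<in>d. norm (f (Sup K) - f (Inf K))) < \<epsilon> / (2 * C)"
    by (rule absolutely_continuous_onD[OF f e]) (rule that)
  obtain \<delta>2 where 2: "\<delta>2 > 0"
    "\<forall>d. d division_of \<Union>d \<longrightarrow> \<Union>d \<subseteq> S \<longrightarrow> (\<Sum>K\<in>d. Sup K - Inf K) < \<delta>2 \<longrightarrow>
      (\<Sum>K\<in>d. norm (g (Sup K) - g (Inf K))) < \<epsilon> / (2 * C)"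
    by (rule absolutely_continuous_onD[OF g e]) (rule that)
  show "\<exists>\<delta>>0. \<forall>d. d division_of \<Union>d \<and> \<Union>d \<subseteq> S \<and> (\<Sum>K\<in>d. Sup K - Inf K) < \<delta> \<longrightarrow>
    (\<Sum>K\<in>d. norm (f (Sup K) * g (Sup K) - f (Inf K) * g (Inf K))) < \<epsilon>"
  proof (intro exI[of _ "min \<delta>1 \<delta>2"] conjI allI impI)
    show "min \<delta>1 \<delta>2 > 0" using 1 2 by simp
    fix d assume "d division_of \<Union>d \<and> \<Union>d \<subseteq> S \<and> (\<Sum>K\<in>d. Sup K - Inf K) < min \<delta>1 \<delta>2"
    then have d: "d division_of \<Union>d" "\<Union>d \<subseteq> S" "(\<Sum>K\<in>d. Sup K - Inf K) < \<delta>1"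
      "(\<Sum>K\<in>d. Sup K - Inf K) < \<delta>2" by auto
    have "(\<Sum>K\<in>d. norm (f (Sup K) * g (Sup K) - f (Inf K) * g (Inf K)))
       \<le> (\<Sum>K\<in>d. C * norm (g (Sup K) - g (Inf K)) + C * norm (f (Sup K) - f (Inf K)))"
    proof (rule sum_mono)
      fix K assume "K \<in> d"
      then obtain u v where K: "Inf K = u" "Sup K = v" "u \<in> S" "v \<in> S"
        using division_member_real[OF d(1)] d(2) by (metis subsetD)
      have "f v * g v - f u * g u = f v * (g v - g u) + (f v - f u) * g u"
        by (simp add: algebra_simps)
      also have "norm \<dots> \<le> norm (f v) * norm (g v - g u) + norm (f v - f u) * norm (g u)"
        by (intro order.trans[OF norm_triangle_ineq] add_mono norm_mult_ineq)
      also have "\<dots> \<le> C * norm (g v - g u) + norm (f v - f u) * C"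
        using K C by (intro add_mono mult_mono) auto
      finally show "norm (f (Sup K) * g (Sup K) - f (Inf K) * g (Inf K))
        \<le> C * norm (g (Sup K) - g (Inf K)) + C * norm (f (Sup K) - f (Inf K))"
        using K by (simp add: mult.commute)
    qed
    also have "\<dots> = C * (\<Sum>K\<in>d. norm (g (Sup K) - g (Inf K))) + C * (\<Sum>K\<in>d. norm (f (Sup K) - f (Inf K)))"
      by (simp add: sum.distrib sum_distrib_left)
    also have "\<dots> < C * (\<epsilon> / (2 * C)) + C * (\<epsilon> / (2 * C))"
      using 1(2)[rule_format, OF d(1,2,3)] 2(2)[rule_format, OF d(1,2,4)] C by (intro add_strict_mono mult_strict_left_mono) auto
    also have "\<dots> = \<epsilon>" using C by simp
    finally show "(\<Sum>K\<in>d. norm (f (Sup K) * g (Sup K) - f (Inf K) * g (Inf K))) < \<epsilon>" .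
  qed
qed

lemma absolutely_continuous_on_add:
  assumes f: "absolutely_continuous_on S f" and g: "absolutely_continuous_on S g"
  shows "absolutely_continuous_on S (\<lambda>x. f x + g x)"
  unfolding absolutely_continuous_on_def
proof (intro allI impI)
  fix \<epsilon> :: real assume "\<epsilon> > 0"
  then have e: "\<epsilon> / 2 > 0" by simp
  obtain \<delta>1 where 1: "\<delta>1 > 0"
    "\<forall>d. d division_of \<Union>d \<longrightarrow> \<Union>d \<subseteq> S \<longrightarrow> (\<Sum>K\<in>d. Sup K - Inf K) < \<delta>1 \<longrightarrow>
      (\<Sum>K\<in>d. norm (f (Sup K) - f (Inf K))) < \<epsilon> / 2"
    by (rule absolutely_continuous_onD[OF f e]) (rule that)
  obtain \<delta>2 where 2: "\<delta>2 > 0"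
    "\<forall>d. d division_of \<Union>d \<longrightarrow> \<Union>d \<subseteq> S \<longrightarrow> (\<Sum>K\<in>d. Sup K - Inf K) < \<delta>2 \<longrightarrow>
      (\<Sum>K\<in>d. norm (g (Sup K) - g (Inf K))) < \<epsilon> / 2"
    by (rule absolutely_continuous_onD[OF g e]) (rule that)
  show "\<exists>\<delta>>0. \<forall>d. d division_of \<Union>d \<and> \<Union>d \<subseteq> S \<and> (\<Sum>K\<in>d. Sup K - Inf K) < \<delta> \<longrightarrow>
    (\<Sum>K\<in>d. norm (f (Sup K) + g (Sup K) - (f (Inf K) + g (Inf K)))) < \<epsilon>"
  proof (intro exI[of _ "min \<delta>1 \<delta>2"] conjI allI impI)
    show "min \<delta>1 \<delta>2 > 0" using 1 2 by simp
    fix d assume "d division_of \<Union>d \<and> \<Union>d \<subseteq> S \<and> (\<Sum>K\<in>d. Sup K - Inf K) < min \<delta>1 \<delta>2"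
    then have d: "d division_of \<Union>d" "\<Union>d \<subseteq> S" "(\<Sum>K\<in>d. Sup K - Inf K) < \<delta>1"
      "(\<Sum>K\<in>d. Sup K - Inf K) < \<delta>2" by auto
    have "(\<Sum>K\<in>d. norm (f (Sup K) + g (Sup K) - (f (Inf K) + g (Inf K))))
       \<le> (\<Sum>K\<in>d. norm (f (Sup K) - f (Inf K)) + norm (g (Sup K) - g (Inf K)))"
      by (intro sum_mono norm_diff_triangle_ineq)
    also have "\<dots> < \<epsilon>"
      using 1(2)[rule_format, OF d(1,2,3)] 2(2)[rule_format, OF d(1,2,4)] by (simp add: sum.distrib)
    finally show "(\<Sum>K\<in>d. norm (f (Sup K) + g (Sup K) - (f (Inf K) + g (Inf K)))) < \<epsilon>" .
  qed
qed

lemma absolutely_continuous_on_lipschitz: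
  assumes "\<And>x y. x \<in> S \<Longrightarrow> y \<in> S \<Longrightarrow> norm (f x - f y) \<le> B * \<bar>x - y\<bar>"
  shows "absolutely_continuous_on S f"
  unfolding absolutely_continuous_on_def
proof (intro allI impI)
  fix \<epsilon> :: real assume "\<epsilon> > 0"
  define C where "C = \<bar>B\<bar> + 1"
  have C: "C > 0" unfolding C_def by simp
  show "\<exists>\<delta>>0. \<forall>d. d division_of \<Union>d \<and> \<Union>d \<subseteq> S \<and> (\<Sum>K\<in>d. Sup K - Inf K) < \<delta> \<longrightarrow>
    (\<Sum>K\<in>d. norm (f (Sup K) - f (Inf K))) < \<epsilon>"
  proof (intro exI[of _ "\<epsilon> / C"] conjI allI impI)
    show "\<epsilon> / C > 0" using C \<open>\<epsilon> > 0\<close> by simp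
    fix d assume d: "d division_of \<Union>d \<and> \<Union>d \<subseteq> S \<and> (\<Sum>K\<in>d. Sup K - Inf K) < \<epsilon> / C"
    have "(\<Sum>K\<in>d. norm (f (Sup K) - f (Inf K))) \<le> (\<Sum>K\<in>d. C * (Sup K - Inf K))"
    proof (rule sum_mono)
      fix K assume "K \<in> d"
      then obtain u v where K: "u \<le> v" "Inf K = u" "Sup K = v" "u \<in> S" "v \<in> S"
        using division_member_real[of d "\<Union>d" K] d by (metis subsetD)
      have "norm (f v - f u) \<le> B * \<bar>v - u\<bar>" using assms K by blast
      also have "\<dots> \<le> C * \<bar>v - u\<bar>" unfolding C_def by (intro mult_right_mono) auto
      finally show "norm (f (Sup K) - f (Inf K)) \<le> C * (Sup K - Inf K)" using K by simp
    qed
    also have "\<dots> < \<epsilon>" using d C unfolding sum_distrib_left[symmetric] by (simp add: pos_less_divide_eq mult.commute)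
    finally show "(\<Sum>K\<in>d. norm (f (Sup K) - f (Inf K))) < \<epsilon>" .
  qed
qed

lemma absolutely_continuous_on_deriv_bounded:
  fixes f :: "real \<Rightarrow> 'a::real_normed_vector"
  assumes "\<And>x. x \<in> {a..b} \<Longrightarrow> (f has_vector_derivative f' x) (at x within {a..b})"
    and "\<And>x. x \<in> {a..b} \<Longrightarrow> norm (f' x) \<le> B"
  shows "absolutely_continuous_on {a..b} f"
proof (rule absolutely_continuous_on_lipschitz)
  fix x y assume "x \<in> {a..b}" "y \<in> {a..b}"
  then have "norm (f x - f y) \<le> B * norm (x - y)"
    using assms(1)[unfolded has_vector_derivative_def]
    by (intro differentiable_bound[where f' = "\<lambda>x h. h *\<^sub>R f' x" and S = "{a..b}"])
      (auto intro!: onorm_le mult_left_mono assms(2) simp: mult.commute[of B])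
  then show "norm (f x - f y) \<le> B * \<bar>x - y\<bar>" by simp
qed

lemma absolutely_continuous_on_deriv_continuous:
  fixes f :: "real \<Rightarrow> 'a::real_normed_vector"
  assumes "\<And>x. x \<in> {a..b} \<Longrightarrow> (f has_vector_derivative f' x) (at x within {a..b})"
    and "continuous_on {a..b} f'"
  shows "absolutely_continuous_on {a..b} f"
proof -
  have "bounded (f' ` {a..b})"
    using assms(2) by (intro compact_imp_bounded compact_continuous_image) auto
  then obtain B where "\<And>x. x \<in> {a..b} \<Longrightarrow> norm (f' x) \<le> B"
    unfolding bounded_iff by (metis imageI)
  then show ?thesis using assms(1) by (rule absolutely_continuous_on_deriv_bounded[rotated])
qed

lemma absolutely_continuous_on_imp_continuous_on:
  fixes f :: "real \<Rightarrow> 'a::real_normed_vector"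
  assumes "absolutely_continuous_on {a..b} f"
  shows "continuous_on {a..b} f"
  unfolding continuous_on_iff
proof (intro ballI allI impI)
  fix x \<epsilon> :: real assume x: "x \<in> {a..b}" and "\<epsilon> > 0"
  obtain \<delta> where \<delta>: "\<delta> > 0"
    "\<forall>d. d division_of \<Union>d \<longrightarrow> \<Union>d \<subseteq> {a..b} \<longrightarrow> (\<Sum>K\<in>d. Sup K - Inf K) < \<delta> \<longrightarrow>
      (\<Sum>K\<in>d. norm (f (Sup K) - f (Inf K))) < \<epsilon>"
    by (rule absolutely_continuous_onD[OF assms \<open>\<epsilon> > 0\<close>]) (rule that)
  \<comment> \<open>The family consisting of the single interval from u to v already tests this
    increment.\<close>
  have *: "norm (f v - f u) < \<epsilon>" if "u \<le> v" "u \<in> {a..b}" "v \<in> {a..b}" "v - u < \<delta>" for u v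
    using \<delta>(2)[rule_format, of "{cbox u v}"] that division_of_self[of u v] by auto
  show "\<exists>d>0. \<forall>x'\<in>{a..b}. dist x' x < d \<longrightarrow> dist (f x') (f x) < \<epsilon>"
  proof (intro exI[of _ \<delta>] conjI ballI impI)
    fix y assume "y \<in> {a..b}" "dist y x < \<delta>"
    then show "dist (f y) (f x) < \<epsilon>"
      using *[of x y] *[of y x] x by (cases "x \<le> y") (auto simp: dist_norm norm_minus_commute)
  qed (use \<delta> in auto)
qed

text \<open>The gauge covers the exceptional null set by an open set of small measure; there the Riemann
  sum is compared with the increments of \<open>f\<close> through absolute continuity alone.\<close>

theorem absolutely_continuous_on_has_integral:
  fixes f :: "real \<Rightarrow> 'a::banach"
  assumes ac: "absolutely_continuous_on {a..b} f" and "a \<le> b" and N: "negligible N"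
    and der: "\<And>x. x \<in> {a..b} - N \<Longrightarrow> (f has_vector_derivative f' x) (at x within {a..b})"
  shows "(f' has_integral (f b - f a)) {a..b}"
proof (cases "a = b")
  case True then show ?thesis by (simp add: has_integral_refl)
next
  case False
  then have "a < b" using \<open>a \<le> b\<close> by simp
  \<comment> \<open>As \<open>g\<close> vanishes on the exceptional set, an interval tagged in
    \<open>N\<close> contributes only the increment of \<open>f\<close> to the error. The passage
    back from \<open>g\<close> to \<open>f'\<close> is a change on a negligible set.\<close>
  define g where "g x = (if x \<in> N then 0 else f' x)" for x
  have "(g has_integral (f b - f a)) {a..b}"
    unfolding has_integral_factor_content_real
  proof (intro allI impI)
    fix e :: real assume "e > 0"
    have e2: "e / 2 * (b - a) > 0" using \<open>e > 0\<close> \<open>a < b\<close> by simp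
    obtain \<delta> where \<delta>: "\<delta> > 0"
      "\<forall>d. d division_of \<Union>d \<longrightarrow> \<Union>d \<subseteq> {a..b} \<longrightarrow> (\<Sum>K\<in>d. Sup K - Inf K) < \<delta> \<longrightarrow>
        (\<Sum>K\<in>d. norm (f (Sup K) - f (Inf K))) < e / 2 * (b - a)"
      by (rule absolutely_continuous_onD[OF ac e2]) (rule that)
    have Ns: "N \<in> sets lebesgue" using N by (simp add: negligible_imp_sets)
    obtain U where U: "open U" "N \<subseteq> U" "U - N \<in> lmeasurable" "emeasure lebesgue (U - N) < ennreal \<delta>"
      using sets_lebesgue_outer_open[OF Ns \<open>\<delta> > 0\<close>] by metis
    have UN: "U \<in> lmeasurable" "measure lebesgue U < \<delta>"
    proof -
      have "U = (U - N) \<union> N" using U by auto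
      then show Um: "U \<in> lmeasurable"
        by (metis U(3) N fmeasurable.Un negligible_imp_measurable)
      have "measure lebesgue (U - N) = measure lebesgue U"
        using N Um by (intro measure_Diff_null_set) (auto simp: negligible_iff_null_sets)
      then show "measure lebesgue U < \<delta>"
        using U(3,4) \<delta>(1) by (metis emeasure_eq_measure2 ennreal_less_iff measure_nonneg)
    qed
    have "\<forall>x. \<exists>d>0. x \<in> {a..b} - N \<longrightarrow>
         (\<forall>y\<in>{a..b}. norm (y-x) < d \<longrightarrow> norm (f y - f x - (y-x) *\<^sub>R f' x) \<le> e/2 * norm (y-x))"
      using der[unfolded has_vector_derivative_def has_derivative_within_alt] \<open>e > 0\<close>
      by (metis half_gt_zero_iff zero_less_one)
    then obtain r where r: "\<And>x. 0 < r x"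
      "\<And>x y. \<lbrakk>x \<in> {a..b} - N; y \<in> {a..b}; norm (y-x) < r x\<rbrakk>
                        \<Longrightarrow> norm (f y - f x - (y-x) *\<^sub>R f' x) \<le> e/2 * norm (y-x)"
      by metis
    define \<gamma> where "\<gamma> x = (if x \<in> N then U else ball x (r x))" for x
    show "\<exists>\<gamma>. gauge \<gamma> \<and> (\<forall>p. p tagged_division_of {a..b} \<and> \<gamma> fine p \<longrightarrow>
      norm ((\<Sum>(x, k)\<in>p. measure lborel k *\<^sub>R g x) - (f b - f a)) \<le> e * measure lborel {a..b})"
    proof (intro exI[of _ \<gamma>] conjI allI impI)
      show "gauge \<gamma>" unfolding gauge_def \<gamma>_def using U r by auto
      fix p assume "p tagged_division_of {a..b} \<and> \<gamma> fine p"
      then have p: "p tagged_division_of {a..b}" and fine: "\<gamma> fine p" by auto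
      have finp: "finite p" using p by blast
      define p1 where "p1 = {(x, K) \<in> p. x \<in> N}"
      define p2 where "p2 = {(x, K) \<in> p. x \<notin> N}"
      have pp: "p = p1 \<union> p2" "p1 \<inter> p2 = {}" "finite p1" "finite p2"
        using finp unfolding p1_def p2_def by (auto intro: finite_subset[OF _ finp])
      have ba: "b - a = (\<Sum>(x,K)\<in>p. Sup K - Inf K)" "f b - f a = (\<Sum>(x,K)\<in>p. f(Sup K) - f(Inf K))"
        using additive_tagged_division_1[where f= "\<lambda>x. x"] additive_tagged_division_1[where f= f]
            \<open>a \<le> b\<close> p by auto
      have mem: "\<exists>u v. K = {u..v} \<and> u \<le> v \<and> x \<in> K \<and> u \<in> {a..b} \<and> v \<in> {a..b} \<and> x \<in> {a..b}
           \<and> Sup K = v \<and> Inf K = u \<and> K \<subseteq> \<gamma> x" if "(x, K) \<in> p" for x K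
      proof -
        have "x \<in> K" "K \<subseteq> {a..b}" "\<exists>u v. K = cbox u v" "K \<subseteq> \<gamma> x"
          using p fine that by blast+
        then obtain u v where "K = cbox u v" by blast
        with \<open>x \<in> K\<close> \<open>K \<subseteq> {a..b}\<close> \<open>K \<subseteq> \<gamma> x\<close> show ?thesis
          by (intro exI[of _ u] exI[of _ v]) auto
      qed
      have "(\<Sum>(x, k)\<in>p. measure lborel k *\<^sub>R g x) - (f b - f a)
         = (\<Sum>(x, K)\<in>p. measure lborel K *\<^sub>R g x - (f(Sup K) - f(Inf K)))"
        unfolding ba by (simp add: sum_subtractf case_prod_unfold)
      also have "\<dots> = (\<Sum>(x, K)\<in>p1. measure lborel K *\<^sub>R g x - (f(Sup K) - f(Inf K)))
          + (\<Sum>(x, K)\<in>p2. measure lborel K *\<^sub>R g x - (f(Sup K) - f(Inf K)))"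
        unfolding pp(1) by (rule sum.union_disjoint) (use pp in auto)
      finally have eq: "(\<Sum>(x, k)\<in>p. measure lborel k *\<^sub>R g x) - (f b - f a) = \<dots>" .
      \<comment> \<open>Straddle estimate: both endpoints are compared with the tag, and since the
        tag lies between them the two distances add up to the length of the interval.\<close>
      have n2: "norm (\<Sum>(x, K)\<in>p2. measure lborel K *\<^sub>R g x - (f(Sup K) - f(Inf K)))
         \<le> (\<Sum>(x, K)\<in>p2. e/2 * (Sup K - Inf K))"
      proof (rule sum_norm_le, safe)
        fix x K assume xK: "(x, K) \<in> p2"
        then have "x \<notin> N" "(x, K) \<in> p" unfolding p2_def by auto
        with mem obtain u v where K: "K = {u..v}" "u \<le> v" "x \<in> K" "u \<in> {a..b}" "v \<in> {a..b}" "x \<in> {a..b}"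
          "Sup K = v" "Inf K = u" "K \<subseteq> \<gamma> x" by blast
        then have "u \<in> K" "v \<in> K" "K \<subseteq> ball x (r x)" using \<open>x \<notin> N\<close> by (auto simp: \<gamma>_def)
        then have "u \<in> ball x (r x)" "v \<in> ball x (r x)" by blast+
        then have "norm (u - x) < r x" "norm (v - x) < r x" by (auto simp: dist_norm norm_minus_commute)
        then have *: "norm (f u - f x - (u - x) *\<^sub>R f' x) \<le> e/2 * norm (u - x)"
           "norm (f v - f x - (v - x) *\<^sub>R f' x) \<le> e/2 * norm (v - x)"
          using r(2) K \<open>x \<notin> N\<close> by blast+
        have ueq: "measure lborel K *\<^sub>R g x - (f(Sup K) - f(Inf K)) =
           (f u - f x - (u - x) *\<^sub>R f' x) - (f v - f x - (v - x) *\<^sub>R f' x)"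
          using K \<open>x \<notin> N\<close> by (simp add: g_def algebra_simps)
        have "norm (measure lborel K *\<^sub>R g x - (f(Sup K) - f(Inf K)))
          \<le> e/2 * norm (u - x) + e/2 * norm (v - x)"
          unfolding ueq by (rule order.trans[OF norm_triangle_ineq4 add_mono[OF *]])
        also have "\<dots> = e/2 * (v - u)"
          using K by (simp add: field_simps)
        finally show "norm (measure lborel K *\<^sub>R g x - (f(Sup K) - f(Inf K))) \<le> e/2 * (Sup K - Inf K)"
          using K by simp
      qed
      also have "\<dots> \<le> (\<Sum>(x, K)\<in>p. e/2 * (Sup K - Inf K))"
      proof (rule sum_mono2)
        show "finite p" "p2 \<subseteq> p" using finp pp by auto
        fix z assume "z \<in> p - p2"
        then obtain x K where z: "z = (x, K)" "(x, K) \<in> p" by (cases z) auto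
        then have "Sup K - Inf K \<ge> 0" using mem by fastforce
        then show "0 \<le> (case z of (x, K) \<Rightarrow> e/2 * (Sup K - Inf K))" using z \<open>e > 0\<close> by simp
      qed
      also have "\<dots> = e/2 * (b - a)"
        unfolding ba by (simp add: sum_distrib_left case_prod_unfold)
      finally have n2: "norm (\<Sum>(x, K)\<in>p2. measure lborel K *\<^sub>R g x - (f(Sup K) - f(Inf K))) \<le> e/2 * (b - a)" .
      have tp1: "p1 tagged_partial_division_of {a..b}"
        using p tagged_partial_division_subset[of p "{a..b}" p1] pp by (auto simp: tagged_division_of_def)
      have d1: "snd ` p1 division_of \<Union>(snd ` p1)"
        by (rule partial_division_of_tagged_division[OF tp1])
      have tp1': "p1 tagged_division_of \<Union>(snd ` p1)"
        by (rule tagged_partial_division_of_Union_self[OF tp1])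
      have sub: "\<Union>(snd ` p1) \<subseteq> U" "\<Union>(snd ` p1) \<subseteq> {a..b}"
      proof -
        show "\<Union>(snd ` p1) \<subseteq> {a..b}"
          using tagged_partial_division_ofD(3)[OF tp1] by fastforce
        show "\<Union>(snd ` p1) \<subseteq> U"
          using mem unfolding p1_def \<gamma>_def by fastforce
      qed
      have "(\<Sum>K\<in>snd ` p1. Sup K - Inf K) = (\<Sum>K\<in>snd ` p1. measure lebesgue K)"
      proof (rule sum.cong[OF refl])
        fix K assume "K \<in> snd ` p1"
        then obtain u v where "K = {u..v}" "u \<le> v" "Inf K = u" "Sup K = v"
          using division_member_real[OF d1] by metis
        then show "Sup K - Inf K = measure lebesgue K" by simp
      qed
      also have "\<dots> = measure lebesgue (\<Union>(snd ` p1))"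
        using content_division[OF d1] by simp
      also have "\<dots> \<le> measure lebesgue U"
        using sub UN d1 by (intro measure_mono_fmeasurable) (auto intro: fmeasurableD lmeasurable_division)
      also have "\<dots> < \<delta>" by fact
      finally have "(\<Sum>K\<in>snd ` p1. norm (f (Sup K) - f (Inf K))) < e / 2 * (b - a)"
        using \<delta>(2)[rule_format, OF d1 sub(2)] by simp
      \<comment> \<open>Passing from intervals to tagged intervals requires a summand that vanishes
        on degenerate boxes, since one degenerate interval may carry several tags. A single point
        gives 0 by itself; the guard covers the empty set, where \<open>Sup\<close> and
        \<open>Inf\<close> have no meaning.\<close>
      also have "(\<Sum>K\<in>snd ` p1. norm (f (Sup K) - f (Inf K)))
         = (\<Sum>K\<in>snd ` p1. if K = {} then 0 else norm (f (Sup K) - f (Inf K)))"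
        using mem unfolding p1_def by (intro sum.cong) fastforce+
      also have "\<dots> = (\<Sum>(x,K)\<in>p1. if K = {} then 0 else norm (f (Sup K) - f (Inf K)))"
        by (rule sum.over_tagged_division_lemma[OF tp1', symmetric]) auto
      also have "\<dots> = (\<Sum>(x,K)\<in>p1. norm (f (Sup K) - f (Inf K)))"
        using mem unfolding p1_def by (intro sum.cong) fastforce+
      finally have "(\<Sum>(x,K)\<in>p1. norm (f (Sup K) - f (Inf K))) < e / 2 * (b - a)" .
      moreover have "norm (\<Sum>(x, K)\<in>p1. measure lborel K *\<^sub>R g x - (f(Sup K) - f(Inf K)))
        \<le> (\<Sum>(x,K)\<in>p1. norm (f (Sup K) - f (Inf K)))"
        by (rule sum_norm_le) (auto simp: p1_def g_def norm_minus_commute)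
      ultimately have "norm ((\<Sum>(x, k)\<in>p. measure lborel k *\<^sub>R g x) - (f b - f a)) \<le> e/2 * (b - a) + e/2 * (b-a)"
        unfolding eq using n2 by (intro order.trans[OF norm_triangle_ineq] add_mono) auto
      then show "norm ((\<Sum>(x, k)\<in>p. measure lborel k *\<^sub>R g x) - (f b - f a)) \<le> e * measure lborel {a..b}"
        using \<open>a \<le> b\<close> by (simp add: algebra_simps)
    qed
  qed
  then show ?thesis
    by (rule has_integral_spike[OF N, rotated]) (auto simp: g_def)
qed

section \<open>Indefinite integrals: absolute continuity and differentiation almost
  everywhere\<close>

lemma integrable_truncation_small:
  fixes f :: "'a \<Rightarrow> real"
  assumes f: "integrable M f" and "\<epsilon> > 0"
  obtains B where "B \<ge> 0" "(LINT x|M. (if \<bar>f x\<bar> \<le> B then 0 else \<bar>f x\<bar>)) < \<epsilon>"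
proof -
  have [measurable]: "f \<in> borel_measurable M" using f by simp
  have "(\<lambda>n. LINT x|M. (if \<bar>f x\<bar> \<le> real n then 0 else \<bar>f x\<bar>)) \<longlonglongrightarrow> (LINT x|M. 0)"
  proof (rule integral_dominated_convergence[where w = "\<lambda>x. \<bar>f x\<bar>"])
    show "AE x in M. (\<lambda>n. if \<bar>f x\<bar> \<le> real n then 0 else \<bar>f x\<bar>) \<longlonglongrightarrow> 0"
    proof (rule AE_I2)
      fix x
      have "\<forall>\<^sub>F n in sequentially. \<bar>f x\<bar> \<le> real n"
        using filterlim_real_sequentially unfolding filterlim_at_top by blast
      then have "\<forall>\<^sub>F n in sequentially. (if \<bar>f x\<bar> \<le> real n then 0 else \<bar>f x\<bar>) = 0"
        by eventually_elim simp
      then show "(\<lambda>n. if \<bar>f x\<bar> \<le> real n then 0 else \<bar>f x\<bar>) \<longlonglongrightarrow> 0"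
        by (rule tendsto_eventually)
    qed
  qed (use f in auto)
  then have "\<forall>\<^sub>F n in sequentially. (LINT x|M. (if \<bar>f x\<bar> \<le> real n then 0 else \<bar>f x\<bar>)) < \<epsilon>"
    using \<open>\<epsilon> > 0\<close> by (auto dest: order_tendstoD(2))
  then obtain n where "(LINT x|M. (if \<bar>f x\<bar> \<le> real n then 0 else \<bar>f x\<bar>)) < \<epsilon>"
    by (auto simp: eventually_sequentially)
  then show thesis by (intro that[of "real n"]) auto
qed

text \<open>The integrand is split at a height \<open>B\<close>: the part below contributes at most
  \<open>B\<close> times the total length of the intervals, the part above at most its full
  integral, which is small by the choice of \<open>B\<close> and does not depend on the intervals.
  The integral runs from \<open>x\<close> upwards because the boundary data of the differential
  equation sit at the right endpoint.\<close>

lemma absolutely_continuous_on_indefinite_integral: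
  fixes f :: "real \<Rightarrow> real"
  assumes f: "integrable lborel f"
  shows "absolutely_continuous_on S (\<lambda>x. LINT y|lborel. indicator {x..} y * f y)"
  unfolding absolutely_continuous_on_def
proof (intro allI impI)
  fix \<epsilon> :: real assume "\<epsilon> > 0"
  then obtain B where B: "B \<ge> 0" "(LINT x|lborel. (if \<bar>f x\<bar> \<le> B then 0 else \<bar>f x\<bar>)) < \<epsilon> / 2"
    using integrable_truncation_small[OF f, of "\<epsilon> / 2"] by auto
  define h where "h x = (if \<bar>f x\<bar> \<le> B then 0 else \<bar>f x\<bar>)" for x
  have [measurable]: "f \<in> borel_measurable borel" using f by auto
  have h: "integrable lborel h" unfolding h_def
    by (rule Bochner_Integration.integrable_bound[OF f]) auto
  have hHK: "h integrable_on UNIV" using h integrable_on_lborel by blast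
  have hUNIV: "integral UNIV h = (LINT x|lborel. h x)"
    by (rule integral_lborel[OF h])
  \<comment> \<open>The denominator uses \<open>B + 1\<close> because \<open>B\<close> may be
    0.\<close>
  define \<delta> where "\<delta> = \<epsilon> / (2 * (B + 1))"
  show "\<exists>\<delta>>0. \<forall>d. d division_of \<Union>d \<and> \<Union>d \<subseteq> S \<and> (\<Sum>K\<in>d. Sup K - Inf K) < \<delta> \<longrightarrow>
    (\<Sum>K\<in>d. norm ((LINT y|lborel. indicator {Sup K..} y * f y) - (LINT y|lborel. indicator {Inf K..} y * f y))) < \<epsilon>"
  proof (intro exI[of _ \<delta>] conjI allI impI)
    show "\<delta> > 0" unfolding \<delta>_def using \<open>\<epsilon> > 0\<close> B by auto
    fix d assume "d division_of \<Union>d \<and> \<Union>d \<subseteq> S \<and> (\<Sum>K\<in>d. Sup K - Inf K) < \<delta>"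
    then have d: "d division_of \<Union>d" "(\<Sum>K\<in>d. Sup K - Inf K) < \<delta>" by auto
    have "(\<Sum>K\<in>d. norm ((LINT y|lborel. indicator {Sup K..} y * f y) - (LINT y|lborel. indicator {Inf K..} y * f y)))
      \<le> (\<Sum>K\<in>d. B * (Sup K - Inf K) + integral K h)"
    proof (rule sum_mono)
      fix K assume "K \<in> d"
      then obtain u v where K: "K = {u..v}" "u \<le> v" "Inf K = u" "Sup K = v"
        by (rule division_member_real[OF d(1)])
      have i: "integrable lborel (\<lambda>y. indicator A y * f y)" if "A \<in> sets borel" for A
        using f that by (intro integrable_mult_indicator[where f = f, simplified real_scaleR_def]) auto
      have ih: "integrable lborel (\<lambda>y. indicator A y * h y)" if "A \<in> sets borel" for A
        using h that by (intro integrable_mult_indicator[where f = h, simplified real_scaleR_def]) auto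
      have iB: "integrable lborel (\<lambda>y. indicator {u..<v} y * B)"
        by (intro Bochner_Integration.integrable_mult_left integrable_real_indicator)
          (use K in auto)
      have "(LINT y|lborel. indicator {u..} y * f y) - (LINT y|lborel. indicator {v..} y * f y)
         = (LINT y|lborel. indicator {u..} y * f y - indicator {v..} y * f y)"
        by (intro Bochner_Integration.integral_diff[symmetric] i) auto
      also have "\<dots> = (LINT y|lborel. indicator {u..<v} y * f y)"
        using K by (intro Bochner_Integration.integral_cong refl) (auto simp: indicator_def)
      finally have "norm ((LINT y|lborel. indicator {v..} y * f y) - (LINT y|lborel. indicator {u..} y * f y))
         = norm (LINT y|lborel. indicator {u..<v} y * f y)"
        by (simp add: norm_minus_commute)
      \<comment> \<open>The part \<open>h\<close> above the height is put on the closed interval,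
        since the members of the family are closed and the integrals of \<open>h\<close> over them
        are to be added up.\<close>
      also have "\<dots> \<le> (LINT y|lborel. indicator {u..<v} y * B + indicator {u..v} y * h y)"
      proof (rule Bochner_Integration.integral_norm_bound_integral)
        show "integrable lborel (\<lambda>y. indicator {u..<v} y * f y)" by (rule i) simp
        show "integrable lborel (\<lambda>y. indicator {u..<v} y * B + indicator {u..v} y * h y)"
          by (intro Bochner_Integration.integrable_add iB ih) simp
        show "norm (indicator {u..<v} y * f y) \<le> indicator {u..<v} y * B + indicator {u..v} y * h y" for y
          using B by (auto simp: indicator_def h_def)
      qed
      also have "\<dots> = B * (v - u) + (LINT y|lborel. indicator {u..v} y * h y)"
        using K by (subst Bochner_Integration.integral_add) (auto intro!: iB ih)
      also have "(LINT y|lborel. indicator {u..v} y * h y) = integral {u..v} h"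
        using set_borel_integral_eq_integral(2)[of "{u..v}" h] ih[of "{u..v}"]
        by (simp add: set_lebesgue_integral_def set_integrable_def)
      finally show "norm ((LINT y|lborel. indicator {Sup K..} y * f y) - (LINT y|lborel. indicator {Inf K..} y * f y))
        \<le> B * (Sup K - Inf K) + integral K h" using K by simp
    qed
    also have "\<dots> = B * (\<Sum>K\<in>d. Sup K - Inf K) + (\<Sum>K\<in>d. integral K h)"
      by (simp add: sum.distrib sum_distrib_left)
    also have hK: "h integrable_on K" if "K \<in> d" for K
    proof -
      obtain u v where "K = {u..v}" using \<open>K \<in> d\<close> by (rule division_member_real[OF d(1)])
      then show ?thesis using integrable_on_subinterval[OF hHK, of u v] by simp
    qed
    then have "(\<Sum>K\<in>d. integral K h) = integral (\<Union>d) h"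
      by (rule integral_combine_division_bottomup[OF d(1), symmetric])
    also have "\<dots> \<le> integral UNIV h"
      by (intro integral_subset_le hHK integrable_combine_division[OF d(1)] hK) (auto simp: h_def)
    also have "\<dots> < \<epsilon> / 2" using B unfolding hUNIV h_def by simp
    also have "B * (\<Sum>K\<in>d. Sup K - Inf K) \<le> (B + 1) * \<delta>"
    proof (rule mult_mono)
      show "0 \<le> (\<Sum>K\<in>d. Sup K - Inf K)"
        
      proof (rule sum_nonneg)
        fix K assume "K \<in> d"
        then obtain u v where "u \<le> v" "Inf K = u" "Sup K = v"
          by (rule division_member_real[OF d(1)])
        then show "0 \<le> Sup K - Inf K" by simp
      qed
    qed (use d B in auto)
    also have "(B + 1) * \<delta> = \<epsilon> / 2"
    proof -
      have *: "C * (\<epsilon> / (2 * C)) = \<epsilon> / 2" if "C \<noteq> 0" for C :: real using that by simp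
      show ?thesis unfolding \<delta>_def by (rule *) (use B in linarith)
    qed
    finally show "(\<Sum>K\<in>d. norm ((LINT y|lborel. indicator {Sup K..} y * f y) - (LINT y|lborel. indicator {Inf K..} y * f y))) < \<epsilon>"
      by simp
  qed
qed

text \<open>Lebesgue differentiation on the line, with a single null set for both sides. Averages
  over intervals to the right of a point are differentiated directly; averages to the left become
  averages to the right after the reflection of the line at 0, which preserves null sets.\<close>

lemma integral_averages_tendsto:
  fixes f :: "real \<Rightarrow> real"
  assumes f: "integrable lborel f"
  obtains N where "negligible N"
    "\<forall>x e. x \<notin> N \<longrightarrow> e > 0 \<longrightarrow> (\<exists>d>0. \<forall>h. 0 < h \<and> h < d \<longrightarrow> \<bar>integral {x..x+h} f / h - f x\<bar> < e)"
    "\<forall>x e. x \<notin> N \<longrightarrow> e > 0 \<longrightarrow> (\<exists>d>0. \<forall>h. 0 < h \<and> h < d \<longrightarrow> \<bar>integral {x-h..x} f / h - f x\<bar> < e)"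
proof -
  have fi: "f integrable_on UNIV" using f integrable_on_lborel by blast
  have ri: "(\<lambda>x. f (- x)) integrable_on UNIV"
    using lborel_integrable_real_affine[OF f, of "-1" 0] integrable_on_lborel by auto
  have fi': "f integrable_on cbox u v" "(\<lambda>x. f (- x)) integrable_on cbox u v" for u v
    using integrable_on_subinterval[OF fi, of u v] integrable_on_subinterval[OF ri, of u v] by auto
  obtain N1 where N1: "negligible N1" "\<And>x e. \<lbrakk>x \<notin> N1; 0 < e\<rbrakk> \<Longrightarrow>
               \<exists>d>0. \<forall>h. 0 < h \<and> h < d \<longrightarrow>
                         norm(integral (cbox x (x + h *\<^sub>R One)) f /\<^sub>R h ^ DIM(real) - f x) < e"
    by (rule integrable_ccontinuous_explicit[OF fi'(1)]) (rule that)
  obtain N2 where N2: "negligible N2" "\<And>x e. \<lbrakk>x \<notin> N2; 0 < e\<rbrakk> \<Longrightarrow>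
               \<exists>d>0. \<forall>h. 0 < h \<and> h < d \<longrightarrow>
                         norm(integral (cbox x (x + h *\<^sub>R One)) (\<lambda>x. f (- x)) /\<^sub>R h ^ DIM(real) - f (- x)) < e"
    by (rule integrable_ccontinuous_explicit[OF fi'(2)]) (rule that)
  show thesis
  proof (rule that[of "N1 \<union> uminus ` N2"]; (intro allI impI)?)
    show "negligible (N1 \<union> uminus ` N2)"
      using N1(1) N2(1) by (intro negligible_Un negligible_differentiable_image_negligible)
        (auto intro!: derivative_intros simp: differentiable_on_def)
  next
    fix x e :: real assume "x \<notin> N1 \<union> uminus ` N2" "e > 0"
    then show "\<exists>d>0. \<forall>h. 0 < h \<and> h < d \<longrightarrow> \<bar>integral {x..x+h} f / h - f x\<bar> < e"
      using N1(2)[of x e] by (simp add: divide_inverse mult.commute)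
  next
    fix x e :: real assume x: "x \<notin> N1 \<union> uminus ` N2" "e > 0"
    have "- x \<notin> N2"
    proof
      assume "- x \<in> N2"
      then have "- (- x) \<in> uminus ` N2" by (rule imageI)
      then show False using x by simp
    qed
    then obtain d where d: "d > 0" "\<And>h. 0 < h \<and> h < d \<Longrightarrow> \<bar>integral {-x..-x+h} (\<lambda>x. f (- x)) / h - f x\<bar> < e"
      using N2(2)[of "-x" e] \<open>e > 0\<close> by (auto simp: divide_inverse mult.commute)
    have "integral {-x..-x+h} (\<lambda>x. f (- x)) = integral {x-h..x} f" for h
      using Henstock_Kurzweil_Integration.integral_reflect_real[of x "x - h" f] by simp
    then show "\<exists>d>0. \<forall>h. 0 < h \<and> h < d \<longrightarrow> \<bar>integral {x-h..x} f / h - f x\<bar> < e"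
      using d by auto
  qed
qed

lemma indefinite_integral_diff:
  fixes f :: "real \<Rightarrow> real"
  assumes f: "integrable lborel f" and "x \<le> y"
  shows "(LINT t|lborel. indicator {x..} t * f t) - (LINT t|lborel. indicator {y..} t * f t) = integral {x..y} f"
proof -
  have i: "integrable lborel (\<lambda>y. indicator A y * f y)" if "A \<in> sets borel" for A
    using f that by (intro integrable_mult_indicator[where f = f, simplified real_scaleR_def]) auto
  have "(LINT t|lborel. indicator {x..} t * f t) - (LINT t|lborel. indicator {y..} t * f t)
      = (LINT t|lborel. indicator {x..} t * f t - indicator {y..} t * f t)"
    by (intro Bochner_Integration.integral_diff[symmetric] i) auto
  also have "\<dots> = (LINT t|lborel. indicator {x..y} t * f t)"
  proof (rule integral_cong_AE)
    have "AE t in lborel. t \<noteq> y" by (rule AE_lborel_singleton)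
    then show "AE t in lborel. indicator {x..} t * f t - indicator {y..} t * f t = indicator {x..y} t * f t"
      by eventually_elim (use \<open>x \<le> y\<close> in \<open>auto simp: indicator_def\<close>)
  qed (use f in auto)
  also have "\<dots> = integral {x..y} f"
    using set_borel_integral_eq_integral(2)[of "{x..y}" f] i[of "{x..y}"]
    by (simp add: set_lebesgue_integral_def set_integrable_def)
  finally show ?thesis .
qed

text \<open>The difference quotients from the right and from the left are, up to sign, the two
  one-sided averages of \<open>f\<close>. The minus sign appears because \<open>x\<close> is the
  lower limit of integration.\<close>

theorem indefinite_integral_has_derivative_AE:
  fixes f :: "real \<Rightarrow> real"
  assumes f: "integrable lborel f"
  obtains N where "negligible N"
    "\<forall>x. x \<notin> N \<longrightarrow> ((\<lambda>x. LINT y|lborel. indicator {x..} y * f y) has_vector_derivative - f x) (at x)"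
proof -
  obtain N where N: "negligible N"
    "\<forall>x e. x \<notin> N \<longrightarrow> e > 0 \<longrightarrow> (\<exists>d>0. \<forall>h. 0 < h \<and> h < d \<longrightarrow> \<bar>integral {x..x+h} f / h - f x\<bar> < e)"
    "\<forall>x e. x \<notin> N \<longrightarrow> e > 0 \<longrightarrow> (\<exists>d>0. \<forall>h. 0 < h \<and> h < d \<longrightarrow> \<bar>integral {x-h..x} f / h - f x\<bar> < e)"
    by (rule integral_averages_tendsto[OF f]) (rule that)
  define F where "F x = (LINT y|lborel. indicator {x..} y * f y)" for x
  have "(F has_real_derivative - f x) (at x)" if x: "x \<notin> N" for x
    unfolding has_field_derivative_iff LIM_def
  proof (intro allI impI)
    fix e :: real assume "e > 0"
    obtain d1 where d1: "d1 > 0" "\<forall>h. 0 < h \<and> h < d1 \<longrightarrow> \<bar>integral {x..x+h} f / h - f x\<bar> < e"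
      using N(2)[rule_format, OF x \<open>e > 0\<close>] by (elim exE conjE) (rule that)
    obtain d2 where d2: "d2 > 0" "\<forall>h. 0 < h \<and> h < d2 \<longrightarrow> \<bar>integral {x-h..x} f / h - f x\<bar> < e"
      using N(3)[rule_format, OF x \<open>e > 0\<close>] by (elim exE conjE) (rule that)
    show "\<exists>s>0. \<forall>y. y \<noteq> x \<and> dist y x < s \<longrightarrow> dist ((F y - F x) / (y - x)) (- f x) < e"
    proof (intro exI[of _ "min d1 d2"] conjI allI impI)
      fix y assume y: "y \<noteq> x \<and> dist y x < min d1 d2"
      show "dist ((F y - F x) / (y - x)) (- f x) < e"
      proof (cases "x < y")
        case True
        have "F x - F y = integral {x..y} f"
          unfolding F_def using True by (intro indefinite_integral_diff f) auto
        then have "F y - F x = - integral {x..y} f" by linarith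
        then have "(F y - F x) / (y - x) + f x = - (integral {x..x + (y - x)} f / (y - x) - f x)"
          by simp
        moreover have "\<bar>integral {x..x + (y - x)} f / (y - x) - f x\<bar> < e"
          by (rule d1(2)[rule_format]) (use y True in \<open>auto simp: dist_real_def\<close>)
        ultimately show ?thesis by (simp add: dist_real_def)
      next
        case False
        then have "y < x" using y by auto
        have "F y - F x = integral {y..x} f"
          unfolding F_def using \<open>y < x\<close> by (intro indefinite_integral_diff f) auto
        then have "(F y - F x) / (y - x) + f x = - (integral {x - (x - y)..x} f / (x - y) - f x)"
          using \<open>y < x\<close> by (simp add: field_simps)
        moreover have "\<bar>integral {x - (x - y)..x} f / (x - y) - f x\<bar> < e"
          by (rule d2(2)[rule_format]) (use y \<open>y < x\<close> in \<open>auto simp: dist_real_def\<close>)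
        ultimately show ?thesis by (simp add: dist_real_def)
      qed
    qed (use d1 d2 in auto)
  qed
  then show thesis
    unfolding F_def has_real_derivative_iff_has_vector_derivative by (intro that[OF N(1)] allI impI)
qed

section \<open>Laplace transforms of weighted integrable kernels\<close>

text \<open>The parameter space \<open>M\<close> is carried along so that members of the class can be integrated over a
  parameter; \<open>c\<close> is the rate of the exponential weight and \<open>B\<close> bounds the weighted norm.\<close>

definition laplace_kernel ::
  "'p measure \<Rightarrow> real \<Rightarrow> ('p \<Rightarrow> real) \<Rightarrow> ('p \<Rightarrow> real \<Rightarrow> real) \<Rightarrow> ('p \<Rightarrow> real \<Rightarrow> real) \<Rightarrow> bool" where
  "laplace_kernel M c B F f \<longleftrightarrow>
     (\<lambda>(x, \<alpha>). f x \<alpha>) \<in> borel_measurable (M \<Otimes>\<^sub>M lborel) \<and>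
     (\<forall>x. \<forall>\<alpha><0. f x \<alpha> = 0) \<and>
     (\<forall>x\<in>space M. (\<integral>\<^sup>+\<alpha>. ennreal (\<bar>f x \<alpha>\<bar> * exp (- 2 * c * \<alpha>)) \<partial>lborel) \<le> ennreal (B x)) \<and>
     (\<forall>x\<in>space M. \<forall>\<kappa>\<ge>c. F x \<kappa> = (LINT \<alpha>|lborel. f x \<alpha> * exp (- 2 * \<kappa> * \<alpha>)))"

definition laplace_class ::
  "'p measure \<Rightarrow> real \<Rightarrow> ('p \<Rightarrow> real) \<Rightarrow> ('p \<Rightarrow> real \<Rightarrow> real) \<Rightarrow> bool" where
  "laplace_class M c B F \<longleftrightarrow> (\<exists>f. laplace_kernel M c B F f)"

text \<open>No integrability is assumed: a function that is not integrable has Bochner integral 0,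
  and the bound is then trivial.\<close>

lemma ennreal_norm_integral_le:
  fixes f :: "'a \<Rightarrow> real"
  shows "ennreal \<bar>LINT x|M. f x\<bar> \<le> (\<integral>\<^sup>+x. ennreal \<bar>f x\<bar> \<partial>M)"
proof (cases "integrable M f")
  case True
  then show ?thesis using integral_norm_bound_ennreal[OF True] by simp
qed (simp add: not_integrable_integral_eq)

lemma
  assumes "laplace_kernel M c B F f"
  shows laplace_kernel_measurable: "(\<lambda>(x, \<alpha>). f x \<alpha>) \<in> borel_measurable (M \<Otimes>\<^sub>M lborel)"
    and laplace_kernel_neg: "\<alpha> < 0 \<Longrightarrow> f x \<alpha> = 0"
    and laplace_kernel_bound: "x \<in> space M \<Longrightarrow>
      (\<integral>\<^sup>+\<alpha>. ennreal (\<bar>f x \<alpha>\<bar> * exp (- 2 * c * \<alpha>)) \<partial>lborel) \<le> ennreal (B x)"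
    and laplace_kernel_transform: "x \<in> space M \<Longrightarrow> c \<le> \<kappa> \<Longrightarrow>
      F x \<kappa> = (LINT \<alpha>|lborel. f x \<alpha> * exp (- 2 * \<kappa> * \<alpha>))"
  using assms unfolding laplace_kernel_def by blast+

lemma laplace_kernel_section:
  assumes "laplace_kernel M c B F f" "x \<in> space M"
  shows "f x \<in> borel_measurable borel"
proof -
  have "(\<lambda>\<alpha>. (\<lambda>(x, \<alpha>). f x \<alpha>) (x, \<alpha>)) \<in> borel_measurable lborel"
    by (rule measurable_compose[OF measurable_Pair1' laplace_kernel_measurable]) (use assms in auto)
  then show ?thesis by simp
qed

text \<open>The kernel lives on \<alpha> \<ge> 0, where the exponential weight decreases as its rate
  grows, so the bound at rate \<open>c\<close> serves every larger \<kappa>.\<close>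

lemma laplace_kernel_bound':
  assumes f: "laplace_kernel M c B F f" "x \<in> space M" "c \<le> \<kappa>"
  shows "(\<integral>\<^sup>+\<alpha>. ennreal \<bar>f x \<alpha> * exp (- 2 * \<kappa> * \<alpha>)\<bar> \<partial>lborel) \<le> ennreal (B x)"
proof -
  have "(\<integral>\<^sup>+\<alpha>. ennreal \<bar>f x \<alpha> * exp (- 2 * \<kappa> * \<alpha>)\<bar> \<partial>lborel)
     \<le> (\<integral>\<^sup>+\<alpha>. ennreal (\<bar>f x \<alpha>\<bar> * exp (- 2 * c * \<alpha>)) \<partial>lborel)"
  proof (intro nn_integral_mono ennreal_leI)
    fix \<alpha> :: real
    show "\<bar>f x \<alpha> * exp (- 2 * \<kappa> * \<alpha>)\<bar> \<le> \<bar>f x \<alpha>\<bar> * exp (- 2 * c * \<alpha>)"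
    proof (cases "\<alpha> < 0")
      case True then show ?thesis using laplace_kernel_neg[OF f(1)] by simp
    next
      case False
      then show ?thesis using \<open>c \<le> \<kappa>\<close> by (auto simp: abs_mult intro!: mult_left_mono mult_right_mono)
    qed
  qed
  also have "\<dots> \<le> ennreal (B x)" by (rule laplace_kernel_bound[OF f(1,2)])
  finally show ?thesis .
qed

lemma laplace_kernel_integrable:
  assumes f: "laplace_kernel M c B F f" "x \<in> space M" "c \<le> \<kappa>"
  shows "integrable lborel (\<lambda>\<alpha>. f x \<alpha> * exp (- 2 * \<kappa> * \<alpha>))"
proof (rule integrableI_bounded)
  have [measurable]: "f x \<in> borel_measurable borel" by (rule laplace_kernel_section[OF f(1,2)])
  show "(\<lambda>\<alpha>. f x \<alpha> * exp (- 2 * \<kappa> * \<alpha>)) \<in> borel_measurable lborel" by measurable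
  show "(\<integral>\<^sup>+ \<alpha>. ennreal (norm (f x \<alpha> * exp (- 2 * \<kappa> * \<alpha>))) \<partial>lborel) < \<infinity>"
    using laplace_kernel_bound'[OF f] by (simp add: order.strict_trans1[OF _ ennreal_less_top])
qed

lemma laplace_class_abs_le:
  assumes "laplace_class M c B F" "x \<in> space M" "c \<le> \<kappa>" "B x \<ge> 0"
  shows "\<bar>F x \<kappa>\<bar> \<le> B x"
proof -
  obtain f where f: "laplace_kernel M c B F f" using assms(1) unfolding laplace_class_def by blast
  have "ennreal \<bar>F x \<kappa>\<bar> \<le> ennreal (B x)"
    unfolding laplace_kernel_transform[OF f assms(2,3)]
    by (rule order.trans[OF ennreal_norm_integral_le laplace_kernel_bound'[OF f assms(2,3)]])
  then show ?thesis using assms(4) by simp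
qed

lemma laplace_class_measurable:
  assumes "laplace_class M c B F" "c \<le> \<kappa>"
  shows "(\<lambda>x. F x \<kappa>) \<in> borel_measurable M"
proof -
  obtain f where f: "laplace_kernel M c B F f" using assms(1) unfolding laplace_class_def by blast
  note [measurable] = laplace_kernel_measurable[OF f]
  have "(\<lambda>x. LINT \<alpha>|lborel. f x \<alpha> * exp (- 2 * \<kappa> * \<alpha>)) \<in> borel_measurable M"
    by measurable
  then show ?thesis
    by (rule measurable_cong[THEN iffD1, rotated]) (simp add: laplace_kernel_transform[OF f _ assms(2)])
qed

lemma laplace_class_cong:
  assumes "laplace_class M c B F" "\<And>x \<kappa>. x \<in> space M \<Longrightarrow> c \<le> \<kappa> \<Longrightarrow> F x \<kappa> = G x \<kappa>"
    and "\<And>x. x \<in> space M \<Longrightarrow> B x \<le> B' x"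
  shows "laplace_class M c B' G"
proof -
  obtain f where f: "laplace_kernel M c B F f" using assms(1) unfolding laplace_class_def by blast
  have "laplace_kernel M c B' G f"
    unfolding laplace_kernel_def
    using laplace_kernel_measurable[OF f] laplace_kernel_neg[OF f]
      order.trans[OF laplace_kernel_bound[OF f] ennreal_leI[OF assms(3)]]
      laplace_kernel_transform[OF f] assms(2) by auto
  then show ?thesis unfolding laplace_class_def by blast
qed

lemma laplace_class_rate_mono:
  assumes "laplace_class M c B F" "c \<le> c'"
  shows "laplace_class M c' B F"
proof -
  obtain f where f: "laplace_kernel M c B F f" using assms(1) unfolding laplace_class_def by blast
  have "laplace_kernel M c' B F f"
    unfolding laplace_kernel_def
    using laplace_kernel_measurable[OF f] laplace_kernel_neg[OF f]
      laplace_kernel_bound'[OF f _ assms(2)] laplace_kernel_transform[OF f] assms(2)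
    by (auto simp: abs_mult)
  then show ?thesis unfolding laplace_class_def by blast
qed

section \<open>Closure properties of the class of transforms\<close>

lemma laplace_class_comp:
  assumes "laplace_class M c B F" and t: "t \<in> measurable N M"
  shows "laplace_class N c (\<lambda>x. B (t x)) (\<lambda>x. F (t x))"
proof -
  obtain f where f: "laplace_kernel M c B F f" using assms(1) unfolding laplace_class_def by blast
  note [measurable] = laplace_kernel_measurable[OF f] t
  have "laplace_kernel N c (\<lambda>x. B (t x)) (\<lambda>x. F (t x)) (\<lambda>x. f (t x))"
    unfolding laplace_kernel_def
    using laplace_kernel_neg[OF f] laplace_kernel_bound[OF f] laplace_kernel_transform[OF f]
      measurable_space[OF t] by auto
  then show ?thesis unfolding laplace_class_def by blast
qed

lemma laplace_class_scale:
  assumes "laplace_class M c B F" and w[measurable]: "w \<in> borel_measurable M"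
  shows "laplace_class M c (\<lambda>x. \<bar>w x\<bar> * B x) (\<lambda>x \<kappa>. w x * F x \<kappa>)"
proof -
  obtain f where f: "laplace_kernel M c B F f" using assms(1) unfolding laplace_class_def by blast
  note [measurable] = laplace_kernel_measurable[OF f]
  have "laplace_kernel M c (\<lambda>x. \<bar>w x\<bar> * B x) (\<lambda>x \<kappa>. w x * F x \<kappa>) (\<lambda>x \<alpha>. w x * f x \<alpha>)"
    unfolding laplace_kernel_def
  proof (intro conjI allI ballI impI)
    fix x assume x: "x \<in> space M"
    have [measurable]: "f x \<in> borel_measurable borel" by (rule laplace_kernel_section[OF f x])
    have "(\<integral>\<^sup>+\<alpha>. ennreal (\<bar>w x * f x \<alpha>\<bar> * exp (- 2 * c * \<alpha>)) \<partial>lborel)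
       = ennreal \<bar>w x\<bar> * (\<integral>\<^sup>+\<alpha>. ennreal (\<bar>f x \<alpha>\<bar> * exp (- 2 * c * \<alpha>)) \<partial>lborel)"
      by (subst nn_integral_cmult[symmetric]) (auto simp: abs_mult ennreal_mult[symmetric] mult.assoc)
    also have "\<dots> \<le> ennreal \<bar>w x\<bar> * ennreal (B x)"
      by (intro mult_left_mono laplace_kernel_bound[OF f x]) auto
    also have "\<dots> = ennreal (\<bar>w x\<bar> * B x)" by (simp add: ennreal_mult')
    finally show "(\<integral>\<^sup>+\<alpha>. ennreal (\<bar>w x * f x \<alpha>\<bar> * exp (- 2 * c * \<alpha>)) \<partial>lborel) \<le> ennreal (\<bar>w x\<bar> * B x)" .
    fix \<kappa> assume "c \<le> \<kappa>"
    then show "w x * F x \<kappa> = (LINT \<alpha>|lborel. w x * f x \<alpha> * exp (- 2 * \<kappa> * \<alpha>))"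
      by (simp add: laplace_kernel_transform[OF f x] mult.assoc)
  qed (auto simp: laplace_kernel_neg[OF f])
  then show ?thesis unfolding laplace_class_def by blast
qed

lemma laplace_class_add:
  assumes "laplace_class M c A F" "laplace_class M c B G"
    and nonneg: "\<And>x. x \<in> space M \<Longrightarrow> 0 \<le> A x" "\<And>x. x \<in> space M \<Longrightarrow> 0 \<le> B x"
  shows "laplace_class M c (\<lambda>x. A x + B x) (\<lambda>x \<kappa>. F x \<kappa> + G x \<kappa>)"
proof -
  obtain f where f: "laplace_kernel M c A F f" using assms(1) unfolding laplace_class_def by blast
  obtain g where g: "laplace_kernel M c B G g" using assms(2) unfolding laplace_class_def by blast
  note [measurable] = laplace_kernel_measurable[OF f] laplace_kernel_measurable[OF g]
  have "laplace_kernel M c (\<lambda>x. A x + B x) (\<lambda>x \<kappa>. F x \<kappa> + G x \<kappa>) (\<lambda>x \<alpha>. f x \<alpha> + g x \<alpha>)"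
    unfolding laplace_kernel_def
  proof (intro conjI allI ballI impI)
    fix x assume x: "x \<in> space M"
    have [measurable]: "f x \<in> borel_measurable borel" "g x \<in> borel_measurable borel"
      by (rule laplace_kernel_section[OF f x] laplace_kernel_section[OF g x])+
    have "(\<integral>\<^sup>+\<alpha>. ennreal (\<bar>f x \<alpha> + g x \<alpha>\<bar> * exp (- 2 * c * \<alpha>)) \<partial>lborel)
      \<le> (\<integral>\<^sup>+\<alpha>. ennreal (\<bar>f x \<alpha>\<bar> * exp (- 2 * c * \<alpha>)) + ennreal (\<bar>g x \<alpha>\<bar> * exp (- 2 * c * \<alpha>)) \<partial>lborel)"
      by (intro nn_integral_mono)
        (auto simp: ennreal_plus[symmetric] distrib_right[symmetric] simp del: ennreal_plus
           intro!: ennreal_leI mult_right_mono)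
    also have "\<dots> = (\<integral>\<^sup>+\<alpha>. ennreal (\<bar>f x \<alpha>\<bar> * exp (- 2 * c * \<alpha>)) \<partial>lborel)
       + (\<integral>\<^sup>+\<alpha>. ennreal (\<bar>g x \<alpha>\<bar> * exp (- 2 * c * \<alpha>)) \<partial>lborel)"
      by (rule nn_integral_add) auto
    also have "\<dots> \<le> ennreal (A x) + ennreal (B x)"
      by (intro add_mono laplace_kernel_bound[OF f x] laplace_kernel_bound[OF g x])
    also have "\<dots> = ennreal (A x + B x)" using nonneg x by simp
    finally show "(\<integral>\<^sup>+\<alpha>. ennreal (\<bar>f x \<alpha> + g x \<alpha>\<bar> * exp (- 2 * c * \<alpha>)) \<partial>lborel) \<le> ennreal (A x + B x)" .
    fix \<kappa> assume k: "c \<le> \<kappa>"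
    then show "F x \<kappa> + G x \<kappa> = (LINT \<alpha>|lborel. (f x \<alpha> + g x \<alpha>) * exp (- 2 * \<kappa> * \<alpha>))"
      unfolding distrib_right
      using laplace_kernel_integrable[OF f x k] laplace_kernel_integrable[OF g x k]
      by (simp add: laplace_kernel_transform[OF f x k] laplace_kernel_transform[OF g x k])
  qed (auto simp: laplace_kernel_neg[OF f] laplace_kernel_neg[OF g])
  then show ?thesis unfolding laplace_class_def by blast
qed

text \<open>Multiplication by an exponential translates the kernel: \<open>f x \<alpha>\<close>
  becomes \<open>f x (\<alpha> - s x)\<close>. Nonnegativity of the translation keeps the kernel
  supported on \<alpha> \<ge> 0.\<close>

lemma laplace_class_shift:
  assumes "laplace_class M c B F" and s[measurable]: "s \<in> borel_measurable M"
    and s0: "\<And>x. 0 \<le> s x"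
  shows "laplace_class M c (\<lambda>x. exp (- 2 * c * s x) * B x) (\<lambda>x \<kappa>. exp (- 2 * \<kappa> * s x) * F x \<kappa>)"
proof -
  obtain f where f: "laplace_kernel M c B F f" using assms(1) unfolding laplace_class_def by blast
  note [measurable] = laplace_kernel_measurable[OF f]
  have "laplace_kernel M c (\<lambda>x. exp (- 2 * c * s x) * B x) (\<lambda>x \<kappa>. exp (- 2 * \<kappa> * s x) * F x \<kappa>)
     (\<lambda>x \<alpha>. f x (\<alpha> - s x))"
    unfolding laplace_kernel_def
  proof (intro conjI allI ballI impI)
    fix x assume x: "x \<in> space M"
    have [measurable]: "f x \<in> borel_measurable borel" by (rule laplace_kernel_section[OF f x])
    have "(\<integral>\<^sup>+\<alpha>. ennreal (\<bar>f x (\<alpha> - s x)\<bar> * exp (- 2 * c * \<alpha>)) \<partial>lborel)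
       = (\<integral>\<^sup>+\<alpha>. ennreal (\<bar>f x \<alpha>\<bar> * exp (- 2 * c * (s x + \<alpha>))) \<partial>lborel)"
      by (subst nn_integral_real_affine[where c = 1 and t = "s x"]) auto
    also have "\<dots> = ennreal (exp (- 2 * c * s x)) * (\<integral>\<^sup>+\<alpha>. ennreal (\<bar>f x \<alpha>\<bar> * exp (- 2 * c * \<alpha>)) \<partial>lborel)"
      by (subst nn_integral_cmult[symmetric])
        (auto simp: ennreal_mult[symmetric] mult_exp_exp algebra_simps simp flip: exp_add intro!: nn_integral_cong)
    also have "\<dots> \<le> ennreal (exp (- 2 * c * s x)) * ennreal (B x)"
      by (intro mult_left_mono laplace_kernel_bound[OF f x]) auto
    also have "\<dots> = ennreal (exp (- 2 * c * s x) * B x)" by (simp add: ennreal_mult')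
    finally show "(\<integral>\<^sup>+\<alpha>. ennreal (\<bar>f x (\<alpha> - s x)\<bar> * exp (- 2 * c * \<alpha>)) \<partial>lborel)
      \<le> ennreal (exp (- 2 * c * s x) * B x)" .
    fix \<kappa> assume k: "c \<le> \<kappa>"
    have "(LINT \<alpha>|lborel. f x (\<alpha> - s x) * exp (- 2 * \<kappa> * \<alpha>))
      = (LINT \<alpha>|lborel. f x \<alpha> * exp (- 2 * \<kappa> * (s x + \<alpha>)))"
      by (subst lborel_integral_real_affine[where c = 1 and t = "s x"]) auto
    also have "\<dots> = (LINT \<alpha>|lborel. exp (- 2 * \<kappa> * s x) * (f x \<alpha> * exp (- 2 * \<kappa> * \<alpha>)))"
      by (intro Bochner_Integration.integral_cong refl) (simp add: exp_add[symmetric] algebra_simps)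
    also have "\<dots> = exp (- 2 * \<kappa> * s x) * F x \<kappa>"
      by (simp add: laplace_kernel_transform[OF f x k])
    finally show "exp (- 2 * \<kappa> * s x) * F x \<kappa> = (LINT \<alpha>|lborel. f x (\<alpha> - s x) * exp (- 2 * \<kappa> * \<alpha>))" ..
  next
    fix x \<alpha> :: real and y assume "\<alpha> < 0"
    then show "f y (\<alpha> - s y) = 0" using laplace_kernel_neg[OF f, of "\<alpha> - s y" y] s0[of y] by simp
  qed measurable
  then show ?thesis unfolding laplace_class_def by blast
qed

text \<open>The closure property behind all the others: products are mixtures of shifts, and series are
  mixtures over counting measure.\<close>

lemma laplace_class_mixture:
  assumes "sigma_finite_measure N" "laplace_class (M \<Otimes>\<^sub>M N) c B F"
    and B': "\<And>x. x \<in> space M \<Longrightarrow> (\<integral>\<^sup>+y. ennreal (B (x, y)) \<partial>N) \<le> ennreal (B' x)"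
  shows "laplace_class M c B' (\<lambda>x \<kappa>. LINT y|N. F (x, y) \<kappa>)"
proof -
  interpret N: sigma_finite_measure N by fact
  interpret P: pair_sigma_finite N "lborel :: real measure" ..
  obtain f where f: "laplace_kernel (M \<Otimes>\<^sub>M N) c B F f"
    using assms(2) unfolding laplace_class_def by blast
  have fm[measurable]: "(\<lambda>z. f (fst z) (snd z)) \<in> borel_measurable ((M \<Otimes>\<^sub>M N) \<Otimes>\<^sub>M lborel)"
    using laplace_kernel_measurable[OF f] by (simp add: case_prod_unfold)
  have "laplace_kernel M c B' (\<lambda>x \<kappa>. LINT y|N. F (x, y) \<kappa>) (\<lambda>x \<alpha>. LINT y|N. f (x, y) \<alpha>)"
    unfolding laplace_kernel_def
  proof (intro conjI allI ballI impI)
    \<comment> \<open>The three variables are regrouped so that the one to be integrated out comes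
      last.\<close>
    have "(\<lambda>(w, y). f (fst w, y) (snd w)) \<in> borel_measurable ((M \<Otimes>\<^sub>M lborel) \<Otimes>\<^sub>M N)"
    proof -
      have "(\<lambda>z. ((fst (fst z), snd z), snd (fst z))) \<in> measurable ((M \<Otimes>\<^sub>M lborel) \<Otimes>\<^sub>M N) ((M \<Otimes>\<^sub>M N) \<Otimes>\<^sub>M (lborel :: real measure))"
        by measurable
      from measurable_compose[OF this fm] show ?thesis by (simp add: case_prod_unfold)
    qed
    from N.borel_measurable_lebesgue_integral[OF this]
    show "(\<lambda>(x, \<alpha>). LINT y|N. f (x, y) \<alpha>) \<in> borel_measurable (M \<Otimes>\<^sub>M lborel)"
      by (simp add: case_prod_unfold)
  next
    fix x and \<alpha> :: real assume "\<alpha> < 0"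
    then show "(LINT y|N. f (x, y) \<alpha>) = 0" by (simp add: laplace_kernel_neg[OF f])
  next
    fix x assume x: "x \<in> space M"
    have xm: "(\<lambda>(y, \<alpha>). f (x, y) \<alpha>) \<in> borel_measurable (N \<Otimes>\<^sub>M lborel)"
    proof -
      have "(\<lambda>z. ((x, fst z), snd z)) \<in> measurable (N \<Otimes>\<^sub>M lborel) ((M \<Otimes>\<^sub>M N) \<Otimes>\<^sub>M (lborel :: real measure))"
        using x by measurable
      from measurable_compose[OF this fm] show ?thesis by (simp add: case_prod_unfold)
    qed
    note [measurable] = xm
    have xa[measurable]: "(\<lambda>y. f (x, y) \<alpha>) \<in> borel_measurable N" for \<alpha>
      using measurable_compose[OF measurable_Pair2' xm, of \<alpha>] by simp
    have le: "(\<integral>\<^sup>+\<alpha>. (\<integral>\<^sup>+y. ennreal (\<bar>f (x, y) \<alpha>\<bar> * exp (- 2 * c * \<alpha>)) \<partial>N) \<partial>lborel) \<le> ennreal (B' x)"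
    proof -
      have "(\<integral>\<^sup>+\<alpha>. (\<integral>\<^sup>+y. ennreal (\<bar>f (x, y) \<alpha>\<bar> * exp (- 2 * c * \<alpha>)) \<partial>N) \<partial>lborel)
        = (\<integral>\<^sup>+y. (\<integral>\<^sup>+\<alpha>. ennreal (\<bar>f (x, y) \<alpha>\<bar> * exp (- 2 * c * \<alpha>)) \<partial>lborel) \<partial>N)"
        by (rule P.Fubini'[where f = "\<lambda>y \<alpha>. ennreal (\<bar>f (x, y) \<alpha>\<bar> * exp (- 2 * c * \<alpha>))"]) measurable
      also have "\<dots> \<le> (\<integral>\<^sup>+y. ennreal (B (x, y)) \<partial>N)"
        using x by (intro nn_integral_mono laplace_kernel_bound[OF f]) (auto simp: space_pair_measure)
      also have "\<dots> \<le> ennreal (B' x)" by (rule B'[OF x])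
      finally show ?thesis .
    qed
    have "(\<integral>\<^sup>+\<alpha>. ennreal (\<bar>LINT y|N. f (x, y) \<alpha>\<bar> * exp (- 2 * c * \<alpha>)) \<partial>lborel)
      \<le> (\<integral>\<^sup>+\<alpha>. (\<integral>\<^sup>+y. ennreal (\<bar>f (x, y) \<alpha>\<bar> * exp (- 2 * c * \<alpha>)) \<partial>N) \<partial>lborel)"
    proof (rule nn_integral_mono)
      fix \<alpha> :: real
      have "\<bar>LINT y|N. f (x, y) \<alpha>\<bar> * exp (- 2 * c * \<alpha>) = \<bar>LINT y|N. f (x, y) \<alpha> * exp (- 2 * c * \<alpha>)\<bar>"
        by (simp add: abs_mult)
      then show "ennreal (\<bar>LINT y|N. f (x, y) \<alpha>\<bar> * exp (- 2 * c * \<alpha>))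
         \<le> (\<integral>\<^sup>+y. ennreal (\<bar>f (x, y) \<alpha>\<bar> * exp (- 2 * c * \<alpha>)) \<partial>N)"
        using ennreal_norm_integral_le[where M = N and f = "\<lambda>y. f (x, y) \<alpha> * exp (- 2 * c * \<alpha>)"]
        by (simp add: abs_mult)
    qed
    with le show "(\<integral>\<^sup>+\<alpha>. ennreal (\<bar>LINT y|N. f (x, y) \<alpha>\<bar> * exp (- 2 * c * \<alpha>)) \<partial>lborel) \<le> ennreal (B' x)"
      by (rule order.trans[rotated])
    fix \<kappa> assume k: "c \<le> \<kappa>"
    have int: "integrable (N \<Otimes>\<^sub>M lborel) (\<lambda>(y, \<alpha>). f (x, y) \<alpha> * exp (- 2 * \<kappa> * \<alpha>))"
    proof (rule integrableI_bounded)
      show "(\<lambda>(y, \<alpha>). f (x, y) \<alpha> * exp (- 2 * \<kappa> * \<alpha>)) \<in> borel_measurable (N \<Otimes>\<^sub>M lborel)" by measurable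
      have "(\<integral>\<^sup>+z. ennreal (norm (case z of (y, \<alpha>) \<Rightarrow> f (x, y) \<alpha> * exp (- 2 * \<kappa> * \<alpha>))) \<partial>(N \<Otimes>\<^sub>M lborel))
         = (\<integral>\<^sup>+y. \<integral>\<^sup>+\<alpha>. ennreal \<bar>f (x, y) \<alpha> * exp (- 2 * \<kappa> * \<alpha>)\<bar> \<partial>lborel \<partial>N)"
        by (subst lborel.nn_integral_fst[symmetric]) (auto simp: case_prod_unfold)
      also have "\<dots> \<le> (\<integral>\<^sup>+y. ennreal (B (x, y)) \<partial>N)"
        using x k by (intro nn_integral_mono laplace_kernel_bound'[OF f]) (auto simp: space_pair_measure)
      also have "\<dots> \<le> ennreal (B' x)" by (rule B'[OF x])
      also have "\<dots> < \<infinity>" by simp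
      finally show "(\<integral>\<^sup>+z. ennreal (norm (case z of (y, \<alpha>) \<Rightarrow> f (x, y) \<alpha> * exp (- 2 * \<kappa> * \<alpha>))) \<partial>(N \<Otimes>\<^sub>M lborel)) < \<infinity>" .
    qed
    have "(LINT \<alpha>|lborel. (LINT y|N. f (x, y) \<alpha>) * exp (- 2 * \<kappa> * \<alpha>))
      = (LINT \<alpha>|lborel. LINT y|N. f (x, y) \<alpha> * exp (- 2 * \<kappa> * \<alpha>))"
      by simp
    also have "\<dots> = (LINT y|N. LINT \<alpha>|lborel. f (x, y) \<alpha> * exp (- 2 * \<kappa> * \<alpha>))"
      by (rule P.Fubini_integral[OF int])
    also have "\<dots> = (LINT y|N. F (x, y) \<kappa>)"
      using x k by (intro Bochner_Integration.integral_cong refl)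
        (simp add: laplace_kernel_transform[OF f] space_pair_measure)
    finally show "(LINT y|N. F (x, y) \<kappa>) = (LINT \<alpha>|lborel. (LINT y|N. f (x, y) \<alpha>) * exp (- 2 * \<kappa> * \<alpha>))" ..
  qed
  then show ?thesis unfolding laplace_class_def by blast
qed

lemma laplace_class_mult:
  assumes "laplace_class M c A F" "laplace_class M c B G"
    and nonneg: "\<And>x. x \<in> space M \<Longrightarrow> 0 \<le> A x" "\<And>x. x \<in> space M \<Longrightarrow> 0 \<le> B x"
  shows "laplace_class M c (\<lambda>x. A x * B x) (\<lambda>x \<kappa>. F x \<kappa> * G x \<kappa>)"
proof -
  obtain f where f: "laplace_kernel M c A F f" using assms(1) unfolding laplace_class_def by blast
  have fm[measurable]: "(\<lambda>z. f (fst z) (snd z)) \<in> borel_measurable (M \<Otimes>\<^sub>M lborel)"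
    using laplace_kernel_measurable[OF f] by (simp add: case_prod_unfold)
  have fst: "fst \<in> measurable (M \<Otimes>\<^sub>M (lborel :: real measure)) M" by measurable
  have sm: "(\<lambda>z. max 0 (snd z)) \<in> borel_measurable (M \<Otimes>\<^sub>M (lborel :: real measure))" by measurable
  \<comment> \<open>The convolution is written as the mixture over the position y of translates of
    the second kernel by y, weighted by the first kernel. The translation is \<open>max 0 y\<close>
    because it must be nonnegative everywhere; the first kernel vanishes for y < 0, so nothing
    changes.\<close>
  have *: "laplace_class (M \<Otimes>\<^sub>M lborel) c
     (\<lambda>z. \<bar>f (fst z) (snd z)\<bar> * (exp (- 2 * c * max 0 (snd z)) * B (fst z)))
     (\<lambda>z \<kappa>. f (fst z) (snd z) * (exp (- 2 * \<kappa> * max 0 (snd z)) * G (fst z) \<kappa>))"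
    by (intro laplace_class_scale laplace_class_shift laplace_class_comp[OF assms(2) fst] sm fm) auto
  have expk: "f x y * exp (- 2 * \<kappa> * max 0 y) = f x y * exp (- 2 * \<kappa> * y)" for x y \<kappa>
    using laplace_kernel_neg[OF f, of y x] by (cases "y < 0") auto
  have expk': "\<bar>f x y\<bar> * exp (- 2 * \<kappa> * max 0 y) = \<bar>f x y\<bar> * exp (- 2 * \<kappa> * y)" for x y \<kappa>
    using laplace_kernel_neg[OF f, of y x] by (cases "y < 0") auto
  have "laplace_class M c (\<lambda>x. A x * B x) (\<lambda>x \<kappa>. LINT y|lborel.
      f (fst (x, y)) (snd (x, y)) * (exp (- 2 * \<kappa> * max 0 (snd (x, y))) * G (fst (x, y)) \<kappa>))"
  proof (rule laplace_class_mixture[OF lborel.sigma_finite_measure_axioms *], goal_cases)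
    case (1 x)
    note x = this
    have [measurable]: "f x \<in> borel_measurable borel" by (rule laplace_kernel_section[OF f x])
    have "(\<integral>\<^sup>+y. ennreal (\<bar>f x y\<bar> * (exp (- (2 * c * max 0 y)) * B x)) \<partial>lborel)
       = (\<integral>\<^sup>+y. ennreal (\<bar>f x y\<bar> * exp (- 2 * c * y)) * ennreal (B x) \<partial>lborel)"
      using expk'[of x _ c] nonneg(2)[OF x]
      by (intro nn_integral_cong) (simp add: ennreal_mult[symmetric] mult.assoc[symmetric])
    also have "\<dots> = (\<integral>\<^sup>+y. ennreal (\<bar>f x y\<bar> * exp (- 2 * c * y)) \<partial>lborel) * ennreal (B x)"
      by (rule nn_integral_multc) measurable
    also have "\<dots> \<le> ennreal (A x) * ennreal (B x)"
      by (intro mult_right_mono laplace_kernel_bound[OF f x]) auto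
    finally show ?case using nonneg x by (simp add: ennreal_mult)
  qed
  then show ?thesis
  proof (rule laplace_class_cong)
    fix x \<kappa> assume x: "x \<in> space M" "c \<le> \<kappa>"
    have "(LINT y|lborel. f (fst (x, y)) (snd (x, y)) * (exp (- 2 * \<kappa> * max 0 (snd (x, y))) * G (fst (x, y)) \<kappa>))
      = (LINT y|lborel. (f x y * exp (- 2 * \<kappa> * y)) * G x \<kappa>)"
      by (intro Bochner_Integration.integral_cong refl) (simp add: mult.assoc[symmetric] expk[simplified])
    also have "\<dots> = F x \<kappa> * G x \<kappa>" by (simp add: laplace_kernel_transform[OF f x])
    finally show "(LINT y|lborel. f (fst (x, y)) (snd (x, y)) * (exp (- 2 * \<kappa> * max 0 (snd (x, y))) * G (fst (x, y)) \<kappa>)) = F x \<kappa> * G x \<kappa>" .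
  qed simp
qed

lemma laplace_class_suminf:
  fixes F :: "nat \<Rightarrow> 'p \<Rightarrow> real \<Rightarrow> real"
  assumes F: "\<And>n. laplace_class M c (\<lambda>_. B n) (F n)" and B: "\<And>n. 0 \<le> B n" "summable B"
  shows "laplace_class M c (\<lambda>_. suminf B) (\<lambda>x \<kappa>. \<Sum>n. F n x \<kappa>)"
proof -
  obtain f where f: "\<And>n. laplace_kernel M c (\<lambda>_. B n) (F n) (f n)"
    using F unfolding laplace_class_def by metis
  let ?C = "count_space (UNIV :: nat set)"
  \<comment> \<open>The index of the series becomes part of the parameter, so that the whole
    sequence is one member of the class over a product space.\<close>
  have "laplace_kernel (M \<Otimes>\<^sub>M ?C) c (\<lambda>z. B (snd z)) (\<lambda>z. F (snd z) (fst z)) (\<lambda>z. f (snd z) (fst z))"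
    unfolding laplace_kernel_def
  proof (intro conjI allI ballI impI)
    have "(\<lambda>z. f n (fst (fst z)) (snd z)) \<in> borel_measurable ((M \<Otimes>\<^sub>M ?C) \<Otimes>\<^sub>M (lborel :: real measure))" for n
    proof -
      have "(\<lambda>z. (fst (fst z), snd z)) \<in> measurable ((M \<Otimes>\<^sub>M ?C) \<Otimes>\<^sub>M (lborel :: real measure)) (M \<Otimes>\<^sub>M lborel)"
        by measurable
      from measurable_compose[OF this laplace_kernel_measurable[OF f[of n]]] show ?thesis by simp
    qed
    then have "(\<lambda>z. f (snd (fst z)) (fst (fst z)) (snd z)) \<in> borel_measurable ((M \<Otimes>\<^sub>M ?C) \<Otimes>\<^sub>M (lborel :: real measure))"
      by (rule measurable_compose_countable) measurable
    then show "(\<lambda>(z, \<alpha>). f (snd z) (fst z) \<alpha>) \<in> borel_measurable ((M \<Otimes>\<^sub>M ?C) \<Otimes>\<^sub>M lborel)"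
      by (simp add: case_prod_unfold)
  qed (auto simp: laplace_kernel_neg[OF f] space_pair_measure laplace_kernel_transform[OF f] intro!: laplace_kernel_bound[OF f, simplified])
  then have *: "laplace_class (M \<Otimes>\<^sub>M ?C) c (\<lambda>z. B (snd z)) (\<lambda>z. F (snd z) (fst z))"
    unfolding laplace_class_def by blast
  have "laplace_class M c (\<lambda>_. suminf B) (\<lambda>x \<kappa>. LINT n|?C. F (snd (x, n)) (fst (x, n)) \<kappa>)"
  proof (rule laplace_class_mixture[OF sigma_finite_measure_count_space *])
    show "(\<integral>\<^sup>+n. ennreal (B (snd (x, n))) \<partial>?C) \<le> ennreal (suminf B)" for x :: 'p
      using B by (simp add: nn_integral_count_space_nat suminf_ennreal2)
  qed
  then show ?thesis
  proof (rule laplace_class_cong)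
    fix x \<kappa> assume x: "x \<in> space M" "c \<le> \<kappa>"
    have "summable (\<lambda>n. \<bar>F n x \<kappa>\<bar>)"
      using laplace_class_abs_le[OF F x] B by (intro summable_comparison_test'[OF B(2)]) auto
    then show "(LINT n|?C. F (snd (x, n)) (fst (x, n)) \<kappa>) = (\<Sum>n. F n x \<kappa>)"
      by (simp add: integral_count_space_nat integrable_count_space_nat_iff)
  qed simp
qed

text \<open>Geometric series in the algebra, started at the first power: the constant 1 is the
  transform of a point mass and must be removed before the result can have an integrable
  kernel.\<close>

lemma laplace_class_inverse:
  assumes F: "laplace_class M c (\<lambda>_. r) F" and r: "0 \<le> r" "r < 1"
  shows "laplace_class M c (\<lambda>_. r / (1 - r)) (\<lambda>x \<kappa>. 1 / (1 + F x \<kappa>) - 1)"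
proof -
  have m: "laplace_class M c (\<lambda>_. r) (\<lambda>x \<kappa>. - F x \<kappa>)"
    using laplace_class_scale[OF F, of "\<lambda>_. - 1"] by simp
  have pow: "laplace_class M c (\<lambda>_. r ^ Suc n) (\<lambda>x \<kappa>. (- F x \<kappa>) ^ Suc n)" for n
  proof (induction n)
    case 0 show ?case using m by simp
  next
    case (Suc n)
    show ?case using laplace_class_mult[OF m Suc] r by simp
  qed
  have sm: "(\<lambda>n. r ^ Suc n) sums (r / (1 - r))"
    using sums_mult[OF geometric_sums[of r], of r] r by simp
  have "laplace_class M c (\<lambda>_. \<Sum>n. r ^ Suc n) (\<lambda>x \<kappa>. \<Sum>n. (- F x \<kappa>) ^ Suc n)"
    using r by (intro laplace_class_suminf pow sums_summable[OF sm]) auto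
  then show ?thesis
  proof (rule laplace_class_cong)
    fix x \<kappa> assume x: "x \<in> space M" "c \<le> \<kappa>"
    have "\<bar>F x \<kappa>\<bar> < 1" using laplace_class_abs_le[OF F x] r by simp
    then have "(\<lambda>n. (- F x \<kappa>) ^ Suc n) sums (- F x \<kappa> * (1 / (1 - (- F x \<kappa>))))"
      using sums_mult[OF geometric_sums[of "- F x \<kappa>"], of "- F x \<kappa>"] by simp
    moreover have "- F x \<kappa> * (1 / (1 - (- F x \<kappa>))) = 1 / (1 + F x \<kappa>) - 1"
      using \<open>\<bar>F x \<kappa>\<bar> < 1\<close> by (auto simp: field_simps)
    ultimately show "(\<Sum>n. (- F x \<kappa>) ^ Suc n) = 1 / (1 + F x \<kappa>) - 1"
      by (simp add: sums_iff)
  qed (use sm in \<open>simp add: sums_iff\<close>)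
qed

text \<open>The kernel is the indicator of the interval from 0 to \<open>max 0 (s x)\<close>, whose
  weighted norm is at most \<open>1 / (2 * c)\<close> however long the interval is. Because of
  \<open>max 0\<close> the transform vanishes for negative \<open>s x\<close>, which allows Volterra
  integrals over y \<ge> x to be written as integrals over the whole line.\<close>

lemma laplace_class_truncated_exp:
  assumes "c > 0" and s[measurable]: "s \<in> borel_measurable M"
  shows "laplace_class M c (\<lambda>_. 1 / (2 * c)) (\<lambda>x \<kappa>. (1 - exp (- 2 * \<kappa> * max 0 (s x))) / (2 * \<kappa>))"
proof -
  have *: "has_bochner_integral lborel (\<lambda>\<alpha>. indicator {0..max 0 t} \<alpha> * exp (- 2 * \<kappa> * \<alpha>))
      ((1 - exp (- 2 * \<kappa> * max 0 t)) / (2 * \<kappa>))" if "\<kappa> > 0" for \<kappa> t :: real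
  proof -
    have "has_bochner_integral lborel (\<lambda>\<alpha>. exp (- 2 * \<kappa> * \<alpha>) * indicator {0..max 0 t} \<alpha>)
      ((- exp (- 2 * \<kappa> * max 0 t) / (2 * \<kappa>)) - (- exp (- 2 * \<kappa> * 0) / (2 * \<kappa>)))"
      using that by (intro has_bochner_integral_FTC_Icc_nonneg[where F = "\<lambda>\<alpha>. - exp (- 2 * \<kappa> * \<alpha>) / (2 * \<kappa>)"])
       (auto intro!: derivative_eq_intros)
    then show ?thesis using that by (simp add: mult.commute diff_divide_distrib)
  qed
  have "laplace_kernel M c (\<lambda>_. 1 / (2 * c)) (\<lambda>x \<kappa>. (1 - exp (- 2 * \<kappa> * max 0 (s x))) / (2 * \<kappa>))
    (\<lambda>x \<alpha>. indicator {0..max 0 (s x)} \<alpha>)"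
    unfolding laplace_kernel_def
  proof (intro conjI allI ballI impI)
    show "(\<lambda>(x, \<alpha>). indicat_real {0..max 0 (s x)} \<alpha>) \<in> borel_measurable (M \<Otimes>\<^sub>M lborel)"
    proof -
      have "(\<lambda>(x, \<alpha>). indicat_real {0..max 0 (s x)} \<alpha>)
        = (\<lambda>z. if 0 \<le> snd z \<and> snd z \<le> max 0 (s (fst z)) then 1 else 0)"
        by (auto simp: indicator_def fun_eq_iff)
      then show ?thesis by simp
    qed
    fix x assume "x \<in> space M"
    have i: "integrable lborel (\<lambda>\<alpha>. indicator {0..max 0 (s x)} \<alpha> * exp (- 2 * c * \<alpha>))"
      "(LINT \<alpha>|lborel. indicator {0..max 0 (s x)} \<alpha> * exp (- 2 * c * \<alpha>)) = (1 - exp (- 2 * c * max 0 (s x))) / (2 * c)"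
      using *[OF \<open>c > 0\<close>, of "s x"] unfolding has_bochner_integral_iff by auto
    have "(\<integral>\<^sup>+ \<alpha>. ennreal (\<bar>indicator {0..max 0 (s x)} \<alpha>\<bar> * exp (- 2 * c * \<alpha>)) \<partial>lborel)
       = ennreal ((1 - exp (- 2 * c * max 0 (s x))) / (2 * c))"
      using nn_integral_eq_integral[OF i(1)] i(2) by simp
    also have "\<dots> \<le> ennreal (1 / (2 * c))"
      using \<open>c > 0\<close> by (intro ennreal_leI divide_right_mono) auto
    finally show "(\<integral>\<^sup>+ \<alpha>. ennreal (\<bar>indicator {0..max 0 (s x)} \<alpha>\<bar> * exp (- 2 * c * \<alpha>)) \<partial>lborel)
      \<le> ennreal (1 / (2 * c))" .
    fix \<kappa> assume "c \<le> \<kappa>"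
    then have "\<kappa> > 0" using \<open>c > 0\<close> by simp
    from *[OF this, of "s x"] show "(1 - exp (- 2 * \<kappa> * max 0 (s x))) / (2 * \<kappa>)
      = (LINT \<alpha>|lborel. indicator {0..max 0 (s x)} \<alpha> * exp (- 2 * \<kappa> * \<alpha>))"
      unfolding has_bochner_integral_iff by simp
  qed auto
  then show ?thesis unfolding laplace_class_def by blast
qed

section \<open>The Schroedinger equation\<close>

lemma absolutely_continuous_on_subset:
  assumes "absolutely_continuous_on S f" "T \<subseteq> S"
  shows "absolutely_continuous_on T f"
  unfolding absolutely_continuous_on_def
proof (intro allI impI)
  fix \<epsilon> :: real assume "\<epsilon> > 0"
  obtain \<delta> where \<delta>: "\<delta> > 0"
    "\<forall>d. d division_of \<Union>d \<longrightarrow> \<Union>d \<subseteq> S \<longrightarrow> (\<Sum>K\<in>d. Sup K - Inf K) < \<delta> \<longrightarrow>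
      (\<Sum>K\<in>d. norm (f (Sup K) - f (Inf K))) < \<epsilon>"
    by (rule absolutely_continuous_onD[OF assms(1) \<open>\<epsilon> > 0\<close>]) (rule that)
  show "\<exists>\<delta>>0. \<forall>d. d division_of \<Union>d \<and> \<Union>d \<subseteq> T \<and> (\<Sum>K\<in>d. Sup K - Inf K) < \<delta> \<longrightarrow>
      (\<Sum>K\<in>d. norm (f (Sup K) - f (Inf K))) < \<epsilon>"
    using \<delta> order.trans[OF _ assms(2)] by (intro exI[of _ \<delta>] conjI allI impI) (blast, blast)
qed

lemma absolutely_continuous_on_mult:
  fixes f g :: "real \<Rightarrow> 'a::real_normed_algebra"
  assumes f: "absolutely_continuous_on {a..b} f" and g: "absolutely_continuous_on {a..b} g"
  shows "absolutely_continuous_on {a..b} (\<lambda>x. f x * g x)"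
proof -
  have "bounded (f ` {a..b})" "bounded (g ` {a..b})"
    by (intro compact_imp_bounded compact_continuous_image absolutely_continuous_on_imp_continuous_on f g
        compact_Icc)+
  then obtain A B where "\<forall>y\<in>f ` {a..b}. norm y \<le> A" "\<forall>y\<in>g ` {a..b}. norm y \<le> B"
    unfolding bounded_iff by (elim exE) (rule that)
  then have A: "\<forall>x\<in>{a..b}. norm (f x) \<le> A" and B: "\<forall>x\<in>{a..b}. norm (g x) \<le> B" by blast+
  show ?thesis
  proof (rule absolutely_continuous_on_bounded_mult[OF f g, where B = "max A B"])
    fix x assume "x \<in> {a..b}"
    then show "norm (f x) \<le> max A B" "norm (g x) \<le> max A B"
      using A[rule_format, of x] B[rule_format, of x] by linarith+
  qed
qed

lemma absolutely_continuous_on_const: "absolutely_continuous_on S (\<lambda>_. c)"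
  by (rule absolutely_continuous_on_lipschitz[where B = 0]) simp

lemma absolutely_continuous_on_exp: "absolutely_continuous_on {a..b} (\<lambda>x::real. exp (c * x))"
proof (rule absolutely_continuous_on_deriv_continuous)
  show "((\<lambda>x. exp (c * x)) has_vector_derivative c * exp (c * x)) (at x within {a..b})" for x
    by (rule has_real_derivative_iff_has_vector_derivative[THEN iffD1]) (auto intro!: derivative_eq_intros)
  show "continuous_on {a..b} (\<lambda>x. c * exp (c * x))" by (intro continuous_intros)
qed

text \<open>An absolutely continuous function is the integral of its almost everywhere derivative;
  when that derivative agrees with a continuous function, the classical fundamental theorem makes it
  a derivative at every point, one-sided at the endpoints.\<close>

lemma absolutely_continuous_on_primitive:
  fixes w :: "real \<Rightarrow> real"
  assumes w: "absolutely_continuous_on {a..b} w" and w': "continuous_on {a..b} w'"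
    and N: "negligible N" and der: "\<And>x. x \<notin> N \<Longrightarrow> (w has_vector_derivative w' x) (at x)"
    and x: "x \<in> {a..b}"
  shows "(w has_vector_derivative w' x) (at x within {a..b})"
proof -
  have eq: "w y = w a + integral {a..y} w'" if "y \<in> {a..b}" for y
  proof -
    have *: "(w' has_integral (w y - w a)) {a..y}"
    proof (rule absolutely_continuous_on_has_integral[where f = w, OF _ _ N])
      show "absolutely_continuous_on {a..y} w"
        by (rule absolutely_continuous_on_subset[OF w]) (use that in auto)
      show "a \<le> y" using that by simp
      show "(w has_vector_derivative w' t) (at t within {a..y})" if "t \<in> {a..y} - N" for t
        by (rule has_vector_derivative_at_within, rule der) (use that in simp)
    qed
    show ?thesis unfolding integral_unique[OF *] by simp
  qed
  have "((\<lambda>y. w a + integral {a..y} w') has_vector_derivative 0 + w' x) (at x within {a..b})"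
    by (intro has_vector_derivative_add has_vector_derivative_const integral_has_vector_derivative[OF w' x])
  from has_vector_derivative_transform[OF x eq this] show ?thesis by simp
qed

text \<open>The integrals \<open>I\<close> are differentiable only almost everywhere; that \<open>w\<close> is differentiable
  everywhere comes from the continuity of \<open>w'\<close>, in which the singular terms cancel.\<close>

theorem variation_of_constants:
  fixes g :: "real \<Rightarrow> real"
  defines "I \<equiv> \<lambda>\<kappa> x. LINT y|lborel. indicator {x..} y * (exp (\<kappa> * y) * g y)"
  defines "w \<equiv> \<lambda>\<kappa> A B x. A * exp (\<kappa> * x) + B * exp (- \<kappa> * x)
     + (exp (- \<kappa> * x) * I \<kappa> x - exp (\<kappa> * x) * I (- \<kappa>) x) / (2 * \<kappa>)"
  defines "w' \<equiv> \<lambda>\<kappa> A B x. \<kappa> * A * exp (\<kappa> * x) - \<kappa> * B * exp (- \<kappa> * x)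
     - (exp (- \<kappa> * x) * I \<kappa> x + exp (\<kappa> * x) * I (- \<kappa>) x) / 2"
  assumes "\<kappa> > 0"
    and g: "integrable lborel (\<lambda>y. exp (\<kappa> * y) * g y)" "integrable lborel (\<lambda>y. exp (- \<kappa> * y) * g y)"
  shows "x \<in> {a..b} \<Longrightarrow> (w \<kappa> A B has_vector_derivative w' \<kappa> A B x) (at x within {a..b})"
    and "absolutely_continuous_on {a..b} (w' \<kappa> A B)"
    and "\<exists>N. negligible N \<and> (\<forall>x. x \<notin> N \<longrightarrow>
      (w' \<kappa> A B has_vector_derivative (\<kappa>\<^sup>2 * w \<kappa> A B x + g x)) (at x))"
proof -
  have ac_I: "absolutely_continuous_on {a..b} (I \<kappa>)" "absolutely_continuous_on {a..b} (I (- \<kappa>))" for a b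
    unfolding I_def using absolutely_continuous_on_indefinite_integral[OF g(1)]
      absolutely_continuous_on_indefinite_integral[OF g(2)] by auto
  note acs = absolutely_continuous_on_add absolutely_continuous_on_mult absolutely_continuous_on_const
    absolutely_continuous_on_exp ac_I
  \<comment> \<open>Signs and denominators are moved into constant factors, so that the rules for
    sums, products and constants suffice for both absolute continuity and differentiation.\<close>
  have weq: "w \<kappa> A B = (\<lambda>x. (A * exp (\<kappa> * x) + B * exp (- \<kappa> * x))
     + (1 / (2 * \<kappa>) * (exp (- \<kappa> * x) * I \<kappa> x) + (- 1 / (2 * \<kappa>)) * (exp (\<kappa> * x) * I (- \<kappa>) x)))"
    unfolding w_def by (auto simp: fun_eq_iff diff_divide_distrib)
  have w'eq: "w' \<kappa> A B = (\<lambda>x. ((\<kappa> * A) * exp (\<kappa> * x) + (- \<kappa> * B) * exp (- \<kappa> * x))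
     + ((- 1 / 2) * (exp (- \<kappa> * x) * I \<kappa> x) + (- 1 / 2) * (exp (\<kappa> * x) * I (- \<kappa>) x)))"
    unfolding w'_def by (auto simp: fun_eq_iff add_divide_distrib)
  have ac_w: "absolutely_continuous_on {a..b} (w \<kappa> A B)" for a b
    unfolding weq by (intro acs)
  have ac_w': "absolutely_continuous_on {a..b} (w' \<kappa> A B)" for a b
    unfolding w'eq by (intro acs)
  then show "absolutely_continuous_on {a..b} (w' \<kappa> A B)" .
  obtain N1 where N1: "negligible N1"
    "\<forall>x. x \<notin> N1 \<longrightarrow> (I \<kappa> has_vector_derivative - (exp (\<kappa> * x) * g x)) (at x)"
    by (rule indefinite_integral_has_derivative_AE[OF g(1)]) (rule that, assumption, simp only: I_def)
  obtain N2 where N2: "negligible N2"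
    "\<forall>x. x \<notin> N2 \<longrightarrow> (I (- \<kappa>) has_vector_derivative - (exp (- \<kappa> * x) * g x)) (at x)"
    by (rule indefinite_integral_has_derivative_AE[OF g(2)]) (rule that, assumption, simp only: I_def)
  have N: "negligible (N1 \<union> N2)" using N1 N2 by simp
  have ee: "exp (\<kappa> * x) * exp (- \<kappa> * x) = 1" for x by (simp flip: exp_add)
  have der: "(w \<kappa> A B has_vector_derivative w' \<kappa> A B x) (at x)"
    and der': "(w' \<kappa> A B has_vector_derivative (\<kappa>\<^sup>2 * w \<kappa> A B x + g x)) (at x)" if "x \<notin> N1 \<union> N2" for x
  proof -
    have d: "(I \<kappa> has_real_derivative - (exp (\<kappa> * x) * g x)) (at x)"
        "(I (- \<kappa>) has_real_derivative - (exp (- \<kappa> * x) * g x)) (at x)"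
      using N1(2)[rule_format, of x] N2(2)[rule_format, of x] that unfolding has_real_derivative_iff_has_vector_derivative by auto
    have e: "((\<lambda>x. exp (c * x)) has_real_derivative c * exp (c * x)) (at x)" for c :: real
      by (auto intro!: derivative_eq_intros)
    \<comment> \<open>In each of the two products the exponential factors cancel on the singular
      term and leave \<open>- g x\<close>. With opposite coefficients these terms cancel in
      \<open>w\<close>; with equal coefficients \<open>- 1 / 2\<close> they add up to
      \<open>g x\<close> in the derivative of \<open>w'\<close>.\<close>
    have p: "((\<lambda>x. exp (- \<kappa> * x) * I \<kappa> x) has_real_derivative - \<kappa> * (exp (- \<kappa> * x) * I \<kappa> x) - g x) (at x)"
      using DERIV_mult[OF e[of "- \<kappa>"] d(1)] ee[of x] by (simp add: algebra_simps)
    have m: "((\<lambda>x. exp (\<kappa> * x) * I (- \<kappa>) x) has_real_derivative \<kappa> * (exp (\<kappa> * x) * I (- \<kappa>) x) - g x) (at x)"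
      using DERIV_mult[OF e[of "\<kappa>"] d(2)] ee[of x] by (simp add: algebra_simps)
    have "(w \<kappa> A B has_real_derivative (A * (\<kappa> * exp (\<kappa> * x)) + B * (- \<kappa> * exp (- \<kappa> * x)))
      + (1 / (2 * \<kappa>) * (- \<kappa> * (exp (- \<kappa> * x) * I \<kappa> x) - g x)
      + (- 1 / (2 * \<kappa>)) * (\<kappa> * (exp (\<kappa> * x) * I (- \<kappa>) x) - g x))) (at x)"
      unfolding weq by (intro DERIV_add DERIV_cmult e p m)
    also have "(A * (\<kappa> * exp (\<kappa> * x)) + B * (- \<kappa> * exp (- \<kappa> * x)))
      + (1 / (2 * \<kappa>) * (- \<kappa> * (exp (- \<kappa> * x) * I \<kappa> x) - g x)
      + (- 1 / (2 * \<kappa>)) * (\<kappa> * (exp (\<kappa> * x) * I (- \<kappa>) x) - g x)) = w' \<kappa> A B x"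
      unfolding w'eq using \<open>\<kappa> > 0\<close> by (simp add: field_simps)
    finally show "(w \<kappa> A B has_vector_derivative w' \<kappa> A B x) (at x)"
      unfolding has_real_derivative_iff_has_vector_derivative .
    have "(w' \<kappa> A B has_real_derivative ((\<kappa> * A) * (\<kappa> * exp (\<kappa> * x)) + (- \<kappa> * B) * (- \<kappa> * exp (- \<kappa> * x)))
      + ((- 1 / 2) * (- \<kappa> * (exp (- \<kappa> * x) * I \<kappa> x) - g x)
      + (- 1 / 2) * (\<kappa> * (exp (\<kappa> * x) * I (- \<kappa>) x) - g x))) (at x)"
      unfolding w'eq by (intro DERIV_add DERIV_cmult e p m)
    also have "((\<kappa> * A) * (\<kappa> * exp (\<kappa> * x)) + (- \<kappa> * B) * (- \<kappa> * exp (- \<kappa> * x)))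
      + ((- 1 / 2) * (- \<kappa> * (exp (- \<kappa> * x) * I \<kappa> x) - g x)
      + (- 1 / 2) * (\<kappa> * (exp (\<kappa> * x) * I (- \<kappa>) x) - g x)) = \<kappa>\<^sup>2 * w \<kappa> A B x + g x"
      unfolding weq using \<open>\<kappa> > 0\<close> by (simp add: field_simps power2_eq_square)
    finally show "(w' \<kappa> A B has_vector_derivative (\<kappa>\<^sup>2 * w \<kappa> A B x + g x)) (at x)"
      unfolding has_real_derivative_iff_has_vector_derivative .
  qed
  show "(w \<kappa> A B has_vector_derivative w' \<kappa> A B x) (at x within {a..b})" if "x \<in> {a..b}"
    by (rule absolutely_continuous_on_primitive[OF ac_w absolutely_continuous_on_imp_continuous_on[OF ac_w'] N der that])
  show "\<exists>N. negligible N \<and> (\<forall>x. x \<notin> N \<longrightarrow>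
      (w' \<kappa> A B has_vector_derivative (\<kappa>\<^sup>2 * w \<kappa> A B x + g x)) (at x))"
    by (intro exI conjI allI impI) (rule N, rule der')
qed

section \<open>Wronskians and the well-definedness of the m-function\<close>

lemma schroedinger_solutionE:
  assumes "schroedinger_solution q b z u u'"
  obtains N where "negligible N"
    "\<forall>x\<in>{0<..<b} - N. (u' has_vector_derivative (of_real (q x) - z) * u x) (at x)"
proof -
  let ?P = "\<lambda>x. x \<in> {0<..<b} \<longrightarrow>
    (\<exists>u''. (u' has_vector_derivative u'') (at x) \<and> - u'' + complex_of_real (q x) * u x = z * u x)"
  have "AE x in lebesgue. ?P x"
    using assms unfolding schroedinger_solution_def by simp
  then obtain N where N: "N \<in> null_sets lebesgue" "{x \<in> space lebesgue. \<not> ?P x} \<subseteq> N"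
    unfolding eventually_ae_filter by blast
  show thesis
  proof (rule that[of N])
    show "negligible N" using N(1) by (simp add: negligible_iff_null_sets)
    show "\<forall>x\<in>{0<..<b} - N. (u' has_vector_derivative (of_real (q x) - z) * u x) (at x)"
    proof
      fix x assume "x \<in> {0<..<b} - N"
      then obtain u'' where u: "(u' has_vector_derivative u'') (at x)"
        "- u'' + complex_of_real (q x) * u x = z * u x" using N(2) by auto
      then have "u'' = (of_real (q x) - z) * u x" by (simp add: algebra_simps)
      then show "(u' has_vector_derivative (of_real (q x) - z) * u x) (at x)" using u(1) by simp
    qed
  qed
qed

text \<open>The terms with the potential cancel, so the derivative is 0 almost everywhere. That
  alone would not give constancy; the Wronskian is also absolutely continuous, being built from sums
  and products of absolutely continuous functions.\<close>

lemma wronskian_constant: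
  assumes u: "schroedinger_solution q b z u u'" and v: "schroedinger_solution q b z v v'"
    and x: "x \<in> {0..b}"
  shows "u' x * v x - u x * v' x = u' b * v b - u b * v' b"
proof -
  have du: "\<And>x. x \<in> {0..b} \<Longrightarrow> (u has_vector_derivative u' x) (at x within {0..b})"
    and dv: "\<And>x. x \<in> {0..b} \<Longrightarrow> (v has_vector_derivative v' x) (at x within {0..b})"
    and ac: "absolutely_continuous_on {0..b} u'" "absolutely_continuous_on {0..b} v'"
    using u v unfolding schroedinger_solution_def by auto
  have acu: "absolutely_continuous_on {0..b} u"
    by (rule absolutely_continuous_on_deriv_continuous[OF du absolutely_continuous_on_imp_continuous_on[OF ac(1)]])
  have acv: "absolutely_continuous_on {0..b} v"
    by (rule absolutely_continuous_on_deriv_continuous[OF dv absolutely_continuous_on_imp_continuous_on[OF ac(2)]])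
  define W where "W x = u' x * v x + (- 1) * (u x * v' x)" for x
  have acW: "absolutely_continuous_on {0..b} W"
    unfolding W_def by (intro absolutely_continuous_on_add absolutely_continuous_on_mult
        absolutely_continuous_on_const ac acu acv)
  obtain N1 where N1: "negligible N1"
    "\<forall>x\<in>{0<..<b} - N1. (u' has_vector_derivative (of_real (q x) - z) * u x) (at x)"
    by (rule schroedinger_solutionE[OF u]) (rule that)
  obtain N2 where N2: "negligible N2"
    "\<forall>x\<in>{0<..<b} - N2. (v' has_vector_derivative (of_real (q x) - z) * v x) (at x)"
    by (rule schroedinger_solutionE[OF v]) (rule that)
  have "((\<lambda>_. 0) has_integral (W b - W x)) {x..b}"
  proof (rule absolutely_continuous_on_has_integral[where f = W])
    show "absolutely_continuous_on {x..b} W"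
      by (rule absolutely_continuous_on_subset[OF acW]) (use x in auto)
    show "x \<le> b" using x by simp
    \<comment> \<open>The endpoints join the exceptional set because the equation is imposed on the
      open interval only.\<close>
    show "negligible (N1 \<union> N2 \<union> {0, b})" using N1 N2 by simp
    fix y assume y: "y \<in> {x..b} - (N1 \<union> N2 \<union> {0, b})"
    then have y': "y \<in> {0<..<b}" "y \<in> {0..b}" "y \<notin> N1" "y \<notin> N2" using x by auto
    have open_eq: "at y within {0..b} = at y" using y' by (intro at_within_interior) auto
    have d: "(u has_vector_derivative u' y) (at y)" "(v has_vector_derivative v' y) (at y)"
      "(u' has_vector_derivative (of_real (q y) - z) * u y) (at y)"
      "(v' has_vector_derivative (of_real (q y) - z) * v y) (at y)"
      using du[OF y'(2)] dv[OF y'(2)] N1(2) N2(2) y' by (simp_all add: open_eq)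
    have "(W has_vector_derivative (u' y * v' y + ((of_real (q y) - z) * u y) * v y)
       + (- 1) * (u y * ((of_real (q y) - z) * v y) + u' y * v' y)) (at y)"
      unfolding W_def by (intro has_vector_derivative_add has_vector_derivative_mult has_vector_derivative_mult_right d)
    then have "(W has_vector_derivative 0) (at y)" by (simp add: algebra_simps)
    then show "(W has_vector_derivative 0) (at y within {x..b})"
      by (rule has_vector_derivative_at_within)
  qed
  then have "W b - W x = 0" by (rule has_integral_unique) simp
  then show ?thesis unfolding W_def by simp
qed

text \<open>The definite description needs uniqueness of the quotient over all admissible solutions.
  Two of them share the boundary condition, so their Wronskian vanishes and the quotients at 0
  agree, provided the competitor does not vanish at 0. This last point is settled by the nowhere
  vanishing solution \<psi>, which replaces a uniqueness theorem for the initial value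
  problem.\<close>

theorem m_function_eqI:
  assumes b: "0 < b"
    and v: "schroedinger_solution q b z v v'" "boundary_condition b h v v'" "v 0 \<noteq> 0"
    and \<psi>: "schroedinger_solution q b z \<psi> \<psi>'" "\<And>x. x \<in> {0..b} \<Longrightarrow> \<psi> x \<noteq> 0"
  shows "m_function q b h z = v' 0 / v 0"
  unfolding m_function_def
proof (rule the_equality)
  show "\<exists>u u'. schroedinger_solution q b z u u' \<and> boundary_condition b h u u' \<and>
        (\<exists>x\<in>{0..b}. u x \<noteq> 0) \<and> v' 0 / v 0 = u' 0 / u 0"
    using v b by (intro exI[of _ v] exI[of _ v']) (auto intro!: bexI[of _ 0])
  fix w
  assume "\<exists>u u'. schroedinger_solution q b z u u' \<and> boundary_condition b h u u' \<and>
        (\<exists>x\<in>{0..b}. u x \<noteq> 0) \<and> w = u' 0 / u 0"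
  then obtain u u' where u: "schroedinger_solution q b z u u'" "boundary_condition b h u u'"
    "\<exists>x\<in>{0..b}. u x \<noteq> 0" "w = u' 0 / u 0" by blast
  \<comment> \<open>A common boundary condition makes the Cauchy data at \<open>b\<close> linearly
    dependent: for finite parameter both derivatives are the same multiple of the values, for the
    infinite one both values are 0.\<close>
  have "u' b * v b - u b * v' b = 0"
  proof (cases h)
    case (Finite_h h')
    then have "u' b = - of_real h' * u b" "v' b = - of_real h' * v b"
      using u(2) v(2) by (auto simp: eq_neg_iff_add_eq_0)
    then show ?thesis by simp
  next
    case Infinite_h
    then show ?thesis using u(2) v(2) by simp
  qed
  then have W: "u' 0 * v 0 = u 0 * v' 0"
    using wronskian_constant[OF u(1) v(1), of 0] b by simp
  have "u 0 \<noteq> 0"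
  proof
    assume "u 0 = 0"
    then have "u' 0 = 0" using W v(3) by simp
    \<comment> \<open>With zero Cauchy data at 0 the Wronskian with \<psi> vanishes throughout. It
      is the numerator of the derivative of \<open>u / \<psi>\<close>, so this quotient is constant,
      and its value at 0 is 0.\<close>
    have W\<psi>: "u' x * \<psi> x - u x * \<psi>' x = 0" if "x \<in> {0..b}" for x
      using wronskian_constant[OF u(1) \<psi>(1) that] wronskian_constant[OF u(1) \<psi>(1), of 0] b
        \<open>u 0 = 0\<close> \<open>u' 0 = 0\<close> by simp
    have "\<exists>c. \<forall>x\<in>{0..b}. u x / \<psi> x = c"
    proof (rule has_vector_derivative_zero_constant)
      fix x assume x: "x \<in> {0..b}"
      have "(u has_derivative (\<lambda>h. h *\<^sub>R u' x)) (at x within {0..b})"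
        "(\<psi> has_derivative (\<lambda>h. h *\<^sub>R \<psi>' x)) (at x within {0..b})"
        using u(1) \<psi>(1) x unfolding schroedinger_solution_def has_vector_derivative_def by auto
      from has_derivative_divide'[OF this \<psi>(2)[OF x]]
      have "((\<lambda>x. u x / \<psi> x) has_derivative (\<lambda>h. (h *\<^sub>R u' x * \<psi> x - u x * (h *\<^sub>R \<psi>' x)) / (\<psi> x * \<psi> x))) (at x within {0..b})" .
      moreover have "h *\<^sub>R u' x * \<psi> x - u x * (h *\<^sub>R \<psi>' x) = 0" for h
      proof -
        have "h *\<^sub>R u' x * \<psi> x - u x * (h *\<^sub>R \<psi>' x) = h *\<^sub>R (u' x * \<psi> x - u x * \<psi>' x)"
          by (simp add: scaleR_diff_right)
        then show ?thesis using W\<psi>[OF x] by simp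
      qed
      then have "(\<lambda>h. (h *\<^sub>R u' x * \<psi> x - u x * (h *\<^sub>R \<psi>' x)) / (\<psi> x * \<psi> x)) = (\<lambda>h. h *\<^sub>R 0)"
        by (simp only: div_0 scaleR_zero_right)
      ultimately show "((\<lambda>x. u x / \<psi> x) has_vector_derivative 0) (at x within {0..b})"
        unfolding has_vector_derivative_def by simp
    qed auto
    then obtain c where c: "\<forall>x\<in>{0..b}. u x / \<psi> x = c" by blast
    have "u 0 / \<psi> 0 = c" using c b by auto
    then have "c = 0" using \<open>u 0 = 0\<close> by simp
    then have "\<forall>x\<in>{0..b}. u x = 0" using c \<psi>(2) by simp
    then show False using u(3) by blast
  qed
  then show "w = v' 0 / v 0" using W v(3) u(4) by (simp add: frac_eq_eq mult.commute)
qed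

section \<open>The Volterra equation\<close>

text \<open>The kernel is the conjugate of \<open>sinh (\<kappa> * (y - x)) / \<kappa>\<close>, the
  kernel of variation of constants from the right endpoint, by the factor
  \<open>exp (\<kappa> * (b - x))\<close>. The conjugation removes all growth in \<kappa>. The cut
  at y = x is hidden in \<open>max 0\<close>, the cut at \<open>b\<close> in the support of the
  potential.\<close>

definition volterra_op :: "(real \<Rightarrow> real) \<Rightarrow> (real \<Rightarrow> real \<Rightarrow> real) \<Rightarrow> real \<Rightarrow> real \<Rightarrow> real" where
  "volterra_op q F x \<kappa> =
     (LINT y|lborel. q y * ((1 - exp (- 2 * \<kappa> * max 0 (y - x))) / (2 * \<kappa>) * F y \<kappa>))"

lemma laplace_class_weighted_integral:
  fixes F :: "real \<times> real \<Rightarrow> real \<Rightarrow> real"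
  assumes "laplace_class (lborel \<Otimes>\<^sub>M lborel) c (\<lambda>_. B) F" and q: "integrable lborel q" and "B \<ge> 0"
  shows "laplace_class lborel c (\<lambda>_. (LINT y|lborel. \<bar>q y\<bar>) * B) (\<lambda>x \<kappa>. LINT y|lborel. q y * F (x, y) \<kappa>)"
proof -
  have [measurable]: "q \<in> borel_measurable borel" using q by auto
  have "(\<lambda>z. q (snd z)) \<in> borel_measurable ((lborel :: real measure) \<Otimes>\<^sub>M lborel)" by measurable
  note * = laplace_class_scale[OF assms(1) this]
  have "laplace_class lborel c (\<lambda>_. (LINT y|lborel. \<bar>q y\<bar>) * B) (\<lambda>x \<kappa>. LINT y|lborel. q (snd (x, y)) * F (x, y) \<kappa>)"
  proof (rule laplace_class_mixture[OF lborel.sigma_finite_measure_axioms *])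
    fix x :: real
    have "(\<integral>\<^sup>+y. ennreal (\<bar>q (snd (x, y))\<bar> * B) \<partial>lborel) = (\<integral>\<^sup>+y. ennreal \<bar>q y\<bar> * ennreal B \<partial>lborel)"
      using \<open>B \<ge> 0\<close> by (intro nn_integral_cong) (simp add: ennreal_mult)
    also have "\<dots> = (\<integral>\<^sup>+y. ennreal \<bar>q y\<bar> \<partial>lborel) * ennreal B" by (rule nn_integral_multc) measurable
    also have "(\<integral>\<^sup>+y. ennreal \<bar>q y\<bar> \<partial>lborel) = ennreal (LINT y|lborel. \<bar>q y\<bar>)"
      using q by (intro nn_integral_eq_integral) auto
    finally show "(\<integral>\<^sup>+y. ennreal (\<bar>q (snd (x, y))\<bar> * B) \<partial>lborel) \<le> ennreal ((LINT y|lborel. \<bar>q y\<bar>) * B)"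
      using \<open>B \<ge> 0\<close> by (simp add: ennreal_mult)
  qed
  then show ?thesis by simp
qed

text \<open>The factor in the bound is the contraction constant: the norm of the potential from the
  weighted integral, times \<open>1 / (2 * c)\<close> from the kernel. It is made small by raising
  the rate.\<close>

lemma volterra_op_class:
  assumes F: "laplace_class lborel c (\<lambda>_. B) F" and q: "integrable lborel q" and "B \<ge> 0" "c > 0"
  shows "laplace_class lborel c (\<lambda>_. (LINT y|lborel. \<bar>q y\<bar>) / (2 * c) * B) (volterra_op q F)"
proof -
  have t: "laplace_class (lborel \<Otimes>\<^sub>M lborel) c (\<lambda>_. 1 / (2 * c))
    (\<lambda>z \<kappa>. (1 - exp (- 2 * \<kappa> * max 0 (snd z - fst z))) / (2 * \<kappa>))"
    by (rule laplace_class_truncated_exp[OF \<open>c > 0\<close>]) measurable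
  have F': "laplace_class (lborel \<Otimes>\<^sub>M lborel) c (\<lambda>_. B) (\<lambda>z. F (snd z))"
    by (rule laplace_class_comp[OF F]) measurable
  have "laplace_class (lborel \<Otimes>\<^sub>M lborel) c (\<lambda>_. 1 / (2 * c) * B)
    (\<lambda>z \<kappa>. (1 - exp (- 2 * \<kappa> * max 0 (snd z - fst z))) / (2 * \<kappa>) * F (snd z) \<kappa>)"
    using assms by (intro laplace_class_mult[OF t F']) auto
  from laplace_class_weighted_integral[OF this q] have
    "laplace_class lborel c (\<lambda>_. (LINT y|lborel. \<bar>q y\<bar>) * (1 / (2 * c) * B)) (\<lambda>x \<kappa>. LINT y|lborel. q y *
      ((1 - exp (- 2 * \<kappa> * max 0 (snd (x, y) - fst (x, y)))) / (2 * \<kappa>) * F (snd (x, y)) \<kappa>))"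
    using assms(3,4) by auto
  then show ?thesis
    by (rule laplace_class_cong) (simp_all add: volterra_op_def)
qed

text \<open>A pure exponential is the transform of a point mass and lies outside the class, so
  \<open>volterra_op_class\<close> does not apply to it. One application of the operator repairs
  this: the exponential only translates the kernel of the Volterra factor, without increasing its
  norm.\<close>

lemma volterra_op_exp_class:
  assumes \<tau>[measurable]: "\<tau> \<in> borel_measurable borel" "\<And>x. 0 \<le> \<tau> x"
    and q: "integrable lborel q" and "c > 0"
  shows "laplace_class lborel c (\<lambda>_. (LINT y|lborel. \<bar>q y\<bar>) / (2 * c))
    (volterra_op q (\<lambda>x \<kappa>. exp (- 2 * \<kappa> * \<tau> x)))"
proof -
  have t: "laplace_class (lborel \<Otimes>\<^sub>M lborel) c (\<lambda>_. 1 / (2 * c))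
    (\<lambda>z \<kappa>. (1 - exp (- 2 * \<kappa> * max 0 (snd z - fst z))) / (2 * \<kappa>))"
    by (rule laplace_class_truncated_exp[OF \<open>c > 0\<close>]) measurable
  have "laplace_class (lborel \<Otimes>\<^sub>M lborel) c (\<lambda>z. exp (- 2 * c * \<tau> (snd z)) * (1 / (2 * c)))
    (\<lambda>z \<kappa>. exp (- 2 * \<kappa> * \<tau> (snd z)) * ((1 - exp (- 2 * \<kappa> * max 0 (snd z - fst z))) / (2 * \<kappa>)))"
    by (rule laplace_class_shift[OF t]) (use \<tau>(2) in auto)
  then have "laplace_class (lborel \<Otimes>\<^sub>M lborel) c (\<lambda>_. 1 / (2 * c))
    (\<lambda>z \<kappa>. (1 - exp (- 2 * \<kappa> * max 0 (snd z - fst z))) / (2 * \<kappa>) * exp (- 2 * \<kappa> * \<tau> (snd z)))"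
  proof (rule laplace_class_cong)
    fix z :: "real \<times> real"
    have "exp (- 2 * c * \<tau> (snd z)) \<le> 1" using \<tau>(2)[of "snd z"] \<open>c > 0\<close> by simp
    then show "exp (- 2 * c * \<tau> (snd z)) * (1 / (2 * c)) \<le> 1 / (2 * c)"
      using \<open>c > 0\<close> by (intro mult_left_le_one_le) auto
  qed simp
  from laplace_class_weighted_integral[OF this q] have
    "laplace_class lborel c (\<lambda>_. (LINT y|lborel. \<bar>q y\<bar>) * (1 / (2 * c))) (\<lambda>x \<kappa>. LINT y|lborel. q y *
      ((1 - exp (- 2 * \<kappa> * max 0 (snd (x, y) - fst (x, y)))) / (2 * \<kappa>) * exp (- 2 * \<kappa> * \<tau> (snd (x, y)))))"
    using \<open>c > 0\<close> by auto
  then show ?thesis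
    by (rule laplace_class_cong) (simp_all add: volterra_op_def)
qed

lemma volterra_kernel_bound:
  fixes \<kappa> t :: real
  assumes "\<kappa> > 0"
  shows "\<bar>(1 - exp (- 2 * \<kappa> * max 0 t)) / (2 * \<kappa>)\<bar> \<le> 1 / (2 * \<kappa>)"
proof -
  have "exp (- 2 * \<kappa> * max 0 t) \<le> 1" using assms by simp
  then have "\<bar>1 - exp (- 2 * \<kappa> * max 0 t)\<bar> \<le> 1" by simp
  then show ?thesis using assms by (simp add: divide_right_mono)
qed

lemma volterra_op_integrable:
  fixes q f :: "real \<Rightarrow> real"
  assumes q: "integrable lborel q" and f[measurable]: "f \<in> borel_measurable borel" and fB: "\<And>y. \<bar>f y\<bar> \<le> B"
    and "\<kappa> > 0"
  shows "integrable lborel (\<lambda>y. q y * ((1 - exp (- 2 * \<kappa> * max 0 (y - x))) / (2 * \<kappa>) * f y))"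
    and "\<bar>q y * ((1 - exp (- 2 * \<kappa> * max 0 (y - x))) / (2 * \<kappa>) * f y)\<bar> \<le> \<bar>q y\<bar> * (1 / (2 * \<kappa>) * B)"
proof -
  have [measurable]: "q \<in> borel_measurable borel" using q by auto
  show le: "\<bar>q y * ((1 - exp (- 2 * \<kappa> * max 0 (y - x))) / (2 * \<kappa>) * f y)\<bar> \<le> \<bar>q y\<bar> * (1 / (2 * \<kappa>) * B)" for y
    unfolding abs_mult[of "q y"] abs_mult[of _ "f y"]
    by (intro mult_left_mono mult_mono fB volterra_kernel_bound \<open>\<kappa> > 0\<close>) (use \<open>\<kappa> > 0\<close> in auto)
  have "integrable lborel (\<lambda>y. q y * (1 / (2 * \<kappa>) * B))"
    using q by (rule integrable_mult_left)
  then show "integrable lborel (\<lambda>y. q y * ((1 - exp (- 2 * \<kappa> * max 0 (y - x))) / (2 * \<kappa>) * f y))"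
  proof (rule Bochner_Integration.integrable_bound)
    have "B \<ge> 0" using fB[of 0] by linarith
    show "AE y in lborel. norm (q y * ((1 - exp (- 2 * \<kappa> * max 0 (y - x))) / (2 * \<kappa>) * f y))
      \<le> norm (q y * (1 / (2 * \<kappa>) * B))"
      using le \<open>B \<ge> 0\<close> \<open>\<kappa> > 0\<close> by (auto simp: abs_mult)
  qed measurable
qed

text \<open>Neumann series with ratio \<open>r\<close>. The solution itself is the exponential plus
  \<open>S\<close>; only the remainder \<open>S\<close>, which starts with the first iterate, has an
  integrable kernel, and its norm is the sum of the powers of \<open>r\<close> from the first
  on.\<close>

theorem volterra_solution:
  assumes \<tau>[measurable]: "\<tau> \<in> borel_measurable borel" "\<And>x. 0 \<le> \<tau> x"
    and q: "integrable lborel q" and "c > 0" and r_def: "r = (LINT y|lborel. \<bar>q y\<bar>) / (2 * c)" and "r < 1"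
  obtains S where "laplace_class lborel c (\<lambda>_. r / (1 - r)) S"
    "\<forall>x. \<forall>\<kappa>\<ge>c. S x \<kappa> = volterra_op q (\<lambda>x \<kappa>. exp (- 2 * \<kappa> * \<tau> x) + S x \<kappa>) x \<kappa>"
proof -
  have [measurable]: "q \<in> borel_measurable borel" using q by auto
  have "r \<ge> 0" unfolding r_def using \<open>c > 0\<close> by (intro divide_nonneg_pos integral_nonneg_AE) auto
  define e where "e x \<kappa> = exp (- 2 * \<kappa> * \<tau> x)" for x \<kappa>
  \<comment> \<open>The index is moved by one: \<open>T n\<close> results from n + 1 applications,
    because the inhomogeneity \<open>e\<close> is not in the class.\<close>
  define T where "T n = (volterra_op q ^^ Suc n) e" for n
  have T_Suc: "T (Suc n) = volterra_op q (T n)" for n unfolding T_def by simp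
  have T_class: "laplace_class lborel c (\<lambda>_. r ^ Suc n) (T n)" for n
  proof (induction n)
    case 0
    then show ?case unfolding T_def e_def r_def
      using volterra_op_exp_class[OF \<tau> q \<open>c > 0\<close>] by simp
  next
    case (Suc n)
    show ?case unfolding T_Suc using volterra_op_class[OF Suc q _ \<open>c > 0\<close>] \<open>r \<ge> 0\<close>
      by (simp add: r_def[symmetric])
  qed
  have sm: "(\<lambda>n. r ^ Suc n) sums (r / (1 - r))"
    using sums_mult[OF geometric_sums[of r], of r] \<open>r \<ge> 0\<close> \<open>r < 1\<close> by simp
  define S where "S x \<kappa> = (\<Sum>n. T n x \<kappa>)" for x \<kappa>
  have S_class: "laplace_class lborel c (\<lambda>_. r / (1 - r)) S"
    using laplace_class_suminf[OF T_class _ sums_summable[OF sm]] \<open>r \<ge> 0\<close> sums_unique[OF sm]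
    unfolding S_def by simp
  have "S x \<kappa> = volterra_op q (\<lambda>x \<kappa>. e x \<kappa> + S x \<kappa>) x \<kappa>" if "\<kappa> \<ge> c" for x \<kappa>
  proof -
    have "\<kappa> > 0" using that \<open>c > 0\<close> by simp
    have Tb: "\<bar>T n y \<kappa>\<bar> \<le> r ^ Suc n" for n y
      using laplace_class_abs_le[OF T_class _ that, of y n] \<open>r \<ge> 0\<close> by simp
    have Tm[measurable]: "(\<lambda>y. T n y \<kappa>) \<in> borel_measurable borel" for n
      using laplace_class_measurable[OF T_class that] by simp
    have Tsum: "summable (\<lambda>n. T n y \<kappa>)" for y
      by (rule summable_comparison_test'[OF sums_summable[OF sm], of 0]) (simp add: Tb[simplified])
    have Ssum: "\<bar>S y \<kappa>\<bar> \<le> r / (1 - r)" for y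
      using laplace_class_abs_le[OF S_class _ that, of y] \<open>r \<ge> 0\<close> \<open>r < 1\<close> by simp
    have Sm[measurable]: "(\<lambda>y. S y \<kappa>) \<in> borel_measurable borel"
      using laplace_class_measurable[OF S_class that] by simp
    define k where "k y = q y * ((1 - exp (- 2 * \<kappa> * max 0 (y - x))) / (2 * \<kappa>))" for y
    have eb: "\<bar>e y \<kappa>\<bar> \<le> 1" for y unfolding e_def using \<tau>(2)[of y] \<open>\<kappa> > 0\<close> by simp
    have em[measurable]: "(\<lambda>y. e y \<kappa>) \<in> borel_measurable borel" unfolding e_def by measurable
    have ki: "integrable lborel (\<lambda>y. k y * f y)" if "f \<in> borel_measurable borel" "\<And>y. \<bar>f y\<bar> \<le> B" for f B
      using volterra_op_integrable(1)[OF q that \<open>\<kappa> > 0\<close>, of x] unfolding k_def by (simp add: mult.assoc)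
    have kb: "\<bar>k y * f y\<bar> \<le> \<bar>q y\<bar> * (1 / (2 * \<kappa>) * B)" if "f \<in> borel_measurable borel" "\<And>y. \<bar>f y\<bar> \<le> B" for f B y
      using volterra_op_integrable(2)[OF q that \<open>\<kappa> > 0\<close>, of y x] unfolding k_def by (simp add: mult.assoc)
    have v: "volterra_op q F x \<kappa> = (LINT y|lborel. k y * F y \<kappa>)" for F
      unfolding volterra_op_def k_def by (simp add: mult.assoc)
    have ab: "\<bar>k y * T n y \<kappa>\<bar> \<le> \<bar>q y\<bar> * (1 / (2 * \<kappa>) * r ^ Suc n)" for n y by (rule kb[OF Tm Tb])
    have sm': "summable (\<lambda>n. A * (1 / (2 * \<kappa>) * r ^ Suc n))" for A
      by (intro summable_mult sums_summable[OF sm])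
    \<comment> \<open>Membership in the class comes from the series of kernels, but the fixed point
      equation is checked for each \<kappa> separately, by interchanging sum and integral under the
      bound \<open>\<bar>q y\<bar> * (1 / (2 * \<kappa>) * r ^ Suc n)\<close>.\<close>
    have "(\<lambda>n. LINT y|lborel. k y * T n y \<kappa>) sums (LINT y|lborel. (\<Sum>n. k y * T n y \<kappa>))"
    proof (rule sums_integral)
      show "integrable lborel (\<lambda>y. k y * T n y \<kappa>)" for n by (rule ki[OF Tm Tb])
      show "AE y in lborel. summable (\<lambda>n. norm (k y * T n y \<kappa>))"
      proof (rule AE_I2)
        fix y show "summable (\<lambda>n. norm (k y * T n y \<kappa>))"
          by (rule summable_comparison_test'[OF sm'[of "\<bar>q y\<bar>"], of 0]) (use ab in simp)
      qed
      show "summable (\<lambda>n. LINT y|lborel. norm (k y * T n y \<kappa>))"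
      proof (rule summable_comparison_test'[OF sm'[of "LINT y|lborel. \<bar>q y\<bar>"], of 0])
        fix n
        have "(LINT y|lborel. norm (k y * T n y \<kappa>)) \<le> (LINT y|lborel. \<bar>q y\<bar> * (1 / (2 * \<kappa>) * r ^ Suc n))"
          using ab q by (intro integral_mono integrable_norm ki[OF Tm Tb] integrable_mult_left integrable_abs) auto
        also have "\<dots> = (LINT y|lborel. \<bar>q y\<bar>) * (1 / (2 * \<kappa>) * r ^ Suc n)"
          by (rule integral_mult_left_zero)
        finally show "norm (LINT y|lborel. norm (k y * T n y \<kappa>)) \<le> (LINT y|lborel. \<bar>q y\<bar>) * (1 / (2 * \<kappa>) * r ^ Suc n)"
          by (simp add: integral_nonneg_AE)
      qed
    qed
    moreover have "(\<Sum>n. k y * T n y \<kappa>) = k y * S y \<kappa>" for y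
      unfolding S_def by (rule suminf_mult[OF Tsum])
    moreover have "(LINT y|lborel. k y * T n y \<kappa>) = T (Suc n) x \<kappa>" for n
      unfolding T_Suc v ..
    ultimately have 1: "(\<lambda>n. T (Suc n) x \<kappa>) sums (LINT y|lborel. k y * S y \<kappa>)" by simp
    have "S x \<kappa> = T 0 x \<kappa> + (LINT y|lborel. k y * S y \<kappa>)"
      unfolding S_def[of x] using suminf_split_head[OF Tsum[of x]] sums_unique[OF 1] by simp
    also have "T 0 x \<kappa> = (LINT y|lborel. k y * e y \<kappa>)" unfolding T_def by (simp add: v)
    also have "(LINT y|lborel. k y * e y \<kappa>) + (LINT y|lborel. k y * S y \<kappa>) = (LINT y|lborel. k y * e y \<kappa> + k y * S y \<kappa>)"
      by (rule Bochner_Integration.integral_add[symmetric]) (rule ki[OF em eb] ki[OF Sm Ssum])+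
    finally show ?thesis unfolding v by (simp add: distrib_left)
  qed
  then have "\<forall>x. \<forall>\<kappa>\<ge>c. S x \<kappa> = volterra_op q (\<lambda>x \<kappa>. exp (- 2 * \<kappa> * \<tau> x) + S x \<kappa>) x \<kappa>"
    unfolding e_def by blast
  then show thesis by (rule that[OF S_class])
qed

text \<open>After multiplication by \<open>exp (\<kappa> * (b - x))\<close> the Volterra equation is
  the formula of \<open>variation_of_constants\<close> with \<open>g = q * w\<close>. The numbers
  \<open>A\<close> and \<open>B\<close> describe the free solution and hence the Cauchy data at
  \<open>b\<close>; the data at 0 are expressed by two integrals of \<open>q * p\<close>, from which
  the transforms are later read off.\<close>

theorem volterra_schroedinger_solution:
  fixes q p e :: "real \<Rightarrow> real"
  assumes b: "0 < b" and q: "integrable lborel q" and q0: "\<And>x. x \<notin> {0<..<b} \<Longrightarrow> q x = 0"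
    and "\<kappa> > 0" and p[measurable]: "p \<in> borel_measurable borel" and pC: "\<And>x. \<bar>p x\<bar> \<le> C"
    and eq: "\<And>x. x \<in> {0..b} \<Longrightarrow> p x = e x + volterra_op q (\<lambda>y _. p y) x \<kappa>"
    and e: "\<And>x. x \<in> {0..b} \<Longrightarrow> exp (\<kappa> * (b - x)) * e x = A * exp (\<kappa> * x) + B * exp (- \<kappa> * x)"
  defines "w \<equiv> \<lambda>x. exp (\<kappa> * (b - x)) * p x"
  obtains w' where
    "schroedinger_solution q b (of_real (- (\<kappa>\<^sup>2))) (\<lambda>x. of_real (w x)) (\<lambda>x. of_real (w' x))"
    "w b = A * exp (\<kappa> * b) + B * exp (- \<kappa> * b)" "w' b = \<kappa> * A * exp (\<kappa> * b) - \<kappa> * B * exp (- \<kappa> * b)"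
    "w' 0 = \<kappa> * A - \<kappa> * B - exp (\<kappa> * b) * ((LINT y|lborel. q y * p y) + (LINT y|lborel. exp (- 2 * \<kappa> * y) * (q y * p y))) / 2"
    "w 0 = A + B + exp (\<kappa> * b) * ((LINT y|lborel. q y * p y) - (LINT y|lborel. exp (- 2 * \<kappa> * y) * (q y * p y))) / (2 * \<kappa>)"
proof -
  have qm[measurable]: "q \<in> borel_measurable borel" using q by auto
  define g where "g y = q y * w y" for y
  have gp_eq: "exp (\<kappa> * y) * g y = exp (\<kappa> * b) * (q y * p y)" for y
    unfolding g_def w_def by (simp add: exp_add[symmetric] algebra_simps flip: exp_add)
  have gm_eq: "exp (- \<kappa> * y) * g y = exp (\<kappa> * b) * (exp (- 2 * \<kappa> * y) * (q y * p y))" for y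
  proof -
    have "exp (- \<kappa> * y) * exp (\<kappa> * (b - y)) = exp (\<kappa> * b) * exp (- 2 * \<kappa> * y)"
      by (simp add: exp_add[symmetric] algebra_simps)
    then show ?thesis unfolding g_def w_def by (metis (no_types, opaque_lifting) mult.assoc mult.left_commute)
  qed
  have "C \<ge> 0" using pC[of 0] by linarith
  have qC: "integrable lborel (\<lambda>y. q y * C)" using q by (rule integrable_mult_left)
  have i0: "integrable lborel (\<lambda>y. q y * p y)"
    using pC \<open>C \<ge> 0\<close> by (intro Bochner_Integration.integrable_bound[OF qC]) (auto simp: abs_mult intro!: mult_left_mono)
  have i1: "integrable lborel (\<lambda>y. exp (- 2 * \<kappa> * y) * (q y * p y))"
  proof (rule Bochner_Integration.integrable_bound[OF qC])
    show "AE y in lborel. norm (exp (- 2 * \<kappa> * y) * (q y * p y)) \<le> norm (q y * C)"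
    proof (rule AE_I2)
      fix y
      show "norm (exp (- 2 * \<kappa> * y) * (q y * p y)) \<le> norm (q y * C)"
      proof (cases "y \<in> {0<..<b}")
        case True
        then have "exp (- 2 * \<kappa> * y) \<le> 1" using \<open>\<kappa> > 0\<close> by simp
        then have "exp (- 2 * \<kappa> * y) * (\<bar>q y\<bar> * \<bar>p y\<bar>) \<le> 1 * (\<bar>q y\<bar> * C)"
          by (intro mult_mono pC) auto
        then show ?thesis using \<open>C \<ge> 0\<close> by (simp add: abs_mult)
      qed (simp add: q0)
    qed
  qed measurable
  have g: "integrable lborel (\<lambda>y. exp (\<kappa> * y) * g y)" "integrable lborel (\<lambda>y. exp (- \<kappa> * y) * g y)"
    unfolding gp_eq gm_eq using i0 i1 by (auto intro: integrable_mult_right)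
  define I where "I \<kappa> x = (LINT y|lborel. indicator {x..} y * (exp (\<kappa> * y) * g y))" for \<kappa> x
  define W where "W x = A * exp (\<kappa> * x) + B * exp (- \<kappa> * x)
     + (exp (- \<kappa> * x) * I \<kappa> x - exp (\<kappa> * x) * I (- \<kappa>) x) / (2 * \<kappa>)" for x
  define w' where "w' x = \<kappa> * A * exp (\<kappa> * x) - \<kappa> * B * exp (- \<kappa> * x)
     - (exp (- \<kappa> * x) * I \<kappa> x + exp (\<kappa> * x) * I (- \<kappa>) x) / 2" for x
  note voc = variation_of_constants[OF \<open>\<kappa> > 0\<close> g, where A = A and B = B, folded I_def, folded W_def w'_def]
  have wW: "w x = W x" if x: "x \<in> {0..b}" for x
  proof -
    have Ii: "integrable lborel (\<lambda>y. indicator {x..} y * (exp (\<kappa> * y) * g y))"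
       "integrable lborel (\<lambda>y. indicator {x..} y * (exp (- \<kappa> * y) * g y))"
      using integrable_mult_indicator[OF _ g(1), of "{x..}"] integrable_mult_indicator[OF _ g(2), of "{x..}"] by auto
    have "exp (\<kappa> * (b - x)) * volterra_op q (\<lambda>y _. p y) x \<kappa>
      = (LINT y|lborel. exp (\<kappa> * (b - x)) * (q y * ((1 - exp (- 2 * \<kappa> * max 0 (y - x))) / (2 * \<kappa>) * p y)))"
      unfolding volterra_op_def by simp
    also have "\<dots> = (LINT y|lborel. exp (- \<kappa> * x) / (2 * \<kappa>) * (indicator {x..} y * (exp (\<kappa> * y) * g y))
       - exp (\<kappa> * x) / (2 * \<kappa>) * (indicator {x..} y * (exp (- \<kappa> * y) * g y)))"
    proof (rule Bochner_Integration.integral_cong[OF refl])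
      fix y
      show "exp (\<kappa> * (b - x)) * (q y * ((1 - exp (- 2 * \<kappa> * max 0 (y - x))) / (2 * \<kappa>) * p y))
        = exp (- \<kappa> * x) / (2 * \<kappa>) * (indicator {x..} y * (exp (\<kappa> * y) * g y))
       - exp (\<kappa> * x) / (2 * \<kappa>) * (indicator {x..} y * (exp (- \<kappa> * y) * g y))"
      proof (cases "x \<le> y")
        case True
        \<comment> \<open>Both exponentials of the kernel separate into a factor in x and a factor
          in y; the factors in y are those of the two integrals \<open>I\<close>.\<close>
        have e1: "exp (\<kappa> * (b - x)) = exp (- \<kappa> * x) * exp (\<kappa> * b)"
          by (simp add: exp_add[symmetric] algebra_simps)
        have e2: "exp (\<kappa> * (b - x)) * exp (- 2 * \<kappa> * (y - x)) = exp (\<kappa> * x) * exp (\<kappa> * b) * exp (- 2 * \<kappa> * y)"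
          by (simp add: exp_add[symmetric] algebra_simps)
        have "exp (\<kappa> * (b - x)) * (q y * ((1 - exp (- 2 * \<kappa> * (y - x))) / (2 * \<kappa>) * p y))
          = (exp (\<kappa> * (b - x)) - exp (\<kappa> * (b - x)) * exp (- 2 * \<kappa> * (y - x))) * (q y * p y) / (2 * \<kappa>)"
          by (simp add: algebra_simps)
        also have "\<dots> = exp (- \<kappa> * x) / (2 * \<kappa>) * (exp (\<kappa> * b) * (q y * p y))
          - exp (\<kappa> * x) / (2 * \<kappa>) * (exp (\<kappa> * b) * (exp (- 2 * \<kappa> * y) * (q y * p y)))"
          unfolding e2 unfolding e1 by (simp add: algebra_simps diff_divide_distrib)
        finally show ?thesis unfolding gp_eq gm_eq using True by simp
      qed simp
    qed
    also have "\<dots> = exp (- \<kappa> * x) / (2 * \<kappa>) * I \<kappa> x - exp (\<kappa> * x) / (2 * \<kappa>) * I (- \<kappa>) x"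
      unfolding I_def using Ii by (subst Bochner_Integration.integral_diff) auto
    finally have *: "exp (\<kappa> * (b - x)) * volterra_op q (\<lambda>y _. p y) x \<kappa>
      = exp (- \<kappa> * x) / (2 * \<kappa>) * I \<kappa> x - exp (\<kappa> * x) / (2 * \<kappa>) * I (- \<kappa>) x" .
    have "w x = exp (\<kappa> * (b - x)) * e x + exp (\<kappa> * (b - x)) * volterra_op q (\<lambda>y _. p y) x \<kappa>"
      unfolding w_def using eq[OF x] by (simp add: distrib_left)
    then show ?thesis unfolding * e[OF x] W_def by (simp add: diff_divide_distrib)
  qed
  \<comment> \<open>The potential vanishes from \<open>b\<close> on, so at \<open>b\<close> only the
    free solution is left.\<close>
  have Ib: "I \<kappa>' b = 0" for \<kappa>'
  proof -
    have "(\<lambda>y. indicator {b..} y * (exp (\<kappa>' * y) * g y)) = (\<lambda>_. 0 :: real)"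
      using q0 by (auto simp: g_def indicator_def fun_eq_iff)
    then show ?thesis unfolding I_def by simp
  qed
  \<comment> \<open>The potential also vanishes to the left of 0, so the integrals from 0 upwards
    are integrals over the whole line.\<close>
  have I0: "I \<kappa>' 0 = (LINT y|lborel. exp (\<kappa>' * y) * g y)" for \<kappa>'
    unfolding I_def using q0 by (intro Bochner_Integration.integral_cong refl) (auto simp: g_def indicator_def)
  have I0p: "I \<kappa> 0 = exp (\<kappa> * b) * (LINT y|lborel. q y * p y)" unfolding I0 gp_eq by simp
  have I0m: "I (- \<kappa>) 0 = exp (\<kappa> * b) * (LINT y|lborel. exp (- 2 * \<kappa> * y) * (q y * p y))" unfolding I0 gm_eq by simp
  show thesis
  proof (rule that[of w'])
    show "w b = A * exp (\<kappa> * b) + B * exp (- \<kappa> * b)" using wW[of b] b by (simp add: W_def Ib)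
    show "w' b = \<kappa> * A * exp (\<kappa> * b) - \<kappa> * B * exp (- \<kappa> * b)" by (simp add: w'_def Ib)
    show "w' 0 = \<kappa> * A - \<kappa> * B - exp (\<kappa> * b) * ((LINT y|lborel. q y * p y) + (LINT y|lborel. exp (- 2 * \<kappa> * y) * (q y * p y))) / 2"
      unfolding w'_def I0p I0m by (simp add: algebra_simps)
    show "w 0 = A + B + exp (\<kappa> * b) * ((LINT y|lborel. q y * p y) - (LINT y|lborel. exp (- 2 * \<kappa> * y) * (q y * p y))) / (2 * \<kappa>)"
      using wW[of 0] b unfolding W_def I0p I0m by (simp add: algebra_simps)
    show "schroedinger_solution q b (of_real (- (\<kappa>\<^sup>2))) (\<lambda>x. of_real (w x)) (\<lambda>x. of_real (w' x))"
      unfolding schroedinger_solution_def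
    proof (intro conjI ballI)
      fix x assume x: "x \<in> {0..b}"
      have "(w has_vector_derivative w' x) (at x within {0..b})"
        by (rule has_vector_derivative_transform[OF x wW voc(1)[OF x]])
      then show "((\<lambda>x. of_real (w x)) has_vector_derivative complex_of_real (w' x)) (at x within {0..b})"
        by (rule bounded_linear.has_vector_derivative[OF bounded_linear_of_real])
    next
      show "absolutely_continuous_on {0..b} (\<lambda>x. complex_of_real (w' x))"
        using voc(2) unfolding absolutely_continuous_on_def by (simp flip: of_real_diff add: norm_of_real)
    next
      obtain N where N: "negligible N" "\<forall>x. x \<notin> N \<longrightarrow> (w' has_vector_derivative (\<kappa>\<^sup>2 * W x + g x)) (at x)"
        using voc(3) by (elim exE conjE) (rule that)
      show "AE x in lebesgue. x \<in> {0<..<b} \<longrightarrow>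
        (\<exists>u''. ((\<lambda>x. complex_of_real (w' x)) has_vector_derivative u'') (at x) \<and>
               - u'' + complex_of_real (q x) * of_real (w x) = of_real (- (\<kappa>\<^sup>2)) * of_real (w x))"
      proof (rule AE_I'[of N])
        show "N \<in> null_sets lebesgue" using N(1) by (simp add: negligible_iff_null_sets)
        have "\<exists>u''. ((\<lambda>x. complex_of_real (w' x)) has_vector_derivative u'') (at x) \<and>
               - u'' + complex_of_real (q x) * of_real (w x) = of_real (- (\<kappa>\<^sup>2)) * of_real (w x)"
          if "x \<notin> N" "x \<in> {0<..<b}" for x
        proof (intro exI conjI)
          show "((\<lambda>x. complex_of_real (w' x)) has_vector_derivative of_real (\<kappa>\<^sup>2 * W x + g x)) (at x)"
            using N(2) that(1) by (intro bounded_linear.has_vector_derivative[OF bounded_linear_of_real]) auto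
          show "- complex_of_real (\<kappa>\<^sup>2 * W x + g x) + complex_of_real (q x) * of_real (w x) = of_real (- (\<kappa>\<^sup>2)) * of_real (w x)"
            using wW[of x] that(2) by (simp add: g_def algebra_simps)
        qed
        then show "{x \<in> space lebesgue. \<not> (x \<in> {0<..<b} \<longrightarrow>
          (\<exists>u''. ((\<lambda>x. complex_of_real (w' x)) has_vector_derivative u'') (at x) \<and>
               - u'' + complex_of_real (q x) * of_real (w x) = of_real (- (\<kappa>\<^sup>2)) * of_real (w x)))} \<subseteq> N"
          by blast
      qed
    qed
  qed
qed

section \<open>Germs of Laplace transforms at infinity\<close>

abbreviation "unit_space \<equiv> count_space (UNIV :: unit set)"

text \<open>The class without a parameter, encoded over a one-point space. The rate is existential
  because each reciprocal may force it upwards; values of \<open>F\<close> below the rate are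
  unconstrained, so only the behaviour near infinity matters.\<close>

definition laplace_germ :: "(real \<Rightarrow> real) \<Rightarrow> bool" where
  "laplace_germ F \<longleftrightarrow>
     (\<exists>c>0. \<exists>B\<ge>0. laplace_class unit_space c (\<lambda>_. B) (\<lambda>_. F))"

lemma laplace_germI:
  assumes "laplace_class M c (\<lambda>_. B) F" "c > 0" "B \<ge> 0" "x \<in> space M"
  shows "laplace_germ (F x)"
proof -
  have "laplace_class unit_space c (\<lambda>_. B) (\<lambda>_. F x)"
    by (rule laplace_class_comp[OF assms(1)]) (use assms(4) in simp)
  then show ?thesis using assms(2,3) unfolding laplace_germ_def by blast
qed

text \<open>One bound works at every higher rate, which is what lets two germs be brought to a
  common rate.\<close>

lemma laplace_germE:
  assumes "laplace_germ F"
  obtains c0 B where "c0 > 0" "B \<ge> 0"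
    "\<forall>c\<ge>c0. laplace_class unit_space c (\<lambda>_. B) (\<lambda>_. F)"
proof -
  obtain c0 B where "c0 > 0" "B \<ge> 0" "laplace_class unit_space c0 (\<lambda>_. B) (\<lambda>_. F)"
    using assms unfolding laplace_germ_def by blast
  then have "\<forall>c\<ge>c0. laplace_class unit_space c (\<lambda>_. B) (\<lambda>_. F)"
    using laplace_class_rate_mono by (intro allI impI) (rule laplace_class_rate_mono)
  with \<open>c0 > 0\<close> \<open>B \<ge> 0\<close> show thesis by (rule that)
qed

lemma laplace_germ_bounded:
  assumes "laplace_germ F"
  shows "\<exists>B. \<forall>\<^sub>F \<kappa> in at_top. \<bar>F \<kappa>\<bar> \<le> B"
proof -
  obtain c0 B where c0: "c0 > 0" "B \<ge> 0"
    "\<forall>c\<ge>c0. laplace_class unit_space c (\<lambda>_. B) (\<lambda>_. F)"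
    by (rule laplace_germE[OF assms(1)]) (rule that)
  have "\<bar>F \<kappa>\<bar> \<le> B" if "\<kappa> \<ge> c0" for \<kappa>
    using laplace_class_abs_le[OF c0(3)[rule_format, of c0], of "()" \<kappa>] c0 that by simp
  then show ?thesis unfolding eventually_at_top_linorder by blast
qed

lemma laplace_germ_add:
  assumes "laplace_germ F" "laplace_germ G"
  shows "laplace_germ (\<lambda>\<kappa>. F \<kappa> + G \<kappa>)"
proof -
  obtain c1 A where 1: "c1 > 0" "A \<ge> 0"
    "\<forall>c\<ge>c1. laplace_class unit_space c (\<lambda>_. A) (\<lambda>_. F)"
    by (rule laplace_germE[OF assms(1)]) (rule that)
  obtain c2 B where 2: "c2 > 0" "B \<ge> 0"
    "\<forall>c\<ge>c2. laplace_class unit_space c (\<lambda>_. B) (\<lambda>_. G)"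
    by (rule laplace_germE[OF assms(2)]) (rule that)
  show ?thesis
    by (rule laplace_germI[OF laplace_class_add[OF 1(3)[rule_format, of "max c1 c2"] 2(3)[rule_format, of "max c1 c2"]]])
      (use 1 2 in auto)
qed

lemma laplace_germ_mult:
  assumes "laplace_germ F" "laplace_germ G"
  shows "laplace_germ (\<lambda>\<kappa>. F \<kappa> * G \<kappa>)"
proof -
  obtain c1 A where 1: "c1 > 0" "A \<ge> 0"
    "\<forall>c\<ge>c1. laplace_class unit_space c (\<lambda>_. A) (\<lambda>_. F)"
    by (rule laplace_germE[OF assms(1)]) (rule that)
  obtain c2 B where 2: "c2 > 0" "B \<ge> 0"
    "\<forall>c\<ge>c2. laplace_class unit_space c (\<lambda>_. B) (\<lambda>_. G)"
    by (rule laplace_germE[OF assms(2)]) (rule that)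
  show ?thesis
    by (rule laplace_germI[OF laplace_class_mult[OF 1(3)[rule_format, of "max c1 c2"] 2(3)[rule_format, of "max c1 c2"]]])
      (use 1 2 in auto)
qed

lemma laplace_germ_cmult:
  assumes "laplace_germ F"
  shows "laplace_germ (\<lambda>\<kappa>. a * F \<kappa>)"
proof -
  obtain c1 A where 1: "c1 > 0" "A \<ge> 0"
    "\<forall>c\<ge>c1. laplace_class unit_space c (\<lambda>_. A) (\<lambda>_. F)"
    by (rule laplace_germE[OF assms(1)]) (rule that)
  show ?thesis
    by (rule laplace_germI[OF laplace_class_scale[OF 1(3)[rule_format, of c1], of "\<lambda>_. a"]])
      (use 1 in auto)
qed

text \<open>Nonzero constants are not germs, but a constant plus a germ acts on germs by
  multiplication: the germs form an ideal in the algebra with unit adjoined.\<close>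

lemma laplace_germ_affine_mult:
  assumes "laplace_germ F" "laplace_germ G"
  shows "laplace_germ (\<lambda>\<kappa>. (a + F \<kappa>) * G \<kappa>)"
  using laplace_germ_add[OF laplace_germ_cmult[OF assms(2), of a] laplace_germ_mult[OF assms]]
  by (simp add: distrib_right)

lemma laplace_germ_shift:
  assumes "laplace_germ F" "s \<ge> 0"
  shows "laplace_germ (\<lambda>\<kappa>. exp (- 2 * \<kappa> * s) * F \<kappa>)"
proof -
  obtain c1 A where 1: "c1 > 0" "A \<ge> 0"
    "\<forall>c\<ge>c1. laplace_class unit_space c (\<lambda>_. A) (\<lambda>_. F)"
    by (rule laplace_germE[OF assms(1)]) (rule that)
  show ?thesis
    by (rule laplace_germI[OF laplace_class_shift[OF 1(3)[rule_format, of c1], of "\<lambda>_. s"]])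
      (use 1 assms(2) in auto)
qed

lemma laplace_germ_kernel:
  assumes f[measurable]: "f \<in> borel_measurable borel" and neg: "\<And>\<alpha>. \<alpha> < 0 \<Longrightarrow> f \<alpha> = 0"
    and "c > 0" and B: "(\<integral>\<^sup>+\<alpha>. ennreal (\<bar>f \<alpha>\<bar> * exp (- 2 * c * \<alpha>)) \<partial>lborel) \<le> ennreal B" "B \<ge> 0"
  shows "laplace_germ (\<lambda>\<kappa>. LINT \<alpha>|lborel. f \<alpha> * exp (- 2 * \<kappa> * \<alpha>))"
proof -
  have "laplace_kernel unit_space c (\<lambda>_. B)
     (\<lambda>_ \<kappa>. LINT \<alpha>|lborel. f \<alpha> * exp (- 2 * \<kappa> * \<alpha>)) (\<lambda>_. f)"
    unfolding laplace_kernel_def using neg B(1) by auto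
  then show ?thesis using assms(3,5) unfolding laplace_germ_def laplace_class_def by blast
qed

lemma laplace_germ_integrable:
  assumes f: "integrable lborel f" and neg: "\<And>\<alpha>. \<alpha> < 0 \<Longrightarrow> f \<alpha> = 0"
  shows "laplace_germ (\<lambda>\<kappa>. LINT \<alpha>|lborel. f \<alpha> * exp (- 2 * \<kappa> * \<alpha>))"
proof (rule laplace_germ_kernel[where c = 1 and B = "LINT \<alpha>|lborel. \<bar>f \<alpha>\<bar>"])
  have "(\<integral>\<^sup>+\<alpha>. ennreal (\<bar>f \<alpha>\<bar> * exp (- 2 * 1 * \<alpha>)) \<partial>lborel) \<le> (\<integral>\<^sup>+\<alpha>. ennreal \<bar>f \<alpha>\<bar> \<partial>lborel)"
  proof (intro nn_integral_mono ennreal_leI)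
    fix \<alpha> :: real
    show "\<bar>f \<alpha>\<bar> * exp (- 2 * 1 * \<alpha>) \<le> \<bar>f \<alpha>\<bar>"
      using neg[of \<alpha>] by (cases "\<alpha> < 0") (auto intro: mult_left_le)
  qed
  also have "\<dots> = ennreal (LINT \<alpha>|lborel. \<bar>f \<alpha>\<bar>)" using f by (intro nn_integral_eq_integral) auto
  finally show "(\<integral>\<^sup>+\<alpha>. ennreal (\<bar>f \<alpha>\<bar> * exp (- 2 * 1 * \<alpha>)) \<partial>lborel) \<le> ennreal (LINT \<alpha>|lborel. \<bar>f \<alpha>\<bar>)" .
qed (use f neg in auto)

text \<open>The kernel is the constant 2 on the half-line. Its explicit norm \<open>1 / c\<close>
  tends to 0 as the rate grows, and this is the source of smallness for inverting in
  \<open>laplace_germ_inverse\<close>.\<close>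

lemma laplace_class_reciprocal:
  assumes "c > 0"
  shows "laplace_class M c (\<lambda>_. 1 / c) (\<lambda>_ \<kappa>. 1 / \<kappa>)"
proof -
  have nn: "(\<integral>\<^sup>+\<alpha>. ennreal (exp (- 2 * \<kappa> * \<alpha>)) * indicator {0..} \<alpha> \<partial>lborel) = ennreal (1 / (2 * \<kappa>))"
    if "\<kappa> > 0" for \<kappa> :: real
  proof -
    have "filterlim (\<lambda>\<alpha>. (- 2 * \<kappa>) * \<alpha>) at_bot at_top"
      using that by (intro filterlim_tendsto_neg_mult_at_bot[OF tendsto_const] filterlim_ident) auto
    then have "((\<lambda>\<alpha>. exp ((- 2 * \<kappa>) * \<alpha>)) \<longlongrightarrow> 0) at_top"
      by (rule filterlim_compose[OF exp_at_bot])
    from tendsto_mult[OF this tendsto_const[of "- 1 / (2 * \<kappa>)"]]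
    have lim: "((\<lambda>\<alpha>. - exp (- 2 * \<kappa> * \<alpha>) / (2 * \<kappa>)) \<longlongrightarrow> 0) at_top" by simp
    have "(\<integral>\<^sup>+\<alpha>. ennreal (exp (- 2 * \<kappa> * \<alpha>)) * indicator {0..} \<alpha> \<partial>lborel)
      = ennreal (0 - (- exp (- 2 * \<kappa> * 0) / (2 * \<kappa>)))"
      by (rule nn_integral_FTC_atLeast[OF _ _ _ lim]) (use that in \<open>auto intro!: derivative_eq_intros\<close>)
    then show ?thesis by simp
  qed
  have "laplace_kernel M c (\<lambda>_. 1 / c) (\<lambda>_ \<kappa>. 1 / \<kappa>) (\<lambda>_ \<alpha>. 2 * indicator {0..} \<alpha>)"
    unfolding laplace_kernel_def
  proof (intro conjI allI ballI impI)
    have "(\<integral>\<^sup>+\<alpha>. ennreal (\<bar>2 * indicator {0..} \<alpha>\<bar> * exp (- 2 * c * \<alpha>)) \<partial>lborel)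
      = (\<integral>\<^sup>+\<alpha>. ennreal 2 * (ennreal (exp (- 2 * c * \<alpha>)) * indicator {0..} \<alpha>) \<partial>lborel)"
      by (intro nn_integral_cong) (auto simp: indicator_def ennreal_mult)
    also have "\<dots> = ennreal 2 * ennreal (1 / (2 * c))"
      unfolding nn[OF assms, symmetric] by (rule nn_integral_cmult) measurable
    also have "\<dots> = ennreal (1 / c)" by (subst ennreal_mult[symmetric]) (use assms in auto)
    finally show "(\<integral>\<^sup>+\<alpha>. ennreal (\<bar>2 * indicator {0..} \<alpha>\<bar> * exp (- 2 * c * \<alpha>)) \<partial>lborel) \<le> ennreal (1 / c)"
      by simp
    fix \<kappa> assume "c \<le> \<kappa>"
    then have "\<kappa> > 0" using assms by simp
    have "has_bochner_integral lborel (\<lambda>\<alpha>. exp (- 2 * \<kappa> * \<alpha>) * indicator {0..} \<alpha>) (1 / (2 * \<kappa>))"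
    proof (rule has_bochner_integral_nn_integral)
      show "(\<integral>\<^sup>+\<alpha>. ennreal (exp (- 2 * \<kappa> * \<alpha>) * indicator {0..} \<alpha>) \<partial>lborel) = ennreal (1 / (2 * \<kappa>))"
        unfolding nn[OF \<open>\<kappa> > 0\<close>, symmetric] by (intro nn_integral_cong) (auto simp: indicator_def)
    qed (use \<open>\<kappa> > 0\<close> in auto)
    from has_bochner_integral_mult_right[OF this, of 2]
    show "1 / \<kappa> = (LINT \<alpha>|lborel. 2 * indicator {0..} \<alpha> * exp (- 2 * \<kappa> * \<alpha>))"
      by (simp add: has_bochner_integral_iff mult.assoc mult.commute)
  qed auto
  then show ?thesis unfolding laplace_class_def by blast
qed

lemma laplace_germ_reciprocal: "laplace_germ (\<lambda>\<kappa>. 1 / \<kappa>)"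
  by (rule laplace_germI[OF laplace_class_reciprocal[of 1 "unit_space"]]) auto

lemma laplace_germ_inverse:
  assumes "laplace_germ F"
  shows "laplace_germ (\<lambda>\<kappa>. 1 / (1 + (a + F \<kappa>) / \<kappa>) - 1)"
proof -
  obtain c1 A where 1: "c1 > 0" "A \<ge> 0" "\<forall>c\<ge>c1. laplace_class unit_space c (\<lambda>_. A) (\<lambda>_. F)"
    by (rule laplace_germE[OF assms]) (rule that)
  \<comment> \<open>At this rate the weighted norm of \<open>(a + F \<kappa>) / \<kappa>\<close> is
    at most \<open>(\<bar>a\<bar> + A) / c\<close>, hence at most 1/2, and the geometric series
    converges.\<close>
  define c where "c = max c1 (2 * (\<bar>a\<bar> + A))"
  have c: "c > 0" "c \<ge> c1" "2 * (\<bar>a\<bar> + A) \<le> c" using 1 unfolding c_def by auto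
  note rec = laplace_class_reciprocal[OF c(1), of unit_space]
  have "laplace_class unit_space c (\<lambda>_. \<bar>a\<bar> * (1 / c) + A * (1 / c)) (\<lambda>_ \<kappa>. a * (1 / \<kappa>) + F \<kappa> * (1 / \<kappa>))"
    by (intro laplace_class_add laplace_class_mult laplace_class_scale[where w = "\<lambda>_. a"] rec 1(3)[rule_format])
      (use c 1 in auto)
  then have "laplace_class unit_space c (\<lambda>_. 1 / 2) (\<lambda>_ \<kappa>. (a + F \<kappa>) / \<kappa>)"
  proof (rule laplace_class_cong)
    show "\<bar>a\<bar> * (1 / c) + A * (1 / c) \<le> 1 / 2"
      using c by (simp add: field_simps)
  qed (simp add: add_divide_distrib)
  from laplace_germI[OF laplace_class_inverse[OF this] c(1), of "()"] show ?thesis by simp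
qed

text \<open>The integral over y no longer depends on a parameter; a dummy real parameter is carried
  to fit \<open>laplace_class_weighted_integral\<close> and evaluated at 0.\<close>

lemma laplace_germ_weighted_integral:
  fixes S :: "real \<Rightarrow> real \<Rightarrow> real"
  assumes S: "laplace_class lborel c (\<lambda>_. B) S" and q: "integrable lborel q" and "c > 0" "B \<ge> 0"
  shows "laplace_germ (\<lambda>\<kappa>. LINT y|lborel. q y * S y \<kappa>)"
proof -
  have "laplace_class (lborel \<Otimes>\<^sub>M lborel) c (\<lambda>_. B) (\<lambda>z :: real \<times> real. S (snd z))"
    by (rule laplace_class_comp[OF S]) measurable
  from laplace_class_weighted_integral[OF this q \<open>B \<ge> 0\<close>]
  have "laplace_class lborel c (\<lambda>_. (LINT y|lborel. \<bar>q y\<bar>) * B) (\<lambda>(x::real) \<kappa>. LINT y|lborel. q y * S y \<kappa>)"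
    by simp
  from laplace_germI[OF this \<open>c > 0\<close>, of 0] show ?thesis
    using \<open>B \<ge> 0\<close> by (simp add: integral_nonneg_AE)
qed

text \<open>The tail of the kernel beyond \<open>a\<close> costs only \<open>exp (- 2 * a * \<kappa>)\<close>, which is why one kernel
  serves all truncations.\<close>

lemma laplace_germ_truncation:
  assumes "laplace_germ F"
  obtains A where "A \<in> borel_measurable borel"
    "\<forall>a. A absolutely_integrable_on {0<..<a}"
    "\<forall>a. \<exists>C. \<forall>\<^sub>F \<kappa> in at_top.
       \<bar>F \<kappa> - (LINT \<alpha>:{0<..<a}|lebesgue. A \<alpha> * exp (- 2 * \<alpha> * \<kappa>))\<bar> \<le> C * exp (- 2 * a * \<kappa>)"
proof -
  obtain c B where c: "c > 0" "B \<ge> 0" "laplace_class unit_space c (\<lambda>_. B) (\<lambda>_. F)"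
    using assms unfolding laplace_germ_def by blast
  obtain f where f: "laplace_kernel unit_space c (\<lambda>_. B) (\<lambda>_. F) f" using c(3) unfolding laplace_class_def by blast
  define A where "A = f ()"
  have Am[measurable]: "A \<in> borel_measurable borel"
    unfolding A_def using laplace_kernel_section[OF f] by simp
  have Ai: "integrable lborel (\<lambda>\<alpha>. A \<alpha> * exp (- 2 * \<kappa> * \<alpha>))" if "c \<le> \<kappa>" for \<kappa>
    unfolding A_def by (rule laplace_kernel_integrable[OF f]) (use that in auto)
  have AF: "F \<kappa> = (LINT \<alpha>|lborel. A \<alpha> * exp (- 2 * \<kappa> * \<alpha>))" if "c \<le> \<kappa>" for \<kappa>
    unfolding A_def by (rule laplace_kernel_transform[OF f]) (use that in auto)
  have A0: "A \<alpha> = 0" if "\<alpha> < 0" for \<alpha> unfolding A_def by (rule laplace_kernel_neg[OF f that])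
  define J where "J = (LINT \<alpha>|lborel. \<bar>A \<alpha> * exp (- 2 * c * \<alpha>)\<bar>)"
  show thesis
  proof (rule that[OF Am]; intro allI)
    fix a :: real
    show "A absolutely_integrable_on {0<..<a}"
    proof -
      \<comment> \<open>On a bounded interval the exponential weight is bounded below, so weighted
        integrability gives plain integrability. The absolute value of \<open>a\<close> covers all
        real \<open>a\<close>; for a \<le> 0 the interval is empty.\<close>
      have "integrable lborel (\<lambda>x. indicator {0<..<a} x *\<^sub>R A x)"
      proof (rule Bochner_Integration.integrable_bound[OF integrable_mult_right[OF Ai[OF order_refl], of "exp (2 * c * \<bar>a\<bar>)"]])
        show "AE x in lborel. norm (indicator {0<..<a} x *\<^sub>R A x) \<le> norm (exp (2 * c * \<bar>a\<bar>) * (A x * exp (- 2 * c * x)))"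
        proof (rule AE_I2)
          fix x
          have "\<bar>A x\<bar> * 1 \<le> \<bar>A x\<bar> * (exp (2 * c * \<bar>a\<bar>) * exp (- 2 * c * x))" if "0 < x" "x < a"
            using that c(1) by (intro mult_left_mono) (auto simp flip: exp_add)
          then show "norm (indicator {0<..<a} x *\<^sub>R A x) \<le> norm (exp (2 * c * \<bar>a\<bar>) * (A x * exp (- 2 * c * x)))"
            by (auto simp: indicator_def abs_mult ac_simps)
        qed
      qed measurable
      then show ?thesis
        unfolding set_integrable_def by (rule integrable_completion[THEN iffD2, rotated]) measurable
    qed
    have "\<forall>\<^sub>F \<kappa> in at_top.
       \<bar>F \<kappa> - (LINT \<alpha>:{0<..<a}|lebesgue. A \<alpha> * exp (- 2 * \<alpha> * \<kappa>))\<bar> \<le> (exp (2 * c * a) * J) * exp (- 2 * a * \<kappa>)"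
      using eventually_ge_at_top[of c]
    proof eventually_elim
      case (elim \<kappa>)
      define g where "g \<alpha> = A \<alpha> * exp (- 2 * \<kappa> * \<alpha>)" for \<alpha>
      have gi: "integrable lborel g" unfolding g_def by (rule Ai[OF elim])
      have gm[measurable]: "g \<in> borel_measurable borel" unfolding g_def by measurable
      have gI: "integrable lborel (\<lambda>\<alpha>. indicator {0<..<a} \<alpha> * g \<alpha>)"
        using integrable_mult_indicator[OF _ gi, of "{0<..<a}"] by simp
      have "(LINT \<alpha>:{0<..<a}|lebesgue. A \<alpha> * exp (- 2 * \<alpha> * \<kappa>)) = (LINT \<alpha>|lborel. indicator {0<..<a} \<alpha> * g \<alpha>)"
        unfolding set_lebesgue_integral_def g_def
        by (subst integral_completion) (auto simp: ac_simps)
      then have "F \<kappa> - (LINT \<alpha>:{0<..<a}|lebesgue. A \<alpha> * exp (- 2 * \<alpha> * \<kappa>))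
        = (LINT \<alpha>|lborel. g \<alpha> - indicator {0<..<a} \<alpha> * g \<alpha>)"
        unfolding AF[OF elim] g_def[symmetric] using gi gI by simp
      also have "\<bar>\<dots>\<bar> \<le> (LINT \<alpha>|lborel. exp (2 * c * a) * exp (- 2 * a * \<kappa>) * \<bar>A \<alpha> * exp (- 2 * c * \<alpha>)\<bar>)"
      proof -
        have "norm (LINT \<alpha>|lborel. g \<alpha> - indicator {0<..<a} \<alpha> * g \<alpha>)
          \<le> (LINT \<alpha>|lborel. exp (2 * c * a) * exp (- 2 * a * \<kappa>) * \<bar>A \<alpha> * exp (- 2 * c * \<alpha>)\<bar>)"
        proof (rule order.trans[OF integral_norm_bound integral_mono_AE])
          show "integrable lborel (\<lambda>\<alpha>. norm (g \<alpha> - indicator {0<..<a} \<alpha> * g \<alpha>))" using gi gI by simp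
          show "integrable lborel (\<lambda>\<alpha>. exp (2 * c * a) * exp (- 2 * a * \<kappa>) * \<bar>A \<alpha> * exp (- 2 * c * \<alpha>)\<bar>)"
            using Ai[OF order_refl] by (intro integrable_mult_right integrable_abs)
          \<comment> \<open>The point \<alpha> = 0 is left out: the kernel may be nonzero there,
            while the interval of integration is open.\<close>
          show "AE \<alpha> in lborel. norm (g \<alpha> - indicator {0<..<a} \<alpha> * g \<alpha>)
            \<le> exp (2 * c * a) * exp (- 2 * a * \<kappa>) * \<bar>A \<alpha> * exp (- 2 * c * \<alpha>)\<bar>"
            using AE_lborel_singleton[of 0]
          proof eventually_elim
            case (elim \<alpha>)
            show ?case
            proof (cases "\<alpha> \<ge> a \<and> \<alpha> > 0")
              case True
              \<comment> \<open>Only the surplus \<kappa> - c of the rate is spent on the factor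
                \<open>exp (- 2 * a * \<kappa>)\<close>; the rate \<open>c\<close> is kept to make
                the remaining integral \<open>J\<close> finite.\<close>
              then have "(\<kappa> - c) * a \<le> (\<kappa> - c) * \<alpha>" using \<open>c \<le> \<kappa>\<close> by (intro mult_left_mono) auto
              then have "exp (- 2 * \<kappa> * \<alpha>) \<le> exp (2 * c * a + - 2 * a * \<kappa> + - 2 * c * \<alpha>)"
                by (simp add: algebra_simps)
              then have "\<bar>A \<alpha>\<bar> * exp (- 2 * \<kappa> * \<alpha>) \<le> \<bar>A \<alpha>\<bar> * exp (2 * c * a + - 2 * a * \<kappa> + - 2 * c * \<alpha>)"
                by (intro mult_left_mono) auto
              then have "\<bar>A \<alpha>\<bar> * exp (- 2 * \<kappa> * \<alpha>)
                \<le> \<bar>A \<alpha>\<bar> * (exp (2 * c * a) * exp (- 2 * a * \<kappa>) * exp (- 2 * c * \<alpha>))"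
                by (simp only: exp_add)
              then show ?thesis using True by (simp add: g_def abs_mult ac_simps)
            next
              case False
              then have z: "g \<alpha> - indicator {0<..<a} \<alpha> * g \<alpha> = 0"
                using A0[of \<alpha>] elim by (cases "\<alpha> < 0") (auto simp: g_def indicator_def)
              show ?thesis unfolding z by simp
            qed
          qed
        qed
        then show ?thesis by simp
      qed
      also have "\<dots> = (exp (2 * c * a) * J) * exp (- 2 * a * \<kappa>)" unfolding J_def by simp
      finally show ?case .
    qed
    then show "\<exists>C. \<forall>\<^sub>F \<kappa> in at_top.
       \<bar>F \<kappa> - (LINT \<alpha>:{0<..<a}|lebesgue. A \<alpha> * exp (- 2 * \<alpha> * \<kappa>))\<bar> \<le> C * exp (- 2 * a * \<kappa>)"
      by blast
  qed
qed

section \<open>The expansion of the m-function\<close>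

lemma laplace_germ_over_id_tendsto:
  assumes "laplace_germ F"
  shows "((\<lambda>\<kappa>. (a + F \<kappa>) / \<kappa>) \<longlongrightarrow> 0) at_top"
proof -
  obtain B where B: "\<forall>\<^sub>F \<kappa> in at_top. \<bar>F \<kappa>\<bar> \<le> B" using laplace_germ_bounded[OF assms] by blast
  have lim: "((\<lambda>\<kappa>. (\<bar>a\<bar> + B) * (1 / \<kappa>)) \<longlongrightarrow> (\<bar>a\<bar> + B) * 0) at_top" for a :: real
    by (intro tendsto_intros tendsto_divide_0[OF tendsto_const] filterlim_at_top_imp_at_infinity filterlim_ident)
  have "\<forall>\<^sub>F \<kappa> in at_top. norm ((a + F \<kappa>) / \<kappa>) \<le> (\<bar>a\<bar> + B) * (1 / \<kappa>)"
    using B eventually_gt_at_top[of 0]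
  proof eventually_elim
    case (elim \<kappa>)
    have "\<bar>a + F \<kappa>\<bar> \<le> \<bar>a\<bar> + B" using elim by linarith
    then show ?case using elim by (simp add: divide_right_mono)
  qed
  then show ?thesis by (rule Lim_null_comparison) (use lim in simp)
qed

text \<open>Here \<open>P\<close> and \<open>s\<close> stand for the values at \<open>0\<close> of the two Volterra solutions and \<open>\<rho>\<close> for the
  reflection coefficient of the boundary condition at \<open>b\<close>. Dropping the \<open>E\<close>-part of \<open>s\<close>
  from the denominator is what produces the error \<open>\<kappa> * E\<^sup>2\<close>.\<close>

lemma reflection_expansion:
  fixes Q b \<rho>0 \<eta> :: real
  assumes "b > 0" and g: "laplace_germ g1" "laplace_germ g2" "laplace_germ L2" "laplace_germ n"
    and P: "\<And>\<kappa>. P \<kappa> = 1 + (Q + g1 \<kappa>) / (2 * \<kappa>)"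
    and s: "\<And>\<kappa>. s \<kappa> = exp (- 2 * \<kappa> * b) * (1 - Q / (2 * \<kappa>)) + g2 \<kappa> / (2 * \<kappa>)"
    and \<rho>: "\<And>\<kappa>. \<rho> \<kappa> = \<rho>0 * (1 + (L2 \<kappa> - \<eta>) / \<kappa>)" and "\<bar>\<rho>0\<bar> = 1"
  shows "\<exists>F. laplace_germ F \<and> (\<exists>C. \<forall>\<^sub>F \<kappa> in at_top. P \<kappa> \<noteq> 0 \<and> P \<kappa> + \<rho> \<kappa> * s \<kappa> \<noteq> 0 \<and>
     \<bar>2 * \<kappa> * \<rho> \<kappa> * exp (- 2 * \<kappa> * b) / (P \<kappa> * (P \<kappa> + \<rho> \<kappa> * s \<kappa>)) - n \<kappa> / P \<kappa>
      - (2 * \<rho>0 * (\<kappa> - \<eta> - Q) * exp (- 2 * \<kappa> * b) - F \<kappa>)\<bar> \<le> C * (\<kappa> * exp (- 2 * \<kappa> * b) ^ 2))"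
proof -
  note inv = laplace_germ_reciprocal
  define gP where "gP \<kappa> = (Q + g1 \<kappa>) * (1 / 2 * (1 / \<kappa>))" for \<kappa>
  have gP: "laplace_germ gP" unfolding gP_def by (intro laplace_germ_affine_mult laplace_germ_cmult g inv)
  define g\<rho> where "g\<rho> \<kappa> = (- \<eta> + L2 \<kappa>) * (\<rho>0 * (1 / \<kappa>))" for \<kappa>
  have g\<rho>: "laplace_germ g\<rho>" unfolding g\<rho>_def by (intro laplace_germ_affine_mult laplace_germ_cmult g inv)
  have P_eq: "P \<kappa> = 1 + gP \<kappa>" for \<kappa> unfolding P gP_def by simp
  have \<rho>_eq: "\<rho> \<kappa> = \<rho>0 + g\<rho> \<kappa>" for \<kappa> unfolding \<rho> g\<rho>_def by (simp add: algebra_simps diff_divide_distrib add_divide_distrib)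
  \<comment> \<open>\<open>Q + G \<kappa>\<close> is \<open>\<kappa> * (D0 \<kappa> - 1)\<close>,
    where \<open>D0\<close> is the denominator \<open>P * (P + \<rho> * s)\<close> without the
    exponential part of \<open>s\<close>. The constant \<open>Q\<close> is split off because it is
    not a germ in general, and it is the contribution to the coefficient of the plain
    exponential.\<close>
  define G where "G \<kappa> = g1 \<kappa> + ((Q + g1 \<kappa>) * (1 / 2 * gP \<kappa>) + 1 / 2 * ((\<rho>0 + g\<rho> \<kappa>) * ((1 + gP \<kappa>) * g2 \<kappa>)))" for \<kappa>
  have G: "laplace_germ G"
    unfolding G_def by (intro laplace_germ_add laplace_germ_affine_mult laplace_germ_cmult g gP g\<rho>)
  define D0 where "D0 \<kappa> = 1 + (Q + G \<kappa>) / \<kappa>" for \<kappa>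
  have D0_eq: "D0 \<kappa> = P \<kappa> * (P \<kappa> + \<rho> \<kappa> * (g2 \<kappa> / (2 * \<kappa>)))" if "\<kappa> > 0" for \<kappa>
  proof -
    have A: "(Q + g1 \<kappa>) / \<kappa> = 2 * gP \<kappa>" unfolding gP_def using that by (simp add: field_simps)
    have B: "1 + (Q + (g + ((Q + g) * (1 / 2 * y) + 1 / 2 * (r * (t * z))))) / \<kappa>
       = 1 + (Q + g) / \<kappa> + (Q + g) / \<kappa> * (1 / 2 * y) + r * (t * (z / (2 * \<kappa>)))" for g y r t z
      using that by (simp add: field_simps)
    have "D0 \<kappa> = 1 + 2 * gP \<kappa> + gP \<kappa> * gP \<kappa> + (\<rho>0 + g\<rho> \<kappa>) * ((1 + gP \<kappa>) * (g2 \<kappa> / (2 * \<kappa>)))"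
      unfolding D0_def G_def B A by simp
    then show ?thesis unfolding P_eq \<rho>_eq by (simp add: algebra_simps)
  qed
  define H where "H \<kappa> = 1 / (1 + (Q + G \<kappa>) / \<kappa>) - 1" for \<kappa>
  have H: "laplace_germ H" unfolding H_def by (rule laplace_germ_inverse[OF G])
  \<comment> \<open>Chosen so that \<open>1 / D0 \<kappa> = 1 - (Q + L1 \<kappa>) / \<kappa>\<close>
    exactly: the first-order coefficient of the reciprocal is a constant plus a germ.\<close>
  define L1 where "L1 \<kappa> = (1 + H \<kappa>) * G \<kappa> + Q * H \<kappa>" for \<kappa>
  have L1: "laplace_germ L1"
    unfolding L1_def by (intro laplace_germ_add laplace_germ_affine_mult laplace_germ_cmult G H)
  \<comment> \<open>What remains of \<open>(\<kappa> - \<eta> + L2 \<kappa>) * (1 - (Q + L1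
    \<kappa>) / \<kappa>)\<close> after subtracting the singular part
    \<open>\<kappa> - \<eta> - Q\<close>.\<close>
  define L3 where "L3 \<kappa> = L2 \<kappa> + (- 1 * L1 \<kappa> + - 1 * ((- \<eta> + L2 \<kappa>) * ((Q + L1 \<kappa>) * (1 / \<kappa>))))" for \<kappa>
  have L3: "laplace_germ L3"
    unfolding L3_def by (intro laplace_germ_add laplace_germ_affine_mult laplace_germ_cmult g L1 inv)
  define H' where "H' \<kappa> = 1 / (1 + (Q / 2 + 1 / 2 * g1 \<kappa>) / \<kappa>) - 1" for \<kappa>
  have H': "laplace_germ H'" unfolding H'_def by (intro laplace_germ_inverse laplace_germ_cmult g)
  \<comment> \<open>The first summand is \<open>n / P\<close>, as \<open>1 + H'\<close> is the
    reciprocal of \<open>P\<close>. The second is the regular part of the reflected term, a kernel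
    translated by \<open>b\<close>.\<close>
  define F where "F \<kappa> = (1 + H' \<kappa>) * n \<kappa> + exp (- 2 * \<kappa> * b) * ((- 2 * \<rho>0) * L3 \<kappa>)" for \<kappa>
  have F: "laplace_germ F"
    unfolding F_def using \<open>b > 0\<close>
    by (intro laplace_germ_add laplace_germ_affine_mult laplace_germ_cmult laplace_germ_shift H' L3 g) auto
  have lim_E: "((\<lambda>\<kappa>. exp (- 2 * \<kappa> * b)) \<longlongrightarrow> 0) at_top"
  proof -
    have "filterlim (\<lambda>\<kappa>. (- 2 * b) * \<kappa>) at_bot at_top"
      using \<open>b > 0\<close> by (intro filterlim_tendsto_neg_mult_at_bot[OF tendsto_const] filterlim_ident) auto
    then have "((\<lambda>\<kappa>. exp ((- 2 * b) * \<kappa>)) \<longlongrightarrow> 0) at_top"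
      by (rule filterlim_compose[OF exp_at_bot])
    then show ?thesis by (simp add: ac_simps)
  qed
  have lim_inv: "((\<lambda>\<kappa>. c / \<kappa>) \<longlongrightarrow> 0) at_top" for c :: real
    by (intro tendsto_divide_0[OF tendsto_const] filterlim_at_top_imp_at_infinity filterlim_ident)
  have lim_P: "(P \<longlongrightarrow> 1) at_top"
  proof -
    have "((\<lambda>\<kappa>. 1 + 1 / 2 * ((Q + g1 \<kappa>) / \<kappa>)) \<longlongrightarrow> 1 + 1 / 2 * 0) at_top"
      by (intro tendsto_intros laplace_germ_over_id_tendsto g)
    then show ?thesis unfolding P by simp
  qed
  have lim_t: "((\<lambda>\<kappa>. 1 - Q / (2 * \<kappa>)) \<longlongrightarrow> 1) at_top"
  proof -
    have "((\<lambda>\<kappa>. 1 - (Q / 2) / \<kappa>) \<longlongrightarrow> 1 - 0) at_top" by (intro tendsto_intros lim_inv)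
    then show ?thesis by simp
  qed
  have lim_s: "(s \<longlongrightarrow> 0) at_top"
  proof -
    have "((\<lambda>\<kappa>. exp (- 2 * \<kappa> * b) * (1 - Q / (2 * \<kappa>)) + 1 / 2 * ((0 + g2 \<kappa>) / \<kappa>)) \<longlongrightarrow> 0 * 1 + 1 / 2 * 0) at_top"
      by (intro tendsto_add tendsto_mult lim_E lim_t tendsto_const laplace_germ_over_id_tendsto g)
    then show ?thesis unfolding s by simp
  qed
  have lim_\<rho>: "(\<rho> \<longlongrightarrow> \<rho>0) at_top"
  proof -
    have "((\<lambda>\<kappa>. \<rho>0 * (1 + ((- \<eta> + L2 \<kappa>) / \<kappa>))) \<longlongrightarrow> \<rho>0 * (1 + 0)) at_top"
      by (intro tendsto_intros laplace_germ_over_id_tendsto g)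
    then show ?thesis unfolding \<rho> by simp
  qed
  have lim_D: "((\<lambda>\<kappa>. P \<kappa> * (P \<kappa> + \<rho> \<kappa> * s \<kappa>)) \<longlongrightarrow> 1 * (1 + \<rho>0 * 0)) at_top"
    by (intro tendsto_intros lim_P lim_s lim_\<rho>)
  have lim_D0: "(D0 \<longlongrightarrow> 1) at_top"
    unfolding D0_def[abs_def] using tendsto_add[OF tendsto_const laplace_germ_over_id_tendsto[OF G], of 1] by simp
  \<comment> \<open>The coefficient of \<open>\<kappa> * E\<^sup>2\<close>, with
    \<open>E = exp (- 2 * \<kappa> * b)\<close>, in the error of replacing the full denominator by
    \<open>D0\<close>. It tends to -2 since \<open>\<rho>0\<^sup>2 = 1\<close>, which is where the
    constant 3 of the final bound comes from.\<close>
  define X where "X \<kappa> = - 2 * (\<rho> \<kappa>)\<^sup>2 * (1 - Q / (2 * \<kappa>)) * P \<kappa> / ((P \<kappa> * (P \<kappa> + \<rho> \<kappa> * s \<kappa>)) * D0 \<kappa>)" for \<kappa>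
  have "(X \<longlongrightarrow> - 2 * \<rho>0\<^sup>2 * 1 * 1 / ((1 * (1 + \<rho>0 * 0)) * 1)) at_top"
    unfolding X_def[abs_def] by (intro tendsto_divide tendsto_mult tendsto_power tendsto_const lim_\<rho> lim_t lim_P lim_D lim_D0) auto
  then have "((\<lambda>\<kappa>. \<bar>X \<kappa>\<bar>) \<longlongrightarrow> \<bar>- 2 * \<rho>0\<^sup>2 * 1 * 1 / ((1 * (1 + \<rho>0 * 0)) * 1)\<bar>) at_top"
    by (rule tendsto_rabs)
  moreover have "\<rho>0\<^sup>2 = 1" using \<open>\<bar>\<rho>0\<bar> = 1\<close> by (metis abs_one one_power2 power2_abs)
  ultimately have "((\<lambda>\<kappa>. \<bar>X \<kappa>\<bar>) \<longlongrightarrow> 2) at_top" by simp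
  then have ev_X: "\<forall>\<^sub>F \<kappa> in at_top. \<bar>X \<kappa>\<bar> < 3" by (rule order_tendstoD(2)) simp
  have ev_D: "\<forall>\<^sub>F \<kappa> in at_top. P \<kappa> * (P \<kappa> + \<rho> \<kappa> * s \<kappa>) > 1 / 2"
    by (rule order_tendstoD(1)[OF lim_D]) simp
  have ev_D0: "\<forall>\<^sub>F \<kappa> in at_top. D0 \<kappa> > 1 / 2" by (rule order_tendstoD(1)[OF lim_D0]) simp
  have "\<forall>\<^sub>F \<kappa> in at_top. P \<kappa> \<noteq> 0 \<and> P \<kappa> + \<rho> \<kappa> * s \<kappa> \<noteq> 0 \<and>
     \<bar>2 * \<kappa> * \<rho> \<kappa> * exp (- 2 * \<kappa> * b) / (P \<kappa> * (P \<kappa> + \<rho> \<kappa> * s \<kappa>)) - n \<kappa> / P \<kappa>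
      - (2 * \<rho>0 * (\<kappa> - \<eta> - Q) * exp (- 2 * \<kappa> * b) - F \<kappa>)\<bar> \<le> 3 * (\<kappa> * exp (- 2 * \<kappa> * b) ^ 2)"
    using ev_X ev_D ev_D0 eventually_gt_at_top[of 0]
  proof eventually_elim
    case (elim \<kappa>)
    define E where "E = exp (- 2 * \<kappa> * b)"
    define D where "D = P \<kappa> * (P \<kappa> + \<rho> \<kappa> * s \<kappa>)"
    have D: "D \<noteq> 0" "D0 \<kappa> \<noteq> 0" "\<kappa> > 0" using elim unfolding D_def by auto
    then have Pne: "P \<kappa> \<noteq> 0" "P \<kappa> + \<rho> \<kappa> * s \<kappa> \<noteq> 0" unfolding D_def by auto
    \<comment> \<open>The two denominators differ by a multiple of \<open>E\<close>, and the
      numerator carries a factor \<open>E\<close> already.\<close>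
    have DD: "D = D0 \<kappa> + E * (\<rho> \<kappa> * (1 - Q / (2 * \<kappa>)) * P \<kappa>)"
      unfolding D_def D0_eq[OF D(3)] s E_def by (simp add: algebra_simps)
    have "2 * \<kappa> * \<rho> \<kappa> * E / D - 2 * \<kappa> * \<rho> \<kappa> * E / D0 \<kappa> = 2 * \<kappa> * \<rho> \<kappa> * E * (D0 \<kappa> - D) / (D * D0 \<kappa>)"
      using D by (simp add: field_simps)
    also have "\<dots> = \<kappa> * E\<^sup>2 * X \<kappa>"
      unfolding X_def D_def[symmetric] using DD by (simp add: power2_eq_square)
    finally have 1: "2 * \<kappa> * \<rho> \<kappa> * E / D = 2 * \<kappa> * \<rho> \<kappa> * E / D0 \<kappa> + \<kappa> * E\<^sup>2 * X \<kappa>" by simp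
    have invD0: "1 / D0 \<kappa> = 1 - (Q + L1 \<kappa>) / \<kappa>"
    proof -
      have "(1 + H \<kappa>) * D0 \<kappa> = 1" using D(2) unfolding H_def D0_def by simp
      then have "1 + H \<kappa> = 1 - (1 + H \<kappa>) * ((Q + G \<kappa>) / \<kappa>)"
        unfolding D0_def by (simp add: algebra_simps)
      also have "(1 + H \<kappa>) * ((Q + G \<kappa>) / \<kappa>) = (Q + L1 \<kappa>) / \<kappa>"
        unfolding L1_def by (simp add: algebra_simps)
      finally show ?thesis unfolding H_def D0_def by simp
    qed
    have "2 * \<kappa> * \<rho> \<kappa> * E / D0 \<kappa> = 2 * \<rho>0 * E * ((\<kappa> + (L2 \<kappa> - \<eta>)) * (1 / D0 \<kappa>))"
    proof -
      have *: "\<kappa> + (L2 \<kappa> - \<eta>) = \<kappa> * (1 + (L2 \<kappa> - \<eta>) / \<kappa>)" using D(3) by (simp add: field_simps)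
      have "2 * \<kappa> * (\<rho>0 * t) * E / d = 2 * \<rho>0 * E * ((\<kappa> * t) * (1 / d))" for t d by simp
      then show ?thesis unfolding \<rho> * .
    qed
    also have "(\<kappa> + (L2 \<kappa> - \<eta>)) * (1 / D0 \<kappa>) = \<kappa> - \<eta> - Q + L3 \<kappa>"
      unfolding invD0 L3_def using D(3) by (simp add: field_simps)
    finally have 2: "2 * \<kappa> * \<rho> \<kappa> * E / D0 \<kappa> = 2 * \<rho>0 * E * (\<kappa> - \<eta> - Q + L3 \<kappa>)" .
    have "n \<kappa> / P \<kappa> = (1 + H' \<kappa>) * n \<kappa>"
    proof -
      have "1 + (Q / 2 + 1 / 2 * g1 \<kappa>) / \<kappa> = P \<kappa>" unfolding P by (simp add: add_divide_distrib)
      then show ?thesis unfolding H'_def by simp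
    qed
    then have 3: "n \<kappa> / P \<kappa> = F \<kappa> + E * (2 * \<rho>0 * L3 \<kappa>)" unfolding F_def E_def by simp
    have "2 * \<kappa> * \<rho> \<kappa> * E / D - n \<kappa> / P \<kappa> - (2 * \<rho>0 * (\<kappa> - \<eta> - Q) * E - F \<kappa>) = \<kappa> * E\<^sup>2 * X \<kappa>"
      unfolding 1 2 3 by (simp add: algebra_simps)
    also have "\<bar>\<dots>\<bar> \<le> \<kappa> * E\<^sup>2 * 3"
      unfolding abs_mult using elim(1) D(3) by (intro mult_mono) auto
    finally show ?case using Pne unfolding D_def E_def by (simp add: mult.commute)
  qed
  then show ?thesis using F by blast
qed

section \<open>The boundary condition and the assembly of the expansion\<close>

lemma schroedinger_solution_add_mult:
  assumes u: "schroedinger_solution q b z u u'" and v: "schroedinger_solution q b z v v'"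
  shows "schroedinger_solution q b z (\<lambda>x. u x + c * v x) (\<lambda>x. u' x + c * v' x)"
  unfolding schroedinger_solution_def
proof (intro conjI ballI)
  show "((\<lambda>x. u x + c * v x) has_vector_derivative u' x + c * v' x) (at x within {0..b})" if "x \<in> {0..b}" for x
    using u v that unfolding schroedinger_solution_def
    by (intro has_vector_derivative_add has_vector_derivative_mult_right) auto
  show "absolutely_continuous_on {0..b} (\<lambda>x. u' x + c * v' x)"
    using u v unfolding schroedinger_solution_def
    by (intro absolutely_continuous_on_add absolutely_continuous_on_mult absolutely_continuous_on_const) auto
  have "AE x in lebesgue. x \<in> {0<..<b} \<longrightarrow>
        (\<exists>u''. (u' has_vector_derivative u'') (at x) \<and> - u'' + complex_of_real (q x) * u x = z * u x)"
    "AE x in lebesgue. x \<in> {0<..<b} \<longrightarrow>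
        (\<exists>v''. (v' has_vector_derivative v'') (at x) \<and> - v'' + complex_of_real (q x) * v x = z * v x)"
    using u v unfolding schroedinger_solution_def by auto
  then show "AE x in lebesgue. x \<in> {0<..<b} \<longrightarrow>
        (\<exists>w''. ((\<lambda>x. u' x + c * v' x) has_vector_derivative w'') (at x) \<and>
           - w'' + complex_of_real (q x) * (u x + c * v x) = z * (u x + c * v x))"
  proof eventually_elim
    case (elim x)
    show ?case
    proof
      assume "x \<in> {0<..<b}"
      then obtain u'' v'' where d: "(u' has_vector_derivative u'') (at x)" "(v' has_vector_derivative v'') (at x)"
        and e: "- u'' + complex_of_real (q x) * u x = z * u x" "- v'' + complex_of_real (q x) * v x = z * v x"
        using elim by auto
      show "\<exists>w''. ((\<lambda>x. u' x + c * v' x) has_vector_derivative w'') (at x) \<and>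
           - w'' + complex_of_real (q x) * (u x + c * v x) = z * (u x + c * v x)"
      proof (intro exI conjI)
        show "((\<lambda>x. u' x + c * v' x) has_vector_derivative u'' + c * v'') (at x)"
          by (intro has_vector_derivative_add has_vector_derivative_mult_right d)
        have "- (u'' + c * v'') + complex_of_real (q x) * (u x + c * v x)
          = (- u'' + complex_of_real (q x) * u x) + c * (- v'' + complex_of_real (q x) * v x)"
          by (simp add: algebra_simps)
        also have "\<dots> = z * (u x + c * v x)" unfolding e by (simp add: algebra_simps)
        finally show "- (u'' + c * v'') + complex_of_real (q x) * (u x + c * v x) = z * (u x + c * v x)" .
      qed
    qed
  qed
qed

text \<open>For solutions with Cauchy data (1, -\<kappa>) and (1, \<kappa>) at \<open>b\<close> the
  boundary condition is a linear equation for \<open>\<rho>\<close>. Expanding its solution in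
  powers of \<open>1 / \<kappa>\<close> gives a leading sign \<open>\<rho>0\<close> and a next
  coefficient \<eta>, and both pairs \<open>coeff_A1\<close>, \<open>coeff_B1\<close> become the
  same expression in \<open>\<rho>0\<close>, \<eta> and the integral of the potential. For infinite
  parameter \<open>\<rho>0 = - 1\<close> and \<eta> = 0, for finite parameter
  \<open>\<rho>0 = 1\<close> and \<open>\<eta> = 2 * h\<close>.\<close>

lemma reflection_coefficient:
  fixes h :: bc_param
  obtains \<rho> L2 :: "real \<Rightarrow> real" and \<rho>0 \<eta> :: real where
    "laplace_germ L2" "\<bar>\<rho>0\<bar> = 1" "\<forall>\<kappa>. \<rho> \<kappa> = \<rho>0 * (1 + (L2 \<kappa> - \<eta>) / \<kappa>)"
    "coeff_A1 h = - 2 * \<rho>0" "\<forall>q b. coeff_B1 q b h = 2 * \<rho>0 * (\<eta> + (LINT y:{0<..<b}|lebesgue. q y))"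
    "\<forall>\<^sub>F \<kappa> in at_top. \<forall>b u u' v v'. u b = 1 \<longrightarrow> u' b = - complex_of_real \<kappa> \<longrightarrow> v b = 1 \<longrightarrow> v' b = complex_of_real \<kappa> \<longrightarrow>
       boundary_condition b h (\<lambda>x. u x + of_real (\<rho> \<kappa>) * v x) (\<lambda>x. u' x + of_real (\<rho> \<kappa>) * v' x)"
proof (cases h)
  case Infinite_h
  have "laplace_germ (\<lambda>_. 0)"
    using laplace_germ_cmult[OF laplace_germ_reciprocal, of 0] by simp
  then show thesis
    by (rule that[of "\<lambda>_. 0" "- 1" "\<lambda>_. - 1" 0]) (auto simp: Infinite_h)
next
  case (Finite_h h')
  \<comment> \<open>The zero multiple of \<open>1 / \<kappa>\<close> is the zero germ, written so as
    to match the form inverted by \<open>laplace_germ_inverse\<close>.\<close>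
  define H where "H \<kappa> = 1 / (1 + (h' + 0 * (1 / \<kappa>)) / \<kappa>) - 1" for \<kappa>
  have H: "laplace_germ H"
    unfolding H_def by (intro laplace_germ_inverse laplace_germ_cmult laplace_germ_reciprocal)
  \<comment> \<open>For large \<kappa> this is \<open>2 * h'\<^sup>2 / (\<kappa> + h')\<close>, the
    remainder in \<open>(\<kappa> - h') / (\<kappa> + h') = 1 + (L2 - 2 * h') /
    \<kappa>\<close>.\<close>
  define L2 where "L2 \<kappa> = (1 + H \<kappa>) * (2 * h'\<^sup>2 * (1 / \<kappa>))" for \<kappa>
  have L2: "laplace_germ L2"
    unfolding L2_def by (intro laplace_germ_affine_mult laplace_germ_cmult laplace_germ_reciprocal H)
  define \<rho> where "\<rho> \<kappa> = 1 * (1 + (L2 \<kappa> - 2 * h') / \<kappa>)" for \<kappa>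
  show thesis
  proof (rule that[of L2 1 \<rho> "2 * h'"])
    show "laplace_germ L2" by (rule L2)
    show "\<forall>\<kappa>. \<rho> \<kappa> = 1 * (1 + (L2 \<kappa> - 2 * h') / \<kappa>)" by (simp add: \<rho>_def)
    show "\<forall>\<^sub>F \<kappa> in at_top. \<forall>b u u' v v'. u b = 1 \<longrightarrow> u' b = - complex_of_real \<kappa> \<longrightarrow> v b = 1 \<longrightarrow> v' b = complex_of_real \<kappa> \<longrightarrow>
       boundary_condition b h (\<lambda>x. u x + of_real (\<rho> \<kappa>) * v x) (\<lambda>x. u' x + of_real (\<rho> \<kappa>) * v' x)"
      using eventually_gt_at_top[of "\<bar>h'\<bar>"]
    proof eventually_elim
      case (elim \<kappa>)
      then have k: "\<kappa> > 0" "\<kappa> + h' \<noteq> 0" by linarith+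
      have "1 + H \<kappa> = \<kappa> / (\<kappa> + h')"
        unfolding H_def using k by (simp add: field_simps)
      then have "\<rho> \<kappa> = 1 + (\<kappa> / (\<kappa> + h') * (2 * h'\<^sup>2 * (1 / \<kappa>)) - 2 * h') / \<kappa>"
        unfolding \<rho>_def L2_def by simp
      also have "\<dots> = (\<kappa> - h') / (\<kappa> + h')"
        using k by (simp add: divide_simps power2_eq_square) (simp add: algebra_simps)
      finally have "\<rho> \<kappa> * (\<kappa> + h') = \<kappa> - h'" using k by simp
      then have "- \<kappa> + \<rho> \<kappa> * \<kappa> + h' * (1 + \<rho> \<kappa>) = 0" by (simp add: algebra_simps)
      then have "complex_of_real (- \<kappa> + \<rho> \<kappa> * \<kappa> + h' * (1 + \<rho> \<kappa>)) = 0" by simp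
      then show ?case by (simp add: Finite_h)
    qed
  qed (auto simp: Finite_h)
qed

text \<open>The potential is here integrable with respect to \<open>lborel\<close> and vanishes off
  the interval everywhere, so all integrals run over the whole line. The error does not involve
  \<open>a\<close>; the transform is cut off at \<open>a\<close> only afterwards.\<close>

theorem m_function_expansion:
  fixes q :: "real \<Rightarrow> real"
  assumes b: "0 < b" and q: "integrable lborel q" and q0: "\<And>x. x \<notin> {0<..<b} \<Longrightarrow> q x = 0"
  shows "\<exists>F C. laplace_germ F \<and> (\<forall>\<^sub>F \<kappa> in at_top. \<exists>m. m_function q b h (of_real (- (\<kappa>\<^sup>2))) = of_real m \<and>
     \<bar>m - (- \<kappa> - F \<kappa> - coeff_A1 h * \<kappa> * exp (- 2 * \<kappa> * b) - coeff_B1 q b h * exp (- 2 * \<kappa> * b))\<bar>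
       \<le> C * (\<kappa> * exp (- 2 * \<kappa> * b) ^ 2))"
proof -
  have qm[measurable]: "q \<in> borel_measurable borel" using q by auto
  define Q where "Q = (LINT y|lborel. q y)"
  have Q: "(LINT y:{0<..<b}|lebesgue. q y) = Q"
  proof -
    have "(\<lambda>y. indicator {0<..<b} y *\<^sub>R q y) = q" using q0 by (auto simp: indicator_def fun_eq_iff)
    then show ?thesis unfolding set_lebesgue_integral_def Q_def by (simp add: integral_completion)
  qed
  \<comment> \<open>At this rate the Volterra ratio \<open>r\<close> is below 1/2, hence the bound
    \<open>R = r / (1 - r)\<close> on both remainders is below 1. This makes the first Volterra
    solution \<open>1 + S1\<close> positive, as the uniqueness argument requires.\<close>
  define c where "c = (LINT y|lborel. \<bar>q y\<bar>) + 1"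
  define r where "r = (LINT y|lborel. \<bar>q y\<bar>) / (2 * c)"
  have qn: "(LINT y|lborel. \<bar>q y\<bar>) \<ge> 0" by (simp add: integral_nonneg_AE)
  have "t + 1 > 0 \<and> t / (2 * (t + 1)) < 1 / 2 \<and> 0 \<le> t / (2 * (t + 1))" if "t \<ge> 0" for t :: real
    using that by (simp add: pos_divide_less_eq)
  from this[OF qn] have c: "c > 0" and r: "r < 1 / 2" "r \<ge> 0" unfolding c_def r_def by auto
  define R where "R = r / (1 - r)"
  have R: "R < 1" "R \<ge> 0" unfolding R_def using r by (auto simp: field_simps)
  have r1: "r < 1" using r by simp
  \<comment> \<open>Relative to the factor \<open>exp (\<kappa> * (b - x))\<close> the free solution
    with derivative -\<kappa> at \<open>b\<close> is the constant 1, and the one with derivative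
    \<kappa> is \<open>exp (- 2 * \<kappa> * (b - x))\<close>; the translations are accordingly 0
    and \<tau>.\<close>
  define \<tau> where "\<tau> x = max 0 (b - x)" for x
  obtain S1 where S1: "laplace_class lborel c (\<lambda>_. R) S1"
    "\<forall>x. \<forall>\<kappa>\<ge>c. S1 x \<kappa> = volterra_op q (\<lambda>x \<kappa>. exp (- 2 * \<kappa> * 0) + S1 x \<kappa>) x \<kappa>"
    by (rule volterra_solution[of "\<lambda>_. 0", OF _ _ q c r_def r1, folded R_def]) (rule borel_measurable_const, rule order_refl, rule that)
  obtain S2 where S2: "laplace_class lborel c (\<lambda>_. R) S2"
    "\<forall>x. \<forall>\<kappa>\<ge>c. S2 x \<kappa> = volterra_op q (\<lambda>x \<kappa>. exp (- 2 * \<kappa> * \<tau> x) + S2 x \<kappa>) x \<kappa>"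
    by (rule volterra_solution[of \<tau>, OF _ _ q c r_def r1, folded R_def]) (simp add: \<tau>_def[abs_def], simp add: \<tau>_def, rule that)
  define J where "J S \<kappa> = (LINT y|lborel. q y * S y \<kappa>)" for S :: "real \<Rightarrow> real \<Rightarrow> real" and \<kappa>
  define K where "K S \<kappa> = (LINT y|lborel. q y * (exp (- 2 * \<kappa> * max 0 y) * S y \<kappa>))" for S :: "real \<Rightarrow> real \<Rightarrow> real" and \<kappa>
  have J: "laplace_germ (J S)" and K: "laplace_germ (K S)" if "laplace_class lborel c (\<lambda>_. R) S" for S
  proof -
    show "laplace_germ (J S)"
      unfolding J_def by (rule laplace_germ_weighted_integral[OF that q c R(2)])
    have "laplace_class lborel c (\<lambda>_. R) (\<lambda>y \<kappa>. exp (- 2 * \<kappa> * max 0 y) * S y \<kappa>)"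
    proof (rule laplace_class_cong[OF laplace_class_shift[OF that]])
      show "exp (- 2 * c * max 0 x) * R \<le> R" for x
        using c R(2) by (intro mult_left_le_one_le) auto
    qed auto
    from laplace_germ_weighted_integral[OF this q c R(2)] show "laplace_germ (K S)" unfolding K_def .
  qed
  \<comment> \<open>The potential is the kernel of its own transform.\<close>
  define q1 where "q1 \<kappa> = (LINT \<alpha>|lborel. q \<alpha> * exp (- 2 * \<kappa> * \<alpha>))" for \<kappa>
  have q1: "laplace_germ q1" unfolding q1_def by (rule laplace_germ_integrable[OF q]) (use q0 in auto)
  \<comment> \<open>The substitution \<alpha> = b - y of the integral of
    \<open>q y * exp (- 2 * \<kappa> * (b - y))\<close>, again supported on the interval from 0 to
    \<open>b\<close>.\<close>
  define q2 where "q2 \<kappa> = (LINT \<alpha>|lborel. q (b - \<alpha>) * exp (- 2 * \<kappa> * \<alpha>))" for \<kappa>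
  have q2: "laplace_germ q2" unfolding q2_def
  proof (rule laplace_germ_integrable)
    show "integrable lborel (\<lambda>\<alpha>. q (b - \<alpha>))"
      using lborel_integrable_real_affine[OF q, of "- 1" b] by simp
  qed (use q0 in auto)
  define g1 where "g1 \<kappa> = J S1 \<kappa> + - 1 * (q1 \<kappa> + K S1 \<kappa>)" for \<kappa>
  define g2 where "g2 \<kappa> = q2 \<kappa> + (J S2 \<kappa> + - 1 * K S2 \<kappa>)" for \<kappa>
  define n where "n \<kappa> = q1 \<kappa> + K S1 \<kappa>" for \<kappa>
  have germs: "laplace_germ g1" "laplace_germ g2" "laplace_germ n"
    unfolding g1_def g2_def n_def by (intro laplace_germ_add laplace_germ_cmult J K S1(1) S2(1) q1 q2)+
  define P where "P \<kappa> = 1 + (Q + g1 \<kappa>) / (2 * \<kappa>)" for \<kappa>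
  define s where "s \<kappa> = exp (- 2 * \<kappa> * b) * (1 - Q / (2 * \<kappa>)) + g2 \<kappa> / (2 * \<kappa>)" for \<kappa>
  obtain \<rho> L2 :: "real \<Rightarrow> real" and \<rho>0 \<eta> :: real where L2: "laplace_germ L2" and \<rho>: "\<bar>\<rho>0\<bar> = 1"
    "\<forall>\<kappa>. \<rho> \<kappa> = \<rho>0 * (1 + (L2 \<kappa> - \<eta>) / \<kappa>)"
    and A1: "coeff_A1 h = - 2 * \<rho>0" and B1: "\<forall>q b. coeff_B1 q b h = 2 * \<rho>0 * (\<eta> + (LINT y:{0<..<b}|lebesgue. q y))"
    and bc: "\<forall>\<^sub>F \<kappa> in at_top. \<forall>b u u' v v'. u b = 1 \<longrightarrow> u' b = - complex_of_real \<kappa> \<longrightarrow> v b = 1 \<longrightarrow> v' b = complex_of_real \<kappa> \<longrightarrow>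
       boundary_condition b h (\<lambda>x. u x + of_real (\<rho> \<kappa>) * v x) (\<lambda>x. u' x + of_real (\<rho> \<kappa>) * v' x)"
    by (rule reflection_coefficient[of h]) (rule that)
  obtain F C where F: "laplace_germ F" and FC: "\<forall>\<^sub>F \<kappa> in at_top. P \<kappa> \<noteq> 0 \<and> P \<kappa> + \<rho> \<kappa> * s \<kappa> \<noteq> 0 \<and>
     \<bar>2 * \<kappa> * \<rho> \<kappa> * exp (- 2 * \<kappa> * b) / (P \<kappa> * (P \<kappa> + \<rho> \<kappa> * s \<kappa>)) - n \<kappa> / P \<kappa>
      - (2 * \<rho>0 * (\<kappa> - \<eta> - Q) * exp (- 2 * \<kappa> * b) - F \<kappa>)\<bar> \<le> C * (\<kappa> * exp (- 2 * \<kappa> * b) ^ 2)"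
    using reflection_expansion[OF b germs(1,2) L2 germs(3) P_def s_def \<rho>(2)[rule_format] \<rho>(1)] by (elim exE conjE) (rule that)
  have "\<forall>\<^sub>F \<kappa> in at_top. \<exists>m. m_function q b h (of_real (- (\<kappa>\<^sup>2))) = of_real m \<and>
     \<bar>m - (- \<kappa> - F \<kappa> - coeff_A1 h * \<kappa> * exp (- 2 * \<kappa> * b) - coeff_B1 q b h * exp (- 2 * \<kappa> * b))\<bar>
       \<le> C * (\<kappa> * exp (- 2 * \<kappa> * b) ^ 2)"
    using FC bc eventually_ge_at_top[of c]
  proof eventually_elim
    case (elim \<kappa>)
    have k: "\<kappa> > 0" using elim c by linarith
    have Sb: "\<bar>S1 x \<kappa>\<bar> \<le> R" "\<bar>S2 x \<kappa>\<bar> \<le> R" for x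
      using laplace_class_abs_le[OF S1(1) _ elim(3), of x] laplace_class_abs_le[OF S2(1) _ elim(3), of x] R by auto
    have Sm[measurable]: "(\<lambda>x. S1 x \<kappa>) \<in> borel_measurable borel" "(\<lambda>x. S2 x \<kappa>) \<in> borel_measurable borel"
      using laplace_class_measurable[OF S1(1) elim(3)] laplace_class_measurable[OF S2(1) elim(3)] by auto
    have qi: "integrable lborel (\<lambda>y. q y * f y)" if "f \<in> borel_measurable borel" "\<And>y. \<bar>f y\<bar> \<le> B" for f and B :: real
    proof (rule Bochner_Integration.integrable_bound[OF integrable_mult_left[OF q, of B]])
      have "B \<ge> 0" using that(2)[of 0] by linarith
      then show "AE y in lborel. norm (q y * f y) \<le> norm (q y * B)"
        using that(2) by (auto simp: abs_mult intro!: mult_left_mono)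
    qed (use that in auto)
    have expb: "\<bar>exp (- 2 * \<kappa> * max 0 y)\<bar> \<le> 1" for y using k by simp
    define p1 where "p1 x = 1 + S1 x \<kappa>" for x
    define e2 where "e2 x = exp (- 2 * \<kappa> * \<tau> x)" for x
    define p2 where "p2 x = e2 x + S2 x \<kappa>" for x
    have e2b: "\<bar>e2 y\<bar> \<le> 1" for y using k unfolding e2_def \<tau>_def by simp
    have [measurable]: "p1 \<in> borel_measurable borel" "p2 \<in> borel_measurable borel" "e2 \<in> borel_measurable borel"
      unfolding p1_def[abs_def] p2_def[abs_def] e2_def[abs_def] \<tau>_def[abs_def] by measurable
    have p1b: "\<bar>p1 x\<bar> \<le> 2" and p2b: "\<bar>p2 x\<bar> \<le> 2" and p1pos: "p1 x > 0" for x
      using Sb[of x] R e2b[of x] unfolding p1_def p2_def by linarith+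
    have p1eq: "p1 x = 1 + volterra_op q (\<lambda>y _. p1 y) x \<kappa>" for x
      using S1(2)[rule_format, OF elim(3), of x] unfolding p1_def volterra_op_def by simp
    have p2eq: "p2 x = e2 x + volterra_op q (\<lambda>y _. p2 y) x \<kappa>" for x
      using S2(2)[rule_format, OF elim(3), of x] unfolding p2_def e2_def volterra_op_def by simp
    define w1 where "w1 x = exp (\<kappa> * (b - x)) * p1 x" for x
    define w2 where "w2 x = exp (\<kappa> * (b - x)) * p2 x" for x
    have init1: "exp (\<kappa> * (b - x)) * 1 = 0 * exp (\<kappa> * x) + exp (\<kappa> * b) * exp (- \<kappa> * x)" for x
      by (simp add: exp_add[symmetric] algebra_simps)
    have init2: "exp (\<kappa> * (b - x)) * e2 x = exp (- \<kappa> * b) * exp (\<kappa> * x) + 0 * exp (- \<kappa> * x)"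
      if "x \<in> {0..b}" for x
      using that unfolding e2_def \<tau>_def by (simp add: exp_add[symmetric] algebra_simps)
    obtain w1' where w1: "schroedinger_solution q b (of_real (- (\<kappa>\<^sup>2))) (\<lambda>x. of_real (w1 x)) (\<lambda>x. of_real (w1' x))"
      "w1 b = 0 * exp (\<kappa> * b) + exp (\<kappa> * b) * exp (- \<kappa> * b)" "w1' b = \<kappa> * 0 * exp (\<kappa> * b) - \<kappa> * exp (\<kappa> * b) * exp (- \<kappa> * b)"
      "w1' 0 = \<kappa> * 0 - \<kappa> * exp (\<kappa> * b) - exp (\<kappa> * b) * ((LINT y|lborel. q y * p1 y) + (LINT y|lborel. exp (- 2 * \<kappa> * y) * (q y * p1 y))) / 2"
      "w1 0 = 0 + exp (\<kappa> * b) + exp (\<kappa> * b) * ((LINT y|lborel. q y * p1 y) - (LINT y|lborel. exp (- 2 * \<kappa> * y) * (q y * p1 y))) / (2 * \<kappa>)"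
      by (rule volterra_schroedinger_solution[OF b q q0 k _ p1b p1eq init1, folded w1_def]) (assumption, simp, rule that)
    obtain w2' where w2: "schroedinger_solution q b (of_real (- (\<kappa>\<^sup>2))) (\<lambda>x. of_real (w2 x)) (\<lambda>x. of_real (w2' x))"
      "w2 b = exp (- \<kappa> * b) * exp (\<kappa> * b) + 0 * exp (- \<kappa> * b)" "w2' b = \<kappa> * exp (- \<kappa> * b) * exp (\<kappa> * b) - \<kappa> * 0 * exp (- \<kappa> * b)"
      "w2' 0 = \<kappa> * exp (- \<kappa> * b) - \<kappa> * 0 - exp (\<kappa> * b) * ((LINT y|lborel. q y * p2 y) + (LINT y|lborel. exp (- 2 * \<kappa> * y) * (q y * p2 y))) / 2"
      "w2 0 = exp (- \<kappa> * b) + 0 + exp (\<kappa> * b) * ((LINT y|lborel. q y * p2 y) - (LINT y|lborel. exp (- 2 * \<kappa> * y) * (q y * p2 y))) / (2 * \<kappa>)"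
      by (rule volterra_schroedinger_solution[OF b q q0 k _ p2b p2eq init2, folded w2_def]) (assumption, simp, assumption, rule that)
    \<comment> \<open>The potential vanishes for y \<le> 0, so the exponential may be put in the
      form with a nonnegative translation used in \<open>K\<close>.\<close>
    have expmax: "exp (- 2 * \<kappa> * y) * (q y * f) = q y * (exp (- 2 * \<kappa> * max 0 y) * f)" for y f
      using q0[of y] by (cases "y > 0") auto
    have I1: "(LINT y|lborel. q y * p1 y) = Q + J S1 \<kappa>"
      unfolding p1_def Q_def J_def distrib_left using q qi[OF Sm(1) Sb(1)] by simp
    have I2: "(LINT y|lborel. exp (- 2 * \<kappa> * y) * (q y * p1 y)) = q1 \<kappa> + K S1 \<kappa>"
    proof -
      have "(LINT y|lborel. exp (- 2 * \<kappa> * y) * (q y * p1 y))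
         = (LINT y|lborel. q y * (exp (- 2 * \<kappa> * max 0 y) * 1) + q y * (exp (- 2 * \<kappa> * max 0 y) * S1 y \<kappa>))"
        unfolding expmax p1_def by (simp add: distrib_left)
      also have "\<dots> = (LINT y|lborel. q y * (exp (- 2 * \<kappa> * max 0 y) * 1)) + K S1 \<kappa>"
        unfolding K_def
      proof (rule Bochner_Integration.integral_add)
        show "integrable lborel (\<lambda>y. q y * (exp (- 2 * \<kappa> * max 0 y) * 1))"
          by (rule qi[where B = 1]) (use expb in auto)
        show "integrable lborel (\<lambda>y. q y * (exp (- 2 * \<kappa> * max 0 y) * S1 y \<kappa>))"
        proof (rule qi[where B = "1 * R"])
          show "\<bar>exp (- 2 * \<kappa> * max 0 y) * S1 y \<kappa>\<bar> \<le> 1 * R" for y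
            unfolding abs_mult by (intro mult_mono expb Sb) auto
        qed measurable
      qed
      also have "(LINT y|lborel. q y * (exp (- 2 * \<kappa> * max 0 y) * 1)) = q1 \<kappa>"
        unfolding q1_def expmax[symmetric] by (simp add: mult.commute)
      finally show ?thesis .
    qed
    have q2eq: "(LINT y|lborel. q y * e2 y) = q2 \<kappa>"
    proof -
      have "(LINT y|lborel. q y * e2 y) = (LINT y|lborel. q (b - y) * e2 (b - y))"
        using lborel_integral_real_affine[of "- 1" "\<lambda>y. q y * e2 y" b] by simp
      also have "\<dots> = q2 \<kappa>"
        unfolding q2_def
      proof (rule Bochner_Integration.integral_cong[OF refl])
        fix y
        show "q (b - y) * e2 (b - y) = q (b - y) * exp (- 2 * \<kappa> * y)"
          using q0[of "b - y"] by (cases "y > 0") (auto simp: e2_def \<tau>_def)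
      qed
      finally show ?thesis .
    qed
    have I3: "(LINT y|lborel. q y * p2 y) = q2 \<kappa> + J S2 \<kappa>"
      unfolding p2_def J_def distrib_left q2eq[symmetric]
      by (rule Bochner_Integration.integral_add[OF qi[OF _ e2b] qi[OF Sm(2) Sb(2)]]) measurable
    have I4: "(LINT y|lborel. exp (- 2 * \<kappa> * y) * (q y * p2 y)) = exp (- 2 * \<kappa> * b) * Q + K S2 \<kappa>"
    proof -
      \<comment> \<open>The two exponentials, of y and of \<open>b - y\<close>, multiply to the
        constant \<open>exp (- 2 * \<kappa> * b)\<close>. This product is the origin of the term
        with \<open>Q\<close> in \<open>s\<close>.\<close>
      have qe: "q y * (exp (- 2 * \<kappa> * max 0 y) * e2 y) = exp (- 2 * \<kappa> * b) * q y" for y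
      proof (cases "y \<in> {0<..<b}")
        case True
        then show ?thesis unfolding e2_def \<tau>_def by (simp add: exp_add[symmetric] algebra_simps)
      qed (simp add: q0)
      have "(LINT y|lborel. exp (- 2 * \<kappa> * y) * (q y * p2 y))
         = (LINT y|lborel. exp (- 2 * \<kappa> * b) * q y + q y * (exp (- 2 * \<kappa> * max 0 y) * S2 y \<kappa>))"
        unfolding expmax p2_def distrib_left qe ..
      also have "\<dots> = (LINT y|lborel. exp (- 2 * \<kappa> * b) * q y) + K S2 \<kappa>"
        unfolding K_def
      proof (rule Bochner_Integration.integral_add)
        show "integrable lborel (\<lambda>y. exp (- 2 * \<kappa> * b) * q y)" using q by simp
        show "integrable lborel (\<lambda>y. q y * (exp (- 2 * \<kappa> * max 0 y) * S2 y \<kappa>))"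
        proof (rule qi[where B = "1 * R"])
          show "\<bar>exp (- 2 * \<kappa> * max 0 y) * S2 y \<kappa>\<bar> \<le> 1 * R" for y
            unfolding abs_mult by (intro mult_mono expb Sb) auto
        qed measurable
      qed
      finally show ?thesis unfolding Q_def by simp
    qed
    have EE: "exp (- \<kappa> * b) = exp (\<kappa> * b) * exp (- 2 * \<kappa> * b)"
      by (simp add: exp_add[symmetric] algebra_simps)
    have w10: "w1 0 = exp (\<kappa> * b) * P \<kappa>"
      unfolding w1(5) I1 I2 P_def g1_def by (simp add: algebra_simps)
    have w20: "w2 0 = exp (\<kappa> * b) * s \<kappa>"
      unfolding w2(5) I3 I4 s_def g2_def EE
      by (simp add: algebra_simps add_divide_distrib diff_divide_distrib)
    \<comment> \<open>The integral of \<open>q * p1\<close>, whose leading part is the constant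
      \<open>Q\<close>, drops out of this combination; only the one with the additional exponential
      survives, and that is a germ.\<close>
    have w1'0: "w1' 0 = - \<kappa> * w1 0 - exp (\<kappa> * b) * n \<kappa>"
      unfolding w1(4,5) I1 I2 n_def using k by (simp add: field_simps)
    have wb: "w1 b = 1" "w1' b = - \<kappa>" "w2 b = 1" "w2' b = \<kappa>"
      using w1(2,3) w2(2,3) by (simp_all add: exp_minus mult.assoc)
    \<comment> \<open>The Wronskian is evaluated at \<open>b\<close>, where the data (1, \<kappa>)
      and (1, -\<kappa>) give 2\<kappa>, and transported to 0.\<close>
    have "of_real (w2' 0) * complex_of_real (w1 0) - of_real (w2 0) * complex_of_real (w1' 0)
      = of_real (w2' b) * of_real (w1 b) - of_real (w2 b) * of_real (w1' b)"
      by (rule wronskian_constant[OF w2(1) w1(1)]) (use b in auto)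
    then have "complex_of_real (w2' 0 * w1 0 - w2 0 * w1' 0) = complex_of_real (2 * \<kappa>)"
      by (simp add: wb)
    then have W: "w2' 0 * w1 0 - w2 0 * w1' 0 = 2 * \<kappa>" by (simp only: of_real_eq_iff)
    define v where "v = w1 0 + \<rho> \<kappa> * w2 0"
    define v' where "v' = w1' 0 + \<rho> \<kappa> * w2' 0"
    have v_eq: "v = exp (\<kappa> * b) * (P \<kappa> + \<rho> \<kappa> * s \<kappa>)" unfolding v_def w10 w20 by (simp add: algebra_simps)
    have ne: "v \<noteq> 0" "w1 0 \<noteq> 0" using elim(1) unfolding v_eq w10 by auto
    have "m_function q b h (of_real (- (\<kappa>\<^sup>2)))
      = (of_real (w1' 0) + of_real (\<rho> \<kappa>) * of_real (w2' 0)) / (of_real (w1 0) + of_real (\<rho> \<kappa>) * of_real (w2 0))"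
    proof (rule m_function_eqI[OF b schroedinger_solution_add_mult[OF w1(1) w2(1)] _ _ w1(1)])
      show "boundary_condition b h (\<lambda>x. of_real (w1 x) + of_real (\<rho> \<kappa>) * of_real (w2 x))
         (\<lambda>x. of_real (w1' x) + of_real (\<rho> \<kappa>) * of_real (w2' x))"
        by (rule elim(2)[rule_format]) (simp_all add: wb)
      show "complex_of_real (w1 0) + of_real (\<rho> \<kappa>) * of_real (w2 0) \<noteq> 0"
        using ne(1) unfolding v_def by (metis of_real_add of_real_eq_0_iff of_real_mult)
      \<comment> \<open>The positive first solution plays the part of the nowhere vanishing
        \<psi>.\<close>
      show "complex_of_real (w1 x) \<noteq> 0" for x
        using p1pos[of x] unfolding w1_def by simp
    qed
    then have m: "m_function q b h (of_real (- (\<kappa>\<^sup>2))) = of_real (v' / v)"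
      unfolding v_def v'_def by simp
    \<comment> \<open>Adding a multiple of \<open>w2\<close> to \<open>w1\<close> changes the
      logarithmic derivative by \<open>\<rho>\<close> times the Wronskian over the product of the
      two values. This isolates the effect of the boundary condition in one term.\<close>
    have "v' / v - w1' 0 / w1 0 = \<rho> \<kappa> * (w2' 0 * w1 0 - w2 0 * w1' 0) / (w1 0 * v)"
      using ne by (simp add: v'_def field_simps) (simp add: v_def algebra_simps)
    also have "\<dots> = 2 * \<kappa> * \<rho> \<kappa> / (exp (\<kappa> * b) * exp (\<kappa> * b) * (P \<kappa> * (P \<kappa> + \<rho> \<kappa> * s \<kappa>)))"
      unfolding W unfolding w10 v_eq by (simp add: ac_simps)
    also have "\<dots> = 2 * \<kappa> * \<rho> \<kappa> * exp (- 2 * \<kappa> * b) / (P \<kappa> * (P \<kappa> + \<rho> \<kappa> * s \<kappa>))"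
    proof -
      have *: "exp (\<kappa> * b) * exp (\<kappa> * b) = 1 / exp (- 2 * \<kappa> * b)"
        by (simp add: exp_add[symmetric] exp_minus field_simps)
      show ?thesis unfolding * by simp
    qed
    also have "w1' 0 / w1 0 = - \<kappa> - n \<kappa> / P \<kappa>"
      unfolding w1'0 using ne(2) by (simp add: diff_divide_distrib) (simp add: w10)
    finally have meq: "v' / v = - \<kappa> - n \<kappa> / P \<kappa> + 2 * \<kappa> * \<rho> \<kappa> * exp (- 2 * \<kappa> * b) / (P \<kappa> * (P \<kappa> + \<rho> \<kappa> * s \<kappa>))"
      by simp
    have "v' / v - (- \<kappa> - F \<kappa> - coeff_A1 h * \<kappa> * exp (- 2 * \<kappa> * b) - coeff_B1 q b h * exp (- 2 * \<kappa> * b))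
      = 2 * \<kappa> * \<rho> \<kappa> * exp (- 2 * \<kappa> * b) / (P \<kappa> * (P \<kappa> + \<rho> \<kappa> * s \<kappa>)) - n \<kappa> / P \<kappa>
      - (2 * \<rho>0 * (\<kappa> - \<eta> - Q) * exp (- 2 * \<kappa> * b) - F \<kappa>)"
      unfolding meq A1 B1[rule_format] Q by (simp add: algebra_simps)
    then show ?case using m elim(1) by (intro exI[of _ "v' / v"]) auto
  qed
  then show ?thesis using F by blast
qed

section \<open>Passage to the given potential and to the error class\<close>

lemma m_function_cong:
  assumes "AE x in lebesgue. x \<in> {0<..<b} \<longrightarrow> q x = q' x"
  shows "m_function q b h z = m_function q' b h z"
proof -
  \<comment> \<open>The potential enters only through a condition imposed almost everywhere on the
    open interval.\<close>
  have *: "schroedinger_solution p b z u u'"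
    if "AE x in lebesgue. x \<in> {0<..<b} \<longrightarrow> p' x = p x" "schroedinger_solution p' b z u u'" for p p' u u'
  proof -
    have "AE x in lebesgue. x \<in> {0<..<b} \<longrightarrow>
        (\<exists>u''. (u' has_vector_derivative u'') (at x) \<and> - u'' + complex_of_real (p' x) * u x = z * u x)"
      using that(2) unfolding schroedinger_solution_def by simp
    with that(1) have "AE x in lebesgue. x \<in> {0<..<b} \<longrightarrow>
        (\<exists>u''. (u' has_vector_derivative u'') (at x) \<and> - u'' + complex_of_real (p x) * u x = z * u x)"
      by eventually_elim auto
    then show ?thesis using that(2) unfolding schroedinger_solution_def by simp
  qed
  have sym: "AE x in lebesgue. x \<in> {0<..<b} \<longrightarrow> q' x = q x"
    using assms by eventually_elim auto
  have "schroedinger_solution q b z = schroedinger_solution q' b z"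
    using *[OF assms] *[OF sym] by (intro ext iffI) auto
  then show ?thesis unfolding m_function_def by simp
qed

text \<open>Dividing an ordinary big-O bound by the power 1 - \<epsilon> leaves
  \<open>C * exp (- 2 * a * \<epsilon> * \<kappa>)\<close>, which tends to 0 as \<open>a\<close> is
  positive.\<close>

lemma tilde_bigo_expI:
  fixes f :: "real \<Rightarrow> 'a::real_normed_vector"
  assumes f: "\<forall>\<^sub>F \<kappa> in at_top. norm (f \<kappa>) \<le> C * exp (- 2 * a * \<kappa>)" and "a > 0"
  shows "f \<in> tilde_bigo at_top (\<lambda>\<kappa>. exp (- 2 * a * \<kappa>) :: real)"
  unfolding tilde_bigo_def
proof (intro CollectI allI impI)
  fix \<epsilon> :: real assume "\<epsilon> > 0"
  have "filterlim (\<lambda>\<kappa>. (- 2 * a * \<epsilon>) * \<kappa>) at_bot at_top"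
    using \<open>a > 0\<close> \<open>\<epsilon> > 0\<close> by (intro filterlim_tendsto_neg_mult_at_bot[OF tendsto_const] filterlim_ident) auto
  then have "((\<lambda>\<kappa>. C * exp ((- 2 * a * \<epsilon>) * \<kappa>)) \<longlongrightarrow> C * 0) at_top"
    by (intro tendsto_mult tendsto_const filterlim_compose[OF exp_at_bot])
  then have lim: "((\<lambda>\<kappa>. C * exp ((- 2 * a * \<epsilon>) * \<kappa>)) \<longlongrightarrow> 0) at_top" by simp
  have "\<forall>\<^sub>F \<kappa> in at_top. norm (norm (f \<kappa>) / norm (exp (- 2 * a * \<kappa>)) powr (1 - \<epsilon>)) \<le> C * exp ((- 2 * a * \<epsilon>) * \<kappa>)"
    using f
  proof eventually_elim
    case (elim \<kappa>)
    have "norm (exp (- 2 * a * \<kappa>)) powr (1 - \<epsilon>) = exp (- 2 * a * \<kappa> * (1 - \<epsilon>))"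
      by (simp add: powr_def mult.commute)
    moreover have "norm (f \<kappa>) / exp (- 2 * a * \<kappa> * (1 - \<epsilon>)) \<le> C * exp (- 2 * a * \<kappa>) / exp (- 2 * a * \<kappa> * (1 - \<epsilon>))"
      using elim by (intro divide_right_mono) auto
    moreover have "C * exp (- 2 * a * \<kappa>) / exp (- 2 * a * \<kappa> * (1 - \<epsilon>)) = C * exp ((- 2 * a * \<epsilon>) * \<kappa>)"
      unfolding times_divide_eq_right[symmetric] exp_diff[symmetric] by (simp add: algebra_simps)
    ultimately show ?case by simp
  qed
  then show "((\<lambda>\<kappa>. norm (f \<kappa>) / norm (exp (- 2 * a * \<kappa>)) powr (1 - \<epsilon>)) \<longlongrightarrow> 0) at_top"
    by (rule Lim_null_comparison[OF _ lim])
qed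

theorem theorem1p6:
  fixes b :: real and q :: "real \<Rightarrow> real" and h :: bc_param
  assumes b_pos: "0 < b"
    and q_L1: "q absolutely_integrable_on {0<..<b}"
  shows "\<exists>A :: real \<Rightarrow> real.
    A \<in> borel_measurable (lebesgue_on {0<..<2 * b}) \<and>
    (\<forall>a. 0 < a \<and> a < 2 * b \<longrightarrow> A absolutely_integrable_on {0<..<a}) \<and>
    (\<forall>a. 0 < a \<and> a < 2 * b \<longrightarrow>
      (\<lambda>\<kappa>::real. m_function q b h (complex_of_real (- (\<kappa>\<^sup>2))) -
         complex_of_real
           (- \<kappa> - (LINT \<alpha>:{0<..<a}|lebesgue. A \<alpha> * exp (- 2 * \<alpha> * \<kappa>))
            - coeff_A1 h * \<kappa> * exp (- 2 * \<kappa> * b) - coeff_B1 q b h * exp (- 2 * \<kappa> * b)))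
      \<in> tilde_bigo at_top (\<lambda>\<kappa>::real. exp (- 2 * a * \<kappa>)))"
proof -
  have qi: "integrable lebesgue (\<lambda>x. indicator {0<..<b} x * q x)"
    using q_L1 unfolding set_integrable_def by simp
  then obtain p0 where p0: "p0 \<in> borel_measurable lborel" "AE x in lborel. indicator {0<..<b} x * q x = p0 x"
    using completion_ex_borel_measurable_real[of "\<lambda>x. indicator {0<..<b} x * q x" lborel] by auto
  \<comment> \<open>The given potential is only Lebesgue measurable, whereas the kernels are Borel
    in product spaces. Cutting off a Borel representative makes the support condition hold at every
    point rather than almost everywhere.\<close>
  define p where "p x = indicator {0<..<b} x * p0 x" for x
  have [measurable]: "p0 \<in> borel_measurable borel" using p0(1) by simp
  have pm[measurable]: "p \<in> borel_measurable borel" unfolding p_def[abs_def] by measurable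
  have p_AE': "AE x in lebesgue. indicator {0<..<b} x * q x = p0 x"
    using p0(2) by (rule AE_completion)
  then have p_AE: "AE x in lebesgue. indicator {0<..<b} x * q x = p x"
    by eventually_elim (auto simp: p_def split: split_indicator)
  then have qp: "AE x in lebesgue. x \<in> {0<..<b} \<longrightarrow> q x = p x"
    by eventually_elim (auto simp: indicator_def split: if_splits)
  have "integrable lebesgue p"
    by (rule integrable_cong_AE_imp[OF qi _ p_AE]) (rule measurable_completion, simp)
  then have p: "integrable lborel p" by (simp add: integrable_completion)
  have psupp: "p x = 0" if "x \<notin> {0<..<b}" for x using that by (simp add: p_def)
  have int_eq: "(LINT y:{0<..<b}|lebesgue. q y) = (LINT y:{0<..<b}|lebesgue. p y)"
    unfolding set_lebesgue_integral_def
  proof (rule integral_cong_AE)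
    show "(\<lambda>x. indicat_real {0<..<b} x *\<^sub>R q x) \<in> borel_measurable lebesgue" using qi by auto
    show "(\<lambda>x. indicat_real {0<..<b} x *\<^sub>R p x) \<in> borel_measurable lebesgue"
      by (rule measurable_completion) measurable
    show "AE x in lebesgue. indicat_real {0<..<b} x *\<^sub>R q x = indicat_real {0<..<b} x *\<^sub>R p x"
      using qp by eventually_elim (auto simp: indicator_def)
  qed
  have B1: "coeff_B1 q b h = coeff_B1 p b h" by (cases h) (auto simp: int_eq)
  have "\<exists>F C. laplace_germ F \<and> (\<forall>\<^sub>F \<kappa> in at_top. \<exists>m. m_function p b h (of_real (- (\<kappa>\<^sup>2))) = of_real m \<and>
     \<bar>m - (- \<kappa> - F \<kappa> - coeff_A1 h * \<kappa> * exp (- 2 * \<kappa> * b) - coeff_B1 p b h * exp (- 2 * \<kappa> * b))\<bar>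
       \<le> C * (\<kappa> * exp (- 2 * \<kappa> * b) ^ 2))"
    by (rule m_function_expansion[OF b_pos p psupp])
  then obtain F C where F: "laplace_germ F" and FC: "\<forall>\<^sub>F \<kappa> in at_top. \<exists>m. m_function p b h (of_real (- (\<kappa>\<^sup>2))) = of_real m \<and>
     \<bar>m - (- \<kappa> - F \<kappa> - coeff_A1 h * \<kappa> * exp (- 2 * \<kappa> * b) - coeff_B1 p b h * exp (- 2 * \<kappa> * b))\<bar>
       \<le> C * (\<kappa> * exp (- 2 * \<kappa> * b) ^ 2)"
    by (elim exE conjE) (rule that)
  obtain A where A: "A \<in> borel_measurable borel" "\<forall>a. A absolutely_integrable_on {0<..<a}"
    "\<forall>a. \<exists>C. \<forall>\<^sub>F \<kappa> in at_top.
       \<bar>F \<kappa> - (LINT \<alpha>:{0<..<a}|lebesgue. A \<alpha> * exp (- 2 * \<alpha> * \<kappa>))\<bar> \<le> C * exp (- 2 * a * \<kappa>)"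
    by (rule laplace_germ_truncation[OF F]) (rule that)
  show ?thesis
  proof (intro exI[of _ A] conjI allI impI)
    show "A \<in> borel_measurable (lebesgue_on {0<..<2 * b})"
      using A(1) by (intro measurable_restrict_space1 measurable_completion) simp
    fix a assume a: "0 < a \<and> a < 2 * b"
    show "A absolutely_integrable_on {0<..<a}" using A(2) by blast
    obtain C' where C': "\<forall>\<^sub>F \<kappa> in at_top.
       \<bar>F \<kappa> - (LINT \<alpha>:{0<..<a}|lebesgue. A \<alpha> * exp (- 2 * \<alpha> * \<kappa>))\<bar> \<le> C' * exp (- 2 * a * \<kappa>)"
      using A(3) by blast
    \<comment> \<open>Positive precisely because a < 2b. Since
      \<open>\<kappa> * exp (- 4 * \<kappa> * b)\<close> equals
      \<open>\<kappa> * exp (- d * \<kappa>) * exp (- 2 * a * \<kappa>)\<close> and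
      \<open>\<kappa> \<le> exp (d * \<kappa>) / d\<close>, the factor \<kappa> is absorbed at the
      price of the constant 1/d.\<close>
    define d where "d = 4 * b - 2 * a"
    have "d > 0" using a unfolding d_def by simp
    show "(\<lambda>\<kappa>::real. m_function q b h (complex_of_real (- (\<kappa>\<^sup>2))) -
         complex_of_real
           (- \<kappa> - (LINT \<alpha>:{0<..<a}|lebesgue. A \<alpha> * exp (- 2 * \<alpha> * \<kappa>))
            - coeff_A1 h * \<kappa> * exp (- 2 * \<kappa> * b) - coeff_B1 q b h * exp (- 2 * \<kappa> * b)))
      \<in> tilde_bigo at_top (\<lambda>\<kappa>::real. exp (- 2 * a * \<kappa>))"
    proof (rule tilde_bigo_expI)
      show "a > 0" using a by simp
      show "\<forall>\<^sub>F \<kappa> in at_top. norm (m_function q b h (complex_of_real (- (\<kappa>\<^sup>2))) -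
         complex_of_real
           (- \<kappa> - (LINT \<alpha>:{0<..<a}|lebesgue. A \<alpha> * exp (- 2 * \<alpha> * \<kappa>))
            - coeff_A1 h * \<kappa> * exp (- 2 * \<kappa> * b) - coeff_B1 q b h * exp (- 2 * \<kappa> * b)))
        \<le> (\<bar>C\<bar> / d + C') * exp (- 2 * a * \<kappa>)"
        using FC C' eventually_gt_at_top[of 0]
      proof eventually_elim
        case (elim \<kappa>)
        obtain m where m: "m_function p b h (of_real (- (\<kappa>\<^sup>2))) = of_real m"
          "\<bar>m - (- \<kappa> - F \<kappa> - coeff_A1 h * \<kappa> * exp (- 2 * \<kappa> * b) - coeff_B1 p b h * exp (- 2 * \<kappa> * b))\<bar>
            \<le> C * (\<kappa> * exp (- 2 * \<kappa> * b) ^ 2)" using elim(1) by blast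
        define I where "I = (LINT \<alpha>:{0<..<a}|lebesgue. A \<alpha> * exp (- 2 * \<alpha> * \<kappa>))"
        define T where "T = coeff_A1 h * \<kappa> * exp (- 2 * \<kappa> * b) + coeff_B1 p b h * exp (- 2 * \<kappa> * b)"
        have "norm (m_function q b h (complex_of_real (- (\<kappa>\<^sup>2))) -
         complex_of_real (- \<kappa> - I - coeff_A1 h * \<kappa> * exp (- 2 * \<kappa> * b) - coeff_B1 q b h * exp (- 2 * \<kappa> * b)))
         = \<bar>m - (- \<kappa> - I - T)\<bar>"
          unfolding m_function_cong[OF qp] m(1) B1 T_def of_real_diff[symmetric] norm_of_real
          by (simp add: algebra_simps)
        also have "\<dots> \<le> \<bar>m - (- \<kappa> - F \<kappa> - T)\<bar> + \<bar>F \<kappa> - I\<bar>" by linarith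
        also have "\<bar>m - (- \<kappa> - F \<kappa> - T)\<bar> \<le> C * (\<kappa> * exp (- 2 * \<kappa> * b) ^ 2)"
          using m(2) unfolding T_def by (simp add: algebra_simps)
        also have "C * (\<kappa> * exp (- 2 * \<kappa> * b) ^ 2) \<le> \<bar>C\<bar> * (1 / d * exp (- 2 * a * \<kappa>))"
        proof -
          have "d * \<kappa> \<le> exp (d * \<kappa>)" using exp_ge_add_one_self[of "d * \<kappa>"] by linarith
          then have "\<kappa> \<le> 1 / d * exp (d * \<kappa>)" using \<open>d > 0\<close> by (simp add: field_simps)
          then have "\<kappa> * exp (- 2 * \<kappa> * b) ^ 2 \<le> 1 / d * exp (d * \<kappa>) * exp (- 2 * \<kappa> * b) ^ 2"
            by (intro mult_right_mono) auto
          also have "\<dots> = 1 / d * exp (- 2 * a * \<kappa>)"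
            unfolding power2_eq_square mult.assoc d_def by (simp add: exp_add[symmetric] algebra_simps)
          finally have le: "\<kappa> * exp (- 2 * \<kappa> * b) ^ 2 \<le> 1 / d * exp (- 2 * a * \<kappa>)" .
          show ?thesis by (rule mult_mono[OF abs_ge_self le]) (use elim(3) in auto)
        qed
        finally show ?case using elim(2) unfolding I_def[symmetric] by (simp add: algebra_simps)
      qed
    qed
  qed
qed

end
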